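(* Let $(\mathcal{B},\mathcal{L},\theta,\mathcal{I}_\alpha)$ be a generalized Boolean dynamical system, and let $\{p_A,s_{\alpha,B}\}$ be the universal Cuntz--Krieger representation generating $C^*(\mathcal{B},\mathcal{L},\theta,\mathcal{I}_\alpha)$. Suppose that $\{P_A,S_{\alpha,B}:A\in\mathcal{B},\alpha\in\mathcal{L},B\in\mathcal{I}_\alpha\}$ is a Cuntz--Krieger representation of $(\mathcal{B},\mathcal{L},\theta,\mathcal{I}_\alpha)$ in a $C^*$-algebra $\mathcal{X}$, and let $\pi:C^*(\mathcal{B},\mathcal{L},\theta,\mathcal{I}_\alpha)\to\mathcal{X}$ be the unique $*$-homomorphism such that $\pi(p_A)=P_A$ and $\pi(s_{\alpha,B})=S_{\alpha,B}$ for all $A\in\mathcal{B}$, $\alpha\in\mathcal{L}$, $B\in\mathcal{I}_\alpha$. Then $\pi$ is injective if and only if the following properties hold: (1) $P_A\neq0$ whenever $A\neq\emptyset$; (2) for each $z\in\mathbb{T}$ there exists a $*$-homomorphism $\beta_z:C^*(P_A,S_{\alpha,B})\to C^*(P_A,S_{\alpha,B})$ such that $\beta_z(P_A)=P_A$ and $\beta_z(S_{\alpha,B})=zS_{\alpha,B}$ for all $A\in\mathcal{B}$, $\alpha\in\mathcal{L}$, $B\in\mathcal{I}_\alpha$.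
   Context: A Boolean algebra $\mathcal{B}$ (not necessarily unital) is a distributive lattice $(\mathcal{B},\cap,\cup)$ with least element $\emptyset$ and relative complements $A\setminus B$, satisfying $(A\cap B)\cup(A\setminus B)=A$ and $(A\cap B)\cap(A\setminus B)=\emptyset$. Write $A\subseteq B$ iff $A\cap B=A$. An ideal of $\mathcal{B}$ is a non-empty subset closed under finite unions and under intersection with arbitrary elements of $\mathcal{B}$. A Boolean dynamical system $(\mathcal{B},\mathcal{L},\theta)$ is a Boolean algebra $\mathcal{B}$, a set $\mathcal{L}$, and maps $\theta_\alpha:\mathcal{B}\to\mathcal{B}$ ($\alpha\in\mathcal{L}$) preserving $\cap,\cup,\setminus$ and $\emptyset$. For $A\in\mathcal{B}$ let $\Delta_A=\{\alpha\in\mathcal{L}:\theta_\alpha(A)\ne\emptyset\}$ and $\lambda_A=|\Delta_A|$. $A$ is regular if $0<\lambda_B<\infty$ for every $\emptyset\neq B\subseteq A$; $\mathcal{B}_{reg}$ is the ideal of regular elements (so $\emptyset\in\mathcal{B}_{reg}$). Let $\mathcal{R}_\alpha=\{A\in\mathcal{B}:A\subseteq\theta_\alpha(B)\text{ for some }B\in\mathcal{B}\}$. A generalized Boolean dynamical system $(\mathcal{B},\mathcal{L},\theta,\mathcal{I}_\alpha)$ consists of a Boolean dynamical system and ideals $\mathcal{I}_\alpha$ of $\mathcal{B}$ with $\mathcal{R}_\alpha\subseteq\mathcal{I}_\alpha$ ($\alpha\in\mathcal{L}$). A Cuntz--Krieger representation of it in a $C^*$-algebra is a family of projections $\{P_A:A\in\mathcal{B}\}$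 and partial isometries $\{S_{\alpha,B}:\alpha\in\mathcal{L},B\in\mathcal{I}_\alpha\}$ such that (i) $P_\emptyset=0$, $P_{A\cap A'}=P_AP_{A'}$, $P_{A\cup A'}=P_A+P_{A'}-P_{A\cap A'}$; (ii) $P_AS_{\alpha,B}=S_{\alpha,B}P_{\theta_\alpha(A)}$; (iii) $S_{\alpha,B}^*S_{\alpha',B'}=\delta_{\alpha,\alpha'}P_{B\cap B'}$; (iv) $P_A=\sum_{\alpha\in\Delta_A}S_{\alpha,\theta_\alpha(A)}S_{\alpha,\theta_\alpha(A)}^*$ for all $A\in\mathcal{B}_{reg}$. $C^*(P_A,S_{\alpha,B})$ denotes the $C^*$-subalgebra generated by the family. $C^*(\mathcal{B},\mathcal{L},\theta,\mathcal{I}_\alpha)$ is the $C^*$-algebra generated by a universal Cuntz--Krieger representation $\{p_A,s_{\alpha,B}\}$. *)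

theory Defs
  imports "HOL-Algebra.Module" "HOL-Analysis.Abstract_Metric_Spaces"
begin

section \<open>C*-algebras\<close>

definition complex_ring :: "complex ring" where
  "complex_ring = \<lparr>carrier = UNIV, mult = (*), one = 1, zero = 0, add = (+)\<rparr>"

text \<open>C*-algebras are not assumed unital: the field \<open>one\<close> inherited from the ring record of
  HOL-Algebra carries no meaning and is never referred to.\<close>

record 'a cstar = "(complex, 'a) module" +
  star :: "'a \<Rightarrow> 'a"
  nrm :: "'a \<Rightarrow> real"

text \<open>The value 0 off the carrier is needed because \<open>Metric_space\<close> asks for nonnegativity and
  symmetry of the distance on the whole type.\<close>

definition cdist :: "('a, 'm) cstar_scheme \<Rightarrow> 'a \<Rightarrow> 'a \<Rightarrow> real" where
  "cdist A x y = (if x \<in> carrier A \<and> y \<in> carrier A then nrm A (x \<ominus>\<^bsub>A\<^esub> y) else 0)"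

locale cstar_algebra = Module.module complex_ring A
  for A :: "('a, 'm) cstar_scheme" (structure) +
  assumes mult_closed: "\<lbrakk>x \<in> carrier A; y \<in> carrier A\<rbrakk> \<Longrightarrow> x \<otimes> y \<in> carrier A"
    and mult_assoc: "\<lbrakk>x \<in> carrier A; y \<in> carrier A; z \<in> carrier A\<rbrakk>
      \<Longrightarrow> (x \<otimes> y) \<otimes> z = x \<otimes> (y \<otimes> z)"
    and distrib_left: "\<lbrakk>x \<in> carrier A; y \<in> carrier A; z \<in> carrier A\<rbrakk>
      \<Longrightarrow> x \<otimes> (y \<oplus> z) = x \<otimes> y \<oplus> x \<otimes> z"
    and distrib_right: "\<lbrakk>x \<in> carrier A; y \<in> carrier A; z \<in> carrier A\<rbrakk>
      \<Longrightarrow> (x \<oplus> y) \<otimes> z = x \<otimes> z \<oplus> y \<otimes> z"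
    and smult_mult_left: "\<lbrakk>x \<in> carrier A; y \<in> carrier A\<rbrakk> \<Longrightarrow> (c \<odot> x) \<otimes> y = c \<odot> (x \<otimes> y)"
    and smult_mult_right: "\<lbrakk>x \<in> carrier A; y \<in> carrier A\<rbrakk> \<Longrightarrow> x \<otimes> (c \<odot> y) = c \<odot> (x \<otimes> y)"
    and star_closed: "x \<in> carrier A \<Longrightarrow> star A x \<in> carrier A"
    and star_star: "x \<in> carrier A \<Longrightarrow> star A (star A x) = x"
    and star_add: "\<lbrakk>x \<in> carrier A; y \<in> carrier A\<rbrakk> \<Longrightarrow> star A (x \<oplus> y) = star A x \<oplus> star A y"
    and star_smult: "x \<in> carrier A \<Longrightarrow> star A (c \<odot> x) = cnj c \<odot> star A x"
    and star_mult: "\<lbrakk>x \<in> carrier A; y \<in> carrier A\<rbrakk> \<Longrightarrow> star A (x \<otimes> y) = star A y \<otimes> star A x"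
    and nrm_nonneg: "x \<in> carrier A \<Longrightarrow> 0 \<le> nrm A x"
    and nrm_eq_0_iff: "x \<in> carrier A \<Longrightarrow> nrm A x = 0 \<longleftrightarrow> x = \<zero>"
    and nrm_triangle: "\<lbrakk>x \<in> carrier A; y \<in> carrier A\<rbrakk> \<Longrightarrow> nrm A (x \<oplus> y) \<le> nrm A x + nrm A y"
    and nrm_smult: "x \<in> carrier A \<Longrightarrow> nrm A (c \<odot> x) = cmod c * nrm A x"
    and nrm_mult: "\<lbrakk>x \<in> carrier A; y \<in> carrier A\<rbrakk> \<Longrightarrow> nrm A (x \<otimes> y) \<le> nrm A x * nrm A y"
    and cstar_identity: "x \<in> carrier A \<Longrightarrow> nrm A (star A x \<otimes> x) = (nrm A x)\<^sup>2"
    and complete: "Metric_space.mcomplete (carrier A) (cdist A)"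

definition cstar_subalgebra :: "('a, 'm) cstar_scheme \<Rightarrow> 'a set \<Rightarrow> bool" where
  "cstar_subalgebra A D \<longleftrightarrow>
     D \<subseteq> carrier A \<and> \<zero>\<^bsub>A\<^esub> \<in> D \<and>
     (\<forall>x\<in>D. \<forall>y\<in>D. x \<oplus>\<^bsub>A\<^esub> y \<in> D) \<and>
     (\<forall>c. \<forall>x\<in>D. c \<odot>\<^bsub>A\<^esub> x \<in> D) \<and>
     (\<forall>x\<in>D. \<forall>y\<in>D. x \<otimes>\<^bsub>A\<^esub> y \<in> D) \<and>
     (\<forall>x\<in>D. star A x \<in> D) \<and>
     closedin (Metric_space.mtopology (carrier A) (cdist A)) D"

definition cstar_generated :: "('a, 'm) cstar_scheme \<Rightarrow> 'a set \<Rightarrow> 'a set" where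
  "cstar_generated A G = \<Inter>{D. cstar_subalgebra A D \<and> G \<subseteq> D}"

definition star_hom :: "('a, 'm) cstar_scheme \<Rightarrow> ('c, 'n) cstar_scheme \<Rightarrow> ('a \<Rightarrow> 'c) \<Rightarrow> bool" where
  "star_hom A B f \<longleftrightarrow>
     f \<in> carrier A \<rightarrow> carrier B \<and>
     (\<forall>x\<in>carrier A. \<forall>y\<in>carrier A. f (x \<oplus>\<^bsub>A\<^esub> y) = f x \<oplus>\<^bsub>B\<^esub> f y) \<and>
     (\<forall>c. \<forall>x\<in>carrier A. f (c \<odot>\<^bsub>A\<^esub> x) = c \<odot>\<^bsub>B\<^esub> f x) \<and>
     (\<forall>x\<in>carrier A. \<forall>y\<in>carrier A. f (x \<otimes>\<^bsub>A\<^esub> y) = f x \<otimes>\<^bsub>B\<^esub> f y) \<and>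
     (\<forall>x\<in>carrier A. f (star A x) = star B (f x))"

definition projection :: "('a, 'm) cstar_scheme \<Rightarrow> 'a \<Rightarrow> bool" where
  "projection A x \<longleftrightarrow> x \<in> carrier A \<and> x \<otimes>\<^bsub>A\<^esub> x = x \<and> star A x = x"

definition partial_isometry :: "('a, 'm) cstar_scheme \<Rightarrow> 'a \<Rightarrow> bool" where
  "partial_isometry A x \<longleftrightarrow> x \<in> carrier A \<and> x \<otimes>\<^bsub>A\<^esub> star A x \<otimes>\<^bsub>A\<^esub> x = x"


section \<open>Generalized Boolean dynamical systems\<close>

text \<open>Boolean algebras without a top element; \<open>A - B\<close> is the relative complement.\<close>

class generalized_boolean_algebra = distrib_lattice + order_bot + minus +
  assumes sup_inf_diff: "sup (inf A B) (A - B) = A"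
    and inf_inf_diff: "inf (inf A B) (A - B) = bot"

definition boolean_ideal :: "'b::generalized_boolean_algebra set \<Rightarrow> bool" where
  "boolean_ideal J \<longleftrightarrow> J \<noteq> {} \<and> (\<forall>A\<in>J. \<forall>B\<in>J. sup A B \<in> J) \<and> (\<forall>A\<in>J. \<forall>B. inf A B \<in> J)"

text \<open>The labels form a set \<open>L\<close>, possibly empty, inside the type \<open>'l\<close>.\<close>

locale boolean_dynamical_system =
  fixes L :: "'l set" and \<theta> :: "'l \<Rightarrow> 'b::generalized_boolean_algebra \<Rightarrow> 'b"
  assumes theta_inf: "\<alpha> \<in> L \<Longrightarrow> \<theta> \<alpha> (inf A B) = inf (\<theta> \<alpha> A) (\<theta> \<alpha> B)"
    and theta_sup: "\<alpha> \<in> L \<Longrightarrow> \<theta> \<alpha> (sup A B) = sup (\<theta> \<alpha> A) (\<theta> \<alpha> B)"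
    and theta_diff: "\<alpha> \<in> L \<Longrightarrow> \<theta> \<alpha> (A - B) = \<theta> \<alpha> A - \<theta> \<alpha> B"
    and theta_bot: "\<alpha> \<in> L \<Longrightarrow> \<theta> \<alpha> bot = bot"
begin

definition \<Delta> :: "'b \<Rightarrow> 'l set" where
  "\<Delta> A = {\<alpha> \<in> L. \<theta> \<alpha> A \<noteq> bot}"

definition regular :: "'b \<Rightarrow> bool" where
  "regular A \<longleftrightarrow> (\<forall>B. B \<noteq> bot \<and> B \<le> A \<longrightarrow> finite (\<Delta> B) \<and> 0 < card (\<Delta> B))"

definition \<R> :: "'l \<Rightarrow> 'b set" where
  "\<R> \<alpha> = {A. \<exists>B. A \<le> \<theta> \<alpha> B}"

end

locale generalized_boolean_dynamical_system = boolean_dynamical_system L \<theta>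
  for L :: "'l set" and \<theta> :: "'l \<Rightarrow> 'b::generalized_boolean_algebra \<Rightarrow> 'b" +
  fixes I :: "'l \<Rightarrow> 'b set"
  assumes ideal_I: "\<alpha> \<in> L \<Longrightarrow> boolean_ideal (I \<alpha>)"
    and R_subset_I: "\<alpha> \<in> L \<Longrightarrow> \<R> \<alpha> \<subseteq> I \<alpha>"


section \<open>Cuntz--Krieger representations\<close>

text \<open>Only the values \<open>S \<alpha> B\<close> with \<open>\<alpha> \<in> L\<close> and \<open>B \<in> I \<alpha>\<close> are part of a representation; the
  other values of \<open>S\<close> are arbitrary.\<close>

locale cuntz_krieger_representation =
  generalized_boolean_dynamical_system L \<theta> I + cstar_algebra A
  for L :: "'l set" and \<theta> :: "'l \<Rightarrow> 'b::generalized_boolean_algebra \<Rightarrow> 'b" and I :: "'l \<Rightarrow> 'b set"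
    and A :: "('a, 'm) cstar_scheme" (structure) +
  fixes P :: "'b \<Rightarrow> 'a" and S :: "'l \<Rightarrow> 'b \<Rightarrow> 'a"
  assumes projection_P: "projection A (P E)"
    and partial_isometry_S: "\<lbrakk>\<alpha> \<in> L; B \<in> I \<alpha>\<rbrakk> \<Longrightarrow> partial_isometry A (S \<alpha> B)"
    and P_bot: "P bot = \<zero>"
    and P_inf: "P (inf E F) = P E \<otimes> P F"
    and P_sup: "P (sup E F) = P E \<oplus> P F \<ominus> P (inf E F)"
    and P_S: "\<lbrakk>\<alpha> \<in> L; B \<in> I \<alpha>\<rbrakk> \<Longrightarrow> P E \<otimes> S \<alpha> B = S \<alpha> B \<otimes> P (\<theta> \<alpha> E)"
    and S_S: "\<lbrakk>\<alpha> \<in> L; B \<in> I \<alpha>; \<alpha>' \<in> L; B' \<in> I \<alpha>'\<rbrakk> \<Longrightarrow>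
      star A (S \<alpha> B) \<otimes> S \<alpha>' B' = (if \<alpha> = \<alpha>' then P (inf B B') else \<zero>)"
    and P_regular: "regular E \<Longrightarrow>
      P E = (\<Oplus>\<alpha>\<in>\<Delta> E. S \<alpha> (\<theta> \<alpha> E) \<otimes> star A (S \<alpha> (\<theta> \<alpha> E)))"

definition generators :: "'l set \<Rightarrow> ('l \<Rightarrow> 'b set) \<Rightarrow> ('b \<Rightarrow> 'a) \<Rightarrow> ('l \<Rightarrow> 'b \<Rightarrow> 'a) \<Rightarrow> 'a set" where
  "generators L I P S = range P \<union> {S \<alpha> B |\<alpha> B. \<alpha> \<in> L \<and> B \<in> I \<alpha>}"

text \<open>The C*-algebra \<open>C*(P, S)\<close> as a C*-algebra in its own right.\<close>

definition generated_algebra ::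
    "('a, 'm) cstar_scheme \<Rightarrow> 'l set \<Rightarrow> ('l \<Rightarrow> 'b set) \<Rightarrow> ('b \<Rightarrow> 'a) \<Rightarrow> ('l \<Rightarrow> 'b \<Rightarrow> 'a)
      \<Rightarrow> ('a, 'm) cstar_scheme" where
  "generated_algebra A L I P S = A\<lparr>carrier := cstar_generated A (generators L I P S)\<rparr>"

text \<open>The universal property speaks about all C*-algebras, over which a single formula of HOL cannot
  quantify. It is enough to quantify over the C*-algebras carried by a subset of one type that is
  large enough. Such a type is the type of sequences of *-polynomials (as formal terms) in the
  generators: every element of \<open>C*(P, S)\<close> is the limit of a sequence of values of such terms, so
  \<open>C*(P, S)\<close> is isomorphic to a C*-algebra carried by a set of sequences of terms. The theorem
  \<open>universal_property\<close> below proves that the universal property for an arbitrary C*-algebra, on an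
  arbitrary type, follows.\<close>

datatype ('b, 'l) star_term =
    Proj 'b
  | Iso 'l 'b
  | Null
  | Plus "('b, 'l) star_term" "('b, 'l) star_term"
  | Scale complex "('b, 'l) star_term"
  | Times "('b, 'l) star_term" "('b, 'l) star_term"
  | Adj "('b, 'l) star_term"

locale universal_cuntz_krieger_representation =
  cuntz_krieger_representation L \<theta> I C p s
  for L :: "'l set" and \<theta> :: "'l \<Rightarrow> 'b::generalized_boolean_algebra \<Rightarrow> 'b" and I :: "'l \<Rightarrow> 'b set"
    and C :: "('c, 'm) cstar_scheme" (structure) and p :: "'b \<Rightarrow> 'c" and s :: "'l \<Rightarrow> 'b \<Rightarrow> 'c" +
  assumes generates: "cstar_generated C (generators L I p s) = carrier C"
    and universal: "\<And>(Y :: (nat \<Rightarrow> ('b, 'l) star_term) cstar) P S.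
      cuntz_krieger_representation L \<theta> I Y P S \<Longrightarrow>
      \<exists>\<phi>. star_hom C Y \<phi> \<and> (\<forall>A. \<phi> (p A) = P A) \<and> (\<forall>\<alpha>\<in>L. \<forall>B\<in>I \<alpha>. \<phi> (s \<alpha> B) = S \<alpha> B)"


section \<open>Consequences\<close>

lemma cring_complex_ring: "cring complex_ring"
  unfolding complex_ring_def
  by (intro cringI abelian_groupI comm_monoidI)
    (auto simp: algebra_simps intro: exI[where x = "- x" for x :: complex])

context cstar_algebra
begin

lemma smult_in [simp, intro]: "x \<in> carrier A \<Longrightarrow> c \<odot> x \<in> carrier A"
  using smult_closed[of c x] by (simp add: complex_ring_def)

lemma minus_eq_smult: "x \<in> carrier A \<Longrightarrow> \<ominus> x = (-1) \<odot> x"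
proof -
  assume x: "x \<in> carrier A"
  have "(-1) \<odot> x \<oplus> x = (-1) \<odot> x \<oplus> 1 \<odot> x"
    using smult_one[of x] x by (simp add: complex_ring_def)
  also have "\<dots> = 0 \<odot> x"
    using smult_l_distr[of "-1" 1 x] x by (simp add: complex_ring_def)
  also have "\<dots> = \<zero>"
    using smult_l_null[OF x] by (simp add: complex_ring_def)
  finally show ?thesis
    using x by (simp add: M.minus_equality)
qed

lemma diff_eq: "\<lbrakk>x \<in> carrier A; y \<in> carrier A\<rbrakk> \<Longrightarrow> x \<ominus> y = x \<oplus> (-1) \<odot> y"
  by (simp add: a_minus_def minus_eq_smult)

lemma nrm_zero [simp]: "nrm A \<zero> = 0"
  by (simp add: nrm_eq_0_iff)

lemma nrm_uminus: "x \<in> carrier A \<Longrightarrow> nrm A (\<ominus> x) = nrm A x"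
  by (simp add: minus_eq_smult nrm_smult)

lemma nrm_diff_commute: "\<lbrakk>x \<in> carrier A; y \<in> carrier A\<rbrakk> \<Longrightarrow> nrm A (x \<ominus> y) = nrm A (y \<ominus> x)"
  using nrm_uminus[of "x \<ominus> y"] by (simp add: a_minus_def M.minus_add M.a_ac)

lemma nrm_diff_triangle:
  assumes "x \<in> carrier A" "y \<in> carrier A" "z \<in> carrier A"
  shows "nrm A (x \<ominus> z) \<le> nrm A (x \<ominus> y) + nrm A (y \<ominus> z)"
proof -
  have "(x \<ominus> y) \<oplus> (y \<ominus> z) = x \<oplus> ((\<ominus> y \<oplus> y) \<oplus> \<ominus> z)"
    using assms by (simp add: a_minus_def M.a_assoc del: M.l_neg)
  also have "\<dots> = x \<ominus> z"
    using assms by (simp add: a_minus_def M.l_neg)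
  finally show ?thesis
    using nrm_triangle[of "x \<ominus> y" "y \<ominus> z"] assms by simp
qed

lemma nrm_star: "x \<in> carrier A \<Longrightarrow> nrm A (star A x) = nrm A x"
proof (rule antisym)
  have le: "nrm A y \<le> nrm A (star A y)" if y: "y \<in> carrier A" for y
  proof (cases "nrm A y = 0")
    case True
    then show ?thesis using y by (simp add: nrm_nonneg star_closed)
  next
    case False
    then have "nrm A y > 0" using nrm_nonneg[OF y] by simp
    moreover have "nrm A y * nrm A y \<le> nrm A (star A y) * nrm A y"
      using nrm_mult[of "star A y" y] cstar_identity[OF y] y
      by (simp add: star_closed power2_eq_square)
    ultimately show ?thesis by simp
  qed
  assume x: "x \<in> carrier A"
  show "nrm A (star A x) \<le> nrm A x"
    using le[of "star A x"] x by (simp add: star_closed star_star)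
  show "nrm A x \<le> nrm A (star A x)" using le x by simp
qed

lemma diff_eq_zero_iff: "\<lbrakk>x \<in> carrier A; y \<in> carrier A\<rbrakk> \<Longrightarrow> x \<ominus> y = \<zero> \<longleftrightarrow> x = y"
  by (metis M.add.inv_closed M.add.inv_solve_right M.l_zero M.r_neg M.zero_closed a_minus_def)

lemma metric_space: "Metric_space (carrier A) (cdist A)"
  by unfold_locales
    (auto simp: cdist_def nrm_nonneg nrm_diff_commute nrm_eq_0_iff diff_eq_zero_iff
      intro: nrm_diff_triangle)

end

sublocale cstar_algebra \<subseteq> metric: Metric_space "carrier A" "cdist A"
  by (rule metric_space)

context cstar_algebra
begin

lemma cstar_subalgebra_carrier: "cstar_subalgebra A (carrier A)"
  unfolding cstar_subalgebra_def
  using mult_closed star_closed metric.topspace_mtopology closedin_topspace[of metric.mtopology]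
  by auto

lemma generated_subalgebra:
  assumes "G \<subseteq> carrier A"
  shows "cstar_subalgebra A (cstar_generated A G)" "G \<subseteq> cstar_generated A G"
    "cstar_generated A G \<subseteq> carrier A"
proof -
  have car: "carrier A \<in> {D. cstar_subalgebra A D \<and> G \<subseteq> D}"
    using assms cstar_subalgebra_carrier by simp
  then show sub: "cstar_generated A G \<subseteq> carrier A"
    unfolding cstar_generated_def by blast
  show "G \<subseteq> cstar_generated A G"
    unfolding cstar_generated_def by blast
  have "closedin metric.mtopology (cstar_generated A G)"
    unfolding cstar_generated_def
    by (rule closedin_Inter) (use car in \<open>auto simp: cstar_subalgebra_def\<close>)
  moreover have "x \<in> cstar_generated A G \<longleftrightarrow> (\<forall>D. cstar_subalgebra A D \<and> G \<subseteq> D \<longrightarrow> x \<in> D)" for x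
    unfolding cstar_generated_def by blast
  ultimately show "cstar_subalgebra A (cstar_generated A G)"
    using sub unfolding cstar_subalgebra_def by (auto simp: cstar_subalgebra_def)
qed

end

text \<open>A bijective image of a subalgebra, with transported operations, is a C*-algebra.\<close>

lemma cstar_algebra_iso:
  fixes A :: "('a, 'm) cstar_scheme" and B :: "('c, 'n) cstar_scheme"
  assumes A: "cstar_algebra A" and D: "cstar_subalgebra A D"
    and bij: "bij_betw f D (carrier B)"
    and zero: "f \<zero>\<^bsub>A\<^esub> = \<zero>\<^bsub>B\<^esub>"
    and add: "\<And>x y. \<lbrakk>x \<in> D; y \<in> D\<rbrakk> \<Longrightarrow> f (x \<oplus>\<^bsub>A\<^esub> y) = f x \<oplus>\<^bsub>B\<^esub> f y"
    and smult: "\<And>c x. x \<in> D \<Longrightarrow> f (c \<odot>\<^bsub>A\<^esub> x) = c \<odot>\<^bsub>B\<^esub> f x"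
    and mult: "\<And>x y. \<lbrakk>x \<in> D; y \<in> D\<rbrakk> \<Longrightarrow> f (x \<otimes>\<^bsub>A\<^esub> y) = f x \<otimes>\<^bsub>B\<^esub> f y"
    and star: "\<And>x. x \<in> D \<Longrightarrow> f (star A x) = star B (f x)"
    and nrm: "\<And>x. x \<in> D \<Longrightarrow> nrm A x = nrm B (f x)"
  shows "cstar_algebra B"
proof -
  interpret A: cstar_algebra A by (rule A)
  have B: "carrier B = f ` D" and inj: "inj_on f D"
    using bij by (auto simp: bij_betw_def)
  have DA: "\<And>x. x \<in> D \<Longrightarrow> x \<in> carrier A"
    and D0: "\<zero>\<^bsub>A\<^esub> \<in> D"
    and D1: "\<And>x y. \<lbrakk>x \<in> D; y \<in> D\<rbrakk> \<Longrightarrow> x \<oplus>\<^bsub>A\<^esub> y \<in> D"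
    and D2: "\<And>c x. x \<in> D \<Longrightarrow> c \<odot>\<^bsub>A\<^esub> x \<in> D"
    and D3: "\<And>x y. \<lbrakk>x \<in> D; y \<in> D\<rbrakk> \<Longrightarrow> x \<otimes>\<^bsub>A\<^esub> y \<in> D"
    and D4: "\<And>x. x \<in> D \<Longrightarrow> star A x \<in> D"
    and clo: "closedin A.metric.mtopology D"
    using D unfolding cstar_subalgebra_def by auto
  note opD = D1 D2 D3 D4
  note sym_ops = add[symmetric] smult[symmetric] mult[symmetric] star[symmetric] zero[symmetric]
  interpret B: abelian_group B
  proof (rule abelian_groupI)
    fix u assume "u \<in> carrier B"
    then obtain x where x: "x \<in> D" "u = f x" using B by auto
    have "f ((-1) \<odot>\<^bsub>A\<^esub> x) \<oplus>\<^bsub>B\<^esub> u = \<zero>\<^bsub>B\<^esub>"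
      using x D2[of x "-1"] by (simp add: sym_ops A.minus_eq_smult[symmetric] DA A.M.l_neg)
    then show "\<exists>v\<in>carrier B. v \<oplus>\<^bsub>B\<^esub> u = \<zero>\<^bsub>B\<^esub>"
      using x D2 B by blast
  qed (auto simp: B sym_ops opD D0 DA A.M.a_ac)
  have cA: "c \<in> carrier complex_ring" for c by (simp add: complex_ring_def)
  have module: "Module.module complex_ring B"
  proof (rule moduleI)
    show "cring complex_ring" by (rule cring_complex_ring)
    show "abelian_group B" by unfold_locales
  qed (auto simp: B sym_ops opD DA A.smult_l_distr A.smult_r_distr A.smult_assoc1 cA)
  have Bdiff: "f x \<ominus>\<^bsub>B\<^esub> f y = f (x \<ominus>\<^bsub>A\<^esub> y)" if "x \<in> D" "y \<in> D" for x y
  proof -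
    have "f ((-1) \<odot>\<^bsub>A\<^esub> y) \<oplus>\<^bsub>B\<^esub> f y = \<zero>\<^bsub>B\<^esub>"
      using that D2[of y "-1"] by (simp add: sym_ops A.minus_eq_smult[symmetric] DA A.M.l_neg)
    then have "\<ominus>\<^bsub>B\<^esub> f y = f ((-1) \<odot>\<^bsub>A\<^esub> y)"
      using that D2 B by (intro B.minus_equality) auto
    then show ?thesis
      using that by (simp add: A.diff_eq DA a_minus_def[of B] sym_ops opD)
  qed
  have Ddiff: "x \<ominus>\<^bsub>A\<^esub> y \<in> D" if "x \<in> D" "y \<in> D" for x y
    using that by (simp add: A.diff_eq DA opD)
  have dist: "cdist B (f x) (f y) = cdist A x y" if "x \<in> D" "y \<in> D" for x y
    using that by (simp add: cdist_def B DA Bdiff nrm Ddiff)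
  have nrm_zero_iff: "nrm B u = 0 \<longleftrightarrow> u = \<zero>\<^bsub>B\<^esub>" if "u \<in> carrier B" for u
    using that inj D0 by (auto simp: B nrm[symmetric] zero[symmetric] A.nrm_eq_0_iff DA inj_on_eq_iff)
  have metricB: "Metric_space (carrier B) (cdist B)"
  proof
    fix u v show "0 \<le> cdist B u v"
      by (auto simp: cdist_def B Bdiff nrm[symmetric] Ddiff DA A.nrm_nonneg)
    show "cdist B u v = cdist B v u"
      using A.metric.commute by (cases "u \<in> carrier B \<and> v \<in> carrier B")
        (auto simp: B dist, auto simp: cdist_def B)
  next
    fix u v assume "u \<in> carrier B" "v \<in> carrier B"
    then show "cdist B u v = 0 \<longleftrightarrow> u = v"
      using inj by (auto simp: B dist DA inj_on_eq_iff)
  next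
    fix u v w assume "u \<in> carrier B" "v \<in> carrier B" "w \<in> carrier B"
    then show "cdist B u w \<le> cdist B u v + cdist B v w"
      by (auto simp: B dist intro!: A.metric.triangle DA)
  qed
  interpret MB: Metric_space "carrier B" "cdist B" by (rule metricB)
  interpret MD: Submetric "carrier A" "cdist A" D
    by unfold_locales (use DA in auto)
  have complete: "MB.mcomplete"
    unfolding MB.mcomplete_def
  proof (intro allI impI)
    fix \<sigma> assume \<sigma>: "MB.MCauchy \<sigma>"
    define \<tau> where "\<tau> = inv_into D f \<circ> \<sigma>"
    have \<tau>: "\<tau> n \<in> D" "\<sigma> n = f (\<tau> n)" for n
    proof -
      have "\<sigma> n \<in> f ` D" using \<sigma> unfolding MB.MCauchy_def B[symmetric] by blast
      then show "\<tau> n \<in> D" "\<sigma> n = f (\<tau> n)"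
        by (auto simp: \<tau>_def inv_into_into f_inv_into_f)
    qed
    have "MD.sub.MCauchy \<tau>"
      using \<sigma> \<tau>(1) unfolding MB.MCauchy_def MD.sub.MCauchy_def
      by (auto simp: \<tau>(2) dist \<tau>(1))
    moreover have "MD.sub.mcomplete"
      using clo A.complete by (rule MD.closedin_mcomplete_imp_mcomplete)
    ultimately obtain x where x: "limitin MD.sub.mtopology \<tau> x sequentially"
      unfolding MD.sub.mcomplete_def by blast
    then have xD: "x \<in> D" and lim: "\<And>\<epsilon>. \<epsilon> > 0 \<Longrightarrow> \<exists>N. \<forall>n\<ge>N. cdist A (\<tau> n) x < \<epsilon>"
      by (auto simp: MD.sub.limit_metric_sequentially, blast)
    have "limitin MB.mtopology \<sigma> (f x) sequentially"
      unfolding MB.limit_metric_sequentially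
      using lim xD \<tau>(1) by (simp add: B \<tau>(2) dist)
    then show "\<exists>u. limitin MB.mtopology \<sigma> u sequentially" ..
  qed
  show ?thesis
  proof (intro cstar_algebra.intro module cstar_algebra_axioms.intro complete nrm_zero_iff)
  qed (auto simp: B sym_ops opD DA A.mult_assoc A.distrib_left A.distrib_right A.smult_mult_left
      A.smult_mult_right A.star_star A.star_add A.star_smult A.star_mult nrm[symmetric]
      A.nrm_nonneg A.nrm_triangle A.nrm_smult A.nrm_mult A.cstar_identity)
qed

lemma (in cstar_algebra) cstar_algebra_subalgebra:
  assumes "cstar_subalgebra A D"
  shows "cstar_algebra (A\<lparr>carrier := D\<rparr>)"
  by (rule cstar_algebra_iso[OF cstar_algebra_axioms assms, of "\<lambda>x. x"]) (auto simp: bij_betw_def)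


context cuntz_krieger_representation
begin

primrec val :: "('b, 'l) star_term \<Rightarrow> 'a" where
  "val (Proj E) = P E"
| "val (Iso \<alpha> B) = (if \<alpha> \<in> L \<and> B \<in> I \<alpha> then S \<alpha> B else \<zero>)"
| "val Null = \<zero>"
| "val (Plus t u) = val t \<oplus> val u"
| "val (Scale c t) = c \<odot> val t"
| "val (Times t u) = val t \<otimes> val u"
| "val (Adj t) = star A (val t)"

lemma P_closed: "P E \<in> carrier A"
  using projection_P by (simp add: projection_def)

lemma S_closed: "\<lbrakk>\<alpha> \<in> L; B \<in> I \<alpha>\<rbrakk> \<Longrightarrow> S \<alpha> B \<in> carrier A"
  using partial_isometry_S by (simp add: partial_isometry_def)

lemma val_closed: "val t \<in> carrier A"
  by (induction t) (auto simp: P_closed S_closed mult_closed star_closed)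

lemma theta_in_I: "\<alpha> \<in> L \<Longrightarrow> \<theta> \<alpha> E \<in> I \<alpha>"
  using R_subset_I[of \<alpha>] by (auto simp: \<R>_def)

definition limits :: "'a set" where
  "limits = {x \<in> carrier A. \<forall>\<epsilon>>0. \<exists>t. nrm A (x \<ominus> val t) < \<epsilon>}"

lemma val_in_limits: "val t \<in> limits"
  unfolding limits_def
  using diff_eq_zero_iff[of "val t" "val t"] by (auto simp: val_closed intro!: exI[of _ t])

lemma limitsD: "\<lbrakk>x \<in> limits; \<epsilon> > 0\<rbrakk> \<Longrightarrow> \<exists>t. nrm A (x \<ominus> val t) < \<epsilon>"
  unfolding limits_def by blast

lemma limits_subalgebra: "cstar_subalgebra A limits"
  unfolding cstar_subalgebra_def
proof (intro conjI ballI allI)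
  have car: "x \<in> carrier A" if "x \<in> limits" for x
    using that by (simp add: limits_def)
  show "limits \<subseteq> carrier A" using car by blast
  show "\<zero> \<in> limits" using val_in_limits[of Null] by simp
  show "x \<oplus> y \<in> limits" if mem: "x \<in> limits" "y \<in> limits" for x y
    unfolding limits_def
  proof (intro CollectI conjI allI impI)
    show "x \<oplus> y \<in> carrier A" using that car by simp
    fix \<epsilon> :: real assume "\<epsilon> > 0"
    obtain t where t: "nrm A (x \<ominus> val t) < \<epsilon> / 2" using limitsD[OF mem(1), of "\<epsilon> / 2"] \<open>\<epsilon> > 0\<close> by auto
    obtain u where u: "nrm A (y \<ominus> val u) < \<epsilon> / 2" using limitsD[OF mem(2), of "\<epsilon> / 2"] \<open>\<epsilon> > 0\<close> by auto
    have "(x \<oplus> y) \<ominus> val (Plus t u) = (x \<ominus> val t) \<oplus> (y \<ominus> val u)"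
      using that car val_closed by (simp add: a_minus_def M.minus_add M.a_ac)
    then have "nrm A ((x \<oplus> y) \<ominus> val (Plus t u)) < \<epsilon>"
      using t u nrm_triangle[of "x \<ominus> val t" "y \<ominus> val u"] that car val_closed by simp
    then show "\<exists>t. nrm A ((x \<oplus> y) \<ominus> val t) < \<epsilon>" ..
  qed
  show "c \<odot> x \<in> limits" if mem: "x \<in> limits" for c x
    unfolding limits_def
  proof (intro CollectI conjI allI impI)
    show "c \<odot> x \<in> carrier A" using that car by simp
    fix \<epsilon> :: real assume "\<epsilon> > 0"
    then have "\<epsilon> / (cmod c + 1) > 0"
      by (simp add: add_nonneg_pos)
    then obtain t where t: "nrm A (x \<ominus> val t) < \<epsilon> / (cmod c + 1)"
      using limitsD[OF mem] by blast
    have nn: "nrm A (x \<ominus> val t) \<ge> 0"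
      using that car val_closed by (simp add: nrm_nonneg)
    have "(c \<odot> x) \<ominus> val (Scale c t) = c \<odot> (x \<ominus> val t)"
      using smult_r_distr[of c x "(-1) \<odot> val t"] smult_assoc1[of c "-1" "val t"]
        smult_assoc1[of "-1" c "val t"] that car val_closed
      by (simp add: diff_eq complex_ring_def)
    then have "nrm A ((c \<odot> x) \<ominus> val (Scale c t)) = cmod c * nrm A (x \<ominus> val t)"
      using that car val_closed by (simp add: nrm_smult)
    also have "\<dots> \<le> nrm A (x \<ominus> val t) * (cmod c + 1)"
      using nn by (simp add: algebra_simps)
    also have "\<dots> < \<epsilon>"
      using t by (subst (asm) pos_less_divide_eq) (auto simp: add_nonneg_pos)
    finally show "\<exists>t. nrm A ((c \<odot> x) \<ominus> val t) < \<epsilon>" ..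
  qed
  show "x \<otimes> y \<in> limits" if mem: "x \<in> limits" "y \<in> limits" for x y
    unfolding limits_def
  proof (intro CollectI conjI allI impI)
    show "x \<otimes> y \<in> carrier A" using that car by (simp add: mult_closed)
    fix \<epsilon> :: real assume "\<epsilon> > 0"
    define \<delta> where "\<delta> = \<epsilon> / (2 * (nrm A y + 1))"
    have ny: "nrm A y \<ge> 0" using that car by (simp add: nrm_nonneg)
    have "\<delta> > 0" using ny \<open>\<epsilon> > 0\<close> by (simp add: \<delta>_def)
    then obtain t where t: "nrm A (x \<ominus> val t) < \<delta>" using limitsD[OF mem(1)] by blast
    define \<gamma> where "\<gamma> = \<epsilon> / (2 * (nrm A (val t) + 1))"
    have nt: "nrm A (val t) \<ge> 0" using val_closed by (simp add: nrm_nonneg)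
    have "\<gamma> > 0" using nt \<open>\<epsilon> > 0\<close> by (simp add: \<gamma>_def)
    then obtain u where u: "nrm A (y \<ominus> val u) < \<gamma>" using limitsD[OF mem(2)] by blast
    note c = car[OF that(1)] car[OF that(2)] val_closed[of t] val_closed[of u]
    have 1: "(x \<ominus> val t) \<otimes> y = x \<otimes> y \<ominus> val t \<otimes> y"
      using c by (simp add: diff_eq mult_closed distrib_right smult_mult_left)
    have 2: "val t \<otimes> (y \<ominus> val u) = val t \<otimes> y \<ominus> val t \<otimes> val u"
      using c by (simp add: diff_eq mult_closed distrib_left smult_mult_right)
    have "nrm A (x \<otimes> y \<ominus> val (Times t u)) \<le> nrm A ((x \<ominus> val t) \<otimes> y) + nrm A (val t \<otimes> (y \<ominus> val u))"
      unfolding 1 2 using c by (simp add: nrm_diff_triangle mult_closed)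
    also have "\<dots> \<le> nrm A (x \<ominus> val t) * nrm A y + nrm A (val t) * nrm A (y \<ominus> val u)"
      using c by (intro add_mono nrm_mult) auto
    also have "\<dots> \<le> \<delta> * nrm A y + nrm A (val t) * \<gamma>"
      using t u ny nt by (intro add_mono mult_right_mono mult_left_mono) auto
    also have "\<dots> < \<delta> * (nrm A y + 1) + (nrm A (val t) + 1) * \<gamma>"
      using \<open>\<delta> > 0\<close> \<open>\<gamma> > 0\<close> by (simp add: algebra_simps)
    also have "\<delta> * (nrm A y + 1) = \<epsilon> / 2" using ny by (simp add: \<delta>_def field_simps)
    also have "(nrm A (val t) + 1) * \<gamma> = \<epsilon> / 2" using nt by (simp add: \<gamma>_def field_simps)
    finally have "nrm A (x \<otimes> y \<ominus> val (Times t u)) < \<epsilon>" by simp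
    then show "\<exists>t. nrm A (x \<otimes> y \<ominus> val t) < \<epsilon>" ..
  qed
  show "star A x \<in> limits" if mem: "x \<in> limits" for x
    unfolding limits_def
  proof (intro CollectI conjI allI impI)
    show "star A x \<in> carrier A" using that car by (simp add: star_closed)
    fix \<epsilon> :: real assume "\<epsilon> > 0"
    then obtain t where t: "nrm A (x \<ominus> val t) < \<epsilon>" using limitsD[OF mem] by blast
    have "star A x \<ominus> val (Adj t) = star A (x \<ominus> val t)"
      using that car val_closed by (simp add: diff_eq star_add star_smult star_closed)
    then have "nrm A (star A x \<ominus> val (Adj t)) < \<epsilon>"
      using t nrm_star[of "x \<ominus> val t"] that car val_closed by simp
    then show "\<exists>t. nrm A (star A x \<ominus> val t) < \<epsilon>" ..
  qed
  show "closedin metric.mtopology limits"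
    unfolding metric.closedin_metric
  proof (intro conjI allI impI)
    show "limits \<subseteq> carrier A" using car by blast
    fix x assume "x \<in> carrier A - limits"
    then obtain \<epsilon> where x: "x \<in> carrier A" "\<epsilon> > 0" "\<And>t. nrm A (x \<ominus> val t) \<ge> \<epsilon>"
      unfolding limits_def by (auto simp: not_less)
    have "y \<notin> limits" if y: "y \<in> metric.mball x (\<epsilon> / 2)" for y
    proof
      assume l: "y \<in> limits"
      obtain t where t: "nrm A (y \<ominus> val t) < \<epsilon> / 2"
        using limitsD[OF l, of "\<epsilon> / 2"] x(2) by auto
      have "nrm A (x \<ominus> y) < \<epsilon> / 2" using y by (auto simp: cdist_def)
      then show False
        using nrm_diff_triangle[of x y "val t"] x(3)[of t] t x(1) car[OF l] val_closed[of t] by simp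
    qed
    then show "\<exists>r>0. disjnt limits (metric.mball x r)"
      using x(2) by (intro exI[of _ "\<epsilon> / 2"]) (auto simp: disjnt_iff)
  qed
qed

lemma generators_closed: "generators L I P S \<subseteq> carrier A"
  by (auto simp: generators_def P_closed S_closed)

lemma generated_subset_limits: "cstar_generated A (generators L I P S) \<subseteq> limits"
proof -
  have "P E \<in> limits" for E using val_in_limits[of "Proj E"] by simp
  moreover have "S \<alpha> B \<in> limits" if "\<alpha> \<in> L" "B \<in> I \<alpha>" for \<alpha> B
    using val_in_limits[of "Iso \<alpha> B"] that by simp
  ultimately show ?thesis
    using limits_subalgebra unfolding cstar_generated_def generators_def by blast
qed

definition encode where
  "encode x n = (SOME t. nrm A (x \<ominus> val t) < inverse (real (Suc n)))"

lemma inj_encode: "inj_on encode limits"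
proof -
  have e: "nrm A (x \<ominus> val (encode x n)) < inverse (real (Suc n))" if "x \<in> limits" for x n
    unfolding encode_def by (rule someI_ex, rule limitsD[OF that]) simp
  show ?thesis
  proof
    fix x y assume xy: "x \<in> limits" "y \<in> limits" "encode x = encode y"
    then have c: "x \<in> carrier A" "y \<in> carrier A" by (auto simp: limits_def)
    show "x = y"
    proof (rule ccontr)
      assume "x \<noteq> y"
      then have "nrm A (x \<ominus> y) > 0"
        using nrm_nonneg[of "x \<ominus> y"] nrm_eq_0_iff[of "x \<ominus> y"] c by (simp add: diff_eq_zero_iff)
      then obtain n where n: "inverse (real (Suc n)) < nrm A (x \<ominus> y) / 2"
        using reals_Archimedean half_gt_zero by blast
      show False
        using nrm_diff_triangle[of x "val (encode x n)" y] nrm_diff_commute[of y "val (encode x n)"]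
          e[OF xy(1), of n] e[OF xy(2), of n] n xy(3) c val_closed[of "encode x n"] by simp
    qed
  qed
qed

end

definition transport_cstar :: "('a \<Rightarrow> 'u) \<Rightarrow> ('a, 'm) cstar_scheme \<Rightarrow> 'a set \<Rightarrow> 'u cstar" where
  "transport_cstar e A D =
    \<lparr>carrier = e ` D,
     mult = \<lambda>x y. e (inv_into D e x \<otimes>\<^bsub>A\<^esub> inv_into D e y), one = undefined,
     zero = e \<zero>\<^bsub>A\<^esub>, add = \<lambda>x y. e (inv_into D e x \<oplus>\<^bsub>A\<^esub> inv_into D e y),
     smult = \<lambda>c x. e (c \<odot>\<^bsub>A\<^esub> inv_into D e x),
     star = \<lambda>x. e (star A (inv_into D e x)), nrm = \<lambda>x. nrm A (inv_into D e x)\<rparr>"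

lemma finsum_hom:
  assumes "abelian_group A" "abelian_group B" "D \<subseteq> carrier A"
    and "\<zero>\<^bsub>A\<^esub> \<in> D" "\<And>x y. \<lbrakk>x \<in> D; y \<in> D\<rbrakk> \<Longrightarrow> x \<oplus>\<^bsub>A\<^esub> y \<in> D"
    and "f \<in> D \<rightarrow> carrier B" "f \<zero>\<^bsub>A\<^esub> = \<zero>\<^bsub>B\<^esub>"
    and "\<And>x y. \<lbrakk>x \<in> D; y \<in> D\<rbrakk> \<Longrightarrow> f (x \<oplus>\<^bsub>A\<^esub> y) = f x \<oplus>\<^bsub>B\<^esub> f y"
    and "g \<in> K \<rightarrow> D"
  shows "finsum A g K \<in> D \<and> f (finsum A g K) = finsum B (\<lambda>k. f (g k)) K"
proof -
  interpret A: abelian_group A by fact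
  interpret B: abelian_group B by fact
  show ?thesis
    using assms(9)
  proof (induction K rule: infinite_finite_induct)
    case (infinite K)
    then show ?case using assms by simp
  next
    case empty
    then show ?case using assms by simp
  next
    case (insert k K)
    have "g \<in> K \<rightarrow> carrier A" "g k \<in> carrier A" "(\<lambda>k. f (g k)) \<in> K \<rightarrow> carrier B" "f (g k) \<in> carrier B"
      using insert.prems assms(3,6) by (auto simp: Pi_iff)
    then show ?case
      using insert assms by (auto simp: A.finsum_insert B.finsum_insert Pi_iff)
  qed
qed

lemma (in universal_cuntz_krieger_representation) universal_property:
  fixes X :: "('x, 'n) cstar_scheme"
  assumes X: "cuntz_krieger_representation L \<theta> I X P S"
  shows "\<exists>\<phi>. star_hom C X \<phi> \<and> (\<forall>A. \<phi> (p A) = P A) \<and> (\<forall>\<alpha>\<in>L. \<forall>B\<in>I \<alpha>. \<phi> (s \<alpha> B) = S \<alpha> B)"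
proof -
  interpret X: cuntz_krieger_representation L \<theta> I X P S by (rule X)
  define D where "D = cstar_generated X (generators L I P S)"
  define e where "e = X.encode"
  define Y where "Y = transport_cstar e X D"
  have sub: "cstar_subalgebra X D" and gen: "generators L I P S \<subseteq> D"
    unfolding D_def using X.generated_subalgebra[OF X.generators_closed] by auto
  have inj: "inj_on e D"
    using X.inj_encode X.generated_subset_limits unfolding e_def D_def by (rule inj_on_subset)
  have DX: "\<And>x. x \<in> D \<Longrightarrow> x \<in> carrier X" and D0: "\<zero>\<^bsub>X\<^esub> \<in> D"
    and D1: "\<And>x y. \<lbrakk>x \<in> D; y \<in> D\<rbrakk> \<Longrightarrow> x \<oplus>\<^bsub>X\<^esub> y \<in> D"
    and D2: "\<And>c x. x \<in> D \<Longrightarrow> c \<odot>\<^bsub>X\<^esub> x \<in> D"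
    and D3: "\<And>x y. \<lbrakk>x \<in> D; y \<in> D\<rbrakk> \<Longrightarrow> x \<otimes>\<^bsub>X\<^esub> y \<in> D"
    and D4: "\<And>x. x \<in> D \<Longrightarrow> star X x \<in> D"
    using sub unfolding cstar_subalgebra_def by auto
  have PD: "P E \<in> D" for E using gen by (auto simp: generators_def)
  have SD: "S \<alpha> B \<in> D" if "\<alpha> \<in> L" "B \<in> I \<alpha>" for \<alpha> B
    using gen that by (auto simp: generators_def)
  have Y: "carrier Y = e ` D" "\<zero>\<^bsub>Y\<^esub> = e \<zero>\<^bsub>X\<^esub>"
    "\<And>x y. \<lbrakk>x \<in> D; y \<in> D\<rbrakk> \<Longrightarrow> e x \<oplus>\<^bsub>Y\<^esub> e y = e (x \<oplus>\<^bsub>X\<^esub> y)"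
    "\<And>x y. \<lbrakk>x \<in> D; y \<in> D\<rbrakk> \<Longrightarrow> e x \<otimes>\<^bsub>Y\<^esub> e y = e (x \<otimes>\<^bsub>X\<^esub> y)"
    "\<And>c x. x \<in> D \<Longrightarrow> c \<odot>\<^bsub>Y\<^esub> e x = e (c \<odot>\<^bsub>X\<^esub> x)"
    "\<And>x. x \<in> D \<Longrightarrow> star Y (e x) = e (star X x)"
    "\<And>x. x \<in> D \<Longrightarrow> nrm Y (e x) = nrm X x"
    using inj by (simp_all add: Y_def transport_cstar_def)
  interpret Y: cstar_algebra Y
    by (rule cstar_algebra_iso[OF X.cstar_algebra_axioms sub, of e])
      (use inj in \<open>auto simp: Y bij_betw_def\<close>)
  have diff: "e x \<ominus>\<^bsub>Y\<^esub> e y = e (x \<ominus>\<^bsub>X\<^esub> y)" if "x \<in> D" "y \<in> D" for x y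
    using that by (simp add: X.diff_eq Y.diff_eq Y DX D2)
  have ag: "abelian_group X" "abelian_group Y" by unfold_locales
  have "cuntz_krieger_representation L \<theta> I Y (\<lambda>E. e (P E)) (\<lambda>\<alpha> B. e (S \<alpha> B))"
  proof
    show "projection Y (e (P E))" for E
      using X.projection_P[of E] PD[of E] by (simp add: projection_def Y)
    show "partial_isometry Y (e (S \<alpha> B))" if "\<alpha> \<in> L" "B \<in> I \<alpha>" for \<alpha> B
      using X.partial_isometry_S[OF that] SD[OF that] by (simp add: partial_isometry_def Y D3 D4)
    show "e (P bot) = \<zero>\<^bsub>Y\<^esub>" by (simp add: X.P_bot Y)
    show "e (P (inf E F)) = e (P E) \<otimes>\<^bsub>Y\<^esub> e (P F)" for E F
      by (simp add: X.P_inf Y PD)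
    show "e (P (sup E F)) = e (P E) \<oplus>\<^bsub>Y\<^esub> e (P F) \<ominus>\<^bsub>Y\<^esub> e (P (inf E F))" for E F
      by (simp add: X.P_sup Y PD D1 diff)
    show "e (P E) \<otimes>\<^bsub>Y\<^esub> e (S \<alpha> B) = e (S \<alpha> B) \<otimes>\<^bsub>Y\<^esub> e (P (\<theta> \<alpha> E))"
      if "\<alpha> \<in> L" "B \<in> I \<alpha>" for \<alpha> B E
      using that by (simp add: X.P_S Y PD SD)
    show "star Y (e (S \<alpha> B)) \<otimes>\<^bsub>Y\<^esub> e (S \<alpha>' B') = (if \<alpha> = \<alpha>' then e (P (inf B B')) else \<zero>\<^bsub>Y\<^esub>)"
      if "\<alpha> \<in> L" "B \<in> I \<alpha>" "\<alpha>' \<in> L" "B' \<in> I \<alpha>'" for \<alpha> B \<alpha>' B'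
      using that X.S_S[OF that] by (simp add: Y SD D4)
    fix E assume E: "regular E"
    have *: "S \<alpha> (\<theta> \<alpha> E) \<in> D" if "\<alpha> \<in> \<Delta> E" for \<alpha>
      using that by (intro SD X.theta_in_I) (auto simp: \<Delta>_def)
    have "e (P E) = (\<Oplus>\<^bsub>Y\<^esub>\<alpha>\<in>\<Delta> E. e (S \<alpha> (\<theta> \<alpha> E) \<otimes>\<^bsub>X\<^esub> star X (S \<alpha> (\<theta> \<alpha> E))))"
      unfolding X.P_regular[OF E]
      by (rule conjunct2[OF finsum_hom[OF ag, where D = D]])
        (auto simp: Y DX D0 D1 * D3 D4)
    also have "\<dots> = (\<Oplus>\<^bsub>Y\<^esub>\<alpha>\<in>\<Delta> E. e (S \<alpha> (\<theta> \<alpha> E)) \<otimes>\<^bsub>Y\<^esub> star Y (e (S \<alpha> (\<theta> \<alpha> E))))"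
      by (rule Y.finsum_cong') (auto simp: Y * D3 D4)
    finally show "e (P E) = \<dots>" .
  qed
  from universal[OF this] obtain \<phi> where \<phi>: "star_hom C Y \<phi>" "\<And>A. \<phi> (p A) = e (P A)"
    "\<And>\<alpha> B. \<lbrakk>\<alpha> \<in> L; B \<in> I \<alpha>\<rbrakk> \<Longrightarrow> \<phi> (s \<alpha> B) = e (S \<alpha> B)"
    by blast
  define g where "g = inv_into D e"
  have g: "g (e x) = x" if "x \<in> D" for x using inj that by (simp add: g_def)
  have \<phi>D: "\<exists>y\<in>D. \<phi> x = e y" if "x \<in> carrier C" for x
    using \<phi>(1) that by (auto simp: star_hom_def Y Pi_iff)
  have gY: "g (u \<oplus>\<^bsub>Y\<^esub> v) = g u \<oplus>\<^bsub>X\<^esub> g v" "g (u \<otimes>\<^bsub>Y\<^esub> v) = g u \<otimes>\<^bsub>X\<^esub> g v"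
      "g (c \<odot>\<^bsub>Y\<^esub> u) = c \<odot>\<^bsub>X\<^esub> g u" "g (star Y u) = star X (g u)" "g u \<in> carrier X"
    if "u \<in> carrier Y" "v \<in> carrier Y" for u v c
    using that by (auto simp: Y g D1 D2 D3 D4 DX)
  have "star_hom C X (g \<circ> \<phi>)"
    using \<phi>(1) by (auto simp: star_hom_def Pi_iff gY)
  then show ?thesis
    using \<phi> by (intro exI[of _ "g \<circ> \<phi>"]) (auto simp: g PD SD)
qed

end

theory Submission
  imports Defs "HOL-Analysis.Analysis"
begin

text \<open>Everything about C*-algebras is reduced to one trick: for self-adjoint \<open>h\<close> the norm satisfies
  \<open>\<parallel>h^(2^n)\<parallel> = \<parallel>h\<parallel>^(2^n)\<close>, so an estimate of the norms of these powers that is off by a factor growing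
  only linearly in \<open>2^n\<close> is exact for \<open>h\<close>. In this way contractivity of *-homomorphisms follows from a
  bound by 2 (from a unitary with imaginary part \<open>h\<close>), the norm bound of the polynomial functional
  calculus follows from counting coefficients, injectivity on the core of the gauge action follows from
  a lower bound on each finite-dimensional subspace, and uniqueness itself from counting homogeneous
  components; no spectral theory and no conditional expectation is needed.

  Given nonzero projections \<open>P A\<close> and a gauge action on \<open>C*(P, S)\<close>, the components of an element of
  the *-algebra generated by \<open>p, s\<close> have images that are dominated by the image of the element, and
  \<open>\<pi>\<close> is isometric on components because it is isometric on the core; hence \<open>\<pi>\<close> is isometric.
  Conversely, an injective \<open>\<pi>\<close> is an isomorphism onto \<open>C*(P, S)\<close>, which transports the gauge action that
  \<open>C\<close> has by universality, and \<open>p A\<close> is nonzero since it is so in the representation by partial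
  shifts on the square-summable functions on boundary paths.\<close>

section \<open>Roots of unity and convergence\<close>

text \<open>The usual averaging over the circle is not at hand: there is one map
  \<open>\<beta>\<close> for each z, with no continuity in z to integrate against. What can be used
  is that each map is contractive and multiplies the image of a monomial of degree n by z^n; for an
  element of bounded degree finitely many z are enough. Degrees add under multiplication, so the
  number of components of iterated squares grows linearly in 2^m, which is the loss that the norm
  trick tolerates. On the core it tolerates any constant, so only the shape of a normal form matters
  there; but the constant must hold on a space that contains all the iterated squares, which is why
  finite parts of the core are placed in subalgebras and not just in spans. The lack of a unit
  shapes the analytic part: \<open>1 - sqrt (1 - h^2)\<close> replaces the root itself, a polynomial
  with constant term is applied to an element instead of being evaluated at h, and a unitary with
  real part h appears as an operator on the algebra. Universality yields only maps out of C; that p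
  A does not vanish needs a model.\<close>

lemma power_bound_imp_le:
  fixes x y a b :: real
  assumes "0 \<le> x" "0 \<le> y"
    and le: "\<And>m. x ^ (2 ^ m) \<le> (a * 2 ^ m + b) * y ^ (2 ^ m)"
  shows "x \<le> y"
proof (rule ccontr)
  assume "\<not> x \<le> y"
  then have xy: "y < x" "x > 0" using assms by auto
  define q where "q = y / x"
  have q: "0 \<le> q" "q < 1" using xy assms by (auto simp: q_def)
  have sub: "strict_mono (\<lambda>m::nat. (2::nat) ^ m)"
    by (rule strict_monoI) simp
  \<comment> \<open>Divided by \<open>x ^ (2 ^ m)\<close>, the hypothesis says 1 \<le> (a 2^m + b)
    q^(2^m). The right side is a subsequence of a linear times a geometric sequence and tends to
    0.\<close>
  have "(\<lambda>n. a * (of_nat n * q ^ n) + b * q ^ n) \<longlonglongrightarrow> a * 0 + b * 0"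
    using q by (intro tendsto_intros powser_times_n_limit_0 LIMSEQ_power_zero) auto
  then have "(\<lambda>m. a * (of_nat (2 ^ m) * q ^ (2 ^ m)) + b * q ^ (2 ^ m)) \<longlonglongrightarrow> 0"
    using LIMSEQ_subseq_LIMSEQ[OF _ sub] by (fastforce simp: o_def)
  moreover have "1 \<le> a * (of_nat (2 ^ m) * q ^ (2 ^ m)) + b * q ^ (2 ^ m)" for m
  proof -
    have "x ^ (2 ^ m) > 0" using xy by simp
    then have "1 \<le> (a * 2 ^ m + b) * y ^ (2 ^ m) / x ^ (2 ^ m)" using le[of m] by simp
    then show ?thesis by (simp add: q_def power_divide algebra_simps add_divide_distrib)
  qed
  ultimately have "(1::real) \<le> 0"
    by (intro tendsto_lowerbound) (auto intro!: always_eventually)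
  then show False by simp
qed

text \<open>Orthogonality of the characters of the cyclic group of order N. The bound on n excludes
  the other multiples of N, at which every summand is 1 as well.\<close>

lemma sum_roots_of_unity:
  fixes n :: int and N :: nat
  assumes "\<bar>n\<bar> < int N"
  shows "(\<Sum>k<N. cis (2 * pi / N) powi (n * int k)) = (if n = 0 then of_nat N else 0)"
proof (cases "n = 0")
  case False
  have N: "N > 0" using assms by simp
  define w where "w = cis (2 * pi / N) powi n"
  have w: "w = cis (2 * pi * n / N)"
    by (simp add: w_def cis_power_int field_simps)
  have "w \<noteq> 1"
  proof
    assume "w = 1"
    then obtain k :: int where "2 * pi * n / N = 2 * pi * k"
      unfolding w by (auto simp: cis_conv_exp exp_eq_1)
    then have "real_of_int n = real_of_int (k * int N)"
      using N by (simp add: field_simps)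
    then have "n = k * int N" by linarith
    then have "\<bar>n\<bar> = \<bar>k\<bar> * int N" by (simp add: abs_mult)
    moreover have "k \<noteq> 0" using \<open>n = k * int N\<close> False by auto
    then have "\<bar>k\<bar> * int N \<ge> int N"
      using mult_right_mono[of 1 "\<bar>k\<bar>" "int N"] by simp
    ultimately show False using assms by simp
  qed
  have "w ^ N = cis (2 * pi * n)"
    unfolding w Complex.DeMoivre using N by simp
  also have "\<dots> = 1"
    by (rule cis_multiple_2pi) auto
  finally have "w ^ N = 1" .
  have "(\<Sum>k<N. cis (2 * pi / N) powi (n * int k)) = (\<Sum>k<N. w ^ k)"
    by (simp add: w_def power_int_mult)
  also have "\<dots> = 0"
    using \<open>w \<noteq> 1\<close> \<open>w ^ N = 1\<close> by (simp add: geometric_sum)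
  finally show ?thesis using False by simp
qed simp

text \<open>Cauchy's estimate. The mean over the circle is replaced by the mean over the roots of
  unity of order \<open>degree R + 1\<close>; two exponents of R differ by less than that, so the
  mean isolates one coefficient exactly.\<close>

lemma coeff_bound_unit_circle:
  fixes R :: "complex poly"
  assumes "\<And>z. cmod z = 1 \<Longrightarrow> cmod (poly R z) \<le> M"
  shows "cmod (coeff R j) \<le> M"
proof (cases "j \<le> degree R")
  case True
  define N where "N = Suc (degree R)"
  define w where "w = cis (2 * pi / N)"
  have nz: "w \<noteq> 0" by (simp add: w_def)
  have pw: "(w ^ k) ^ i * w powi (- int j * int k) = w powi ((int i - int j) * int k)" for i k
  proof -
    have "(w ^ k) ^ i * w powi (- int j * int k) = w powi (int k * int i + - int j * int k)"
      using nz by (subst power_int_add) (simp_all add: power_mult power_int_mult)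
    then show ?thesis by (simp add: algebra_simps)
  qed
  have "(\<Sum>k<N. poly R (w ^ k) * w powi (- int j * int k))
      = (\<Sum>k<N. \<Sum>i\<le>degree R. coeff R i * w powi ((int i - int j) * int k))"
    by (simp add: poly_altdef sum_distrib_right mult.assoc pw del: mult_minus_left)
  also have "\<dots> = (\<Sum>i\<le>degree R. coeff R i * (\<Sum>k<N. w powi ((int i - int j) * int k)))"
    by (subst sum.swap) (simp add: sum_distrib_left)
  also have "\<dots> = (\<Sum>i\<le>degree R. coeff R i * (if i = j then of_nat N else 0))"
  proof (intro sum.cong refl)
    fix i assume "i \<in> {..degree R}"
    then have "\<bar>int i - int j\<bar> < int N" using True by (auto simp: N_def)
    from sum_roots_of_unity[OF this]
    show "coeff R i * (\<Sum>k<N. w powi ((int i - int j) * int k)) = coeff R i * (if i = j then of_nat N else 0)"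
      by (simp add: w_def)
  qed
  also have "\<dots> = of_nat N * coeff R j"
    using True by (simp add: if_distrib sum.delta cong: if_cong)
  finally have "N * cmod (coeff R j) = cmod (\<Sum>k<N. poly R (w ^ k) * w powi (- int j * int k))"
    by (simp add: norm_mult)
  also have "\<dots> \<le> (\<Sum>k<N. M)"
  proof (intro sum_norm_le)
    fix k
    have "cmod (w ^ k) = 1" "cmod (w powi (- int j * int k)) = 1"
      by (auto simp: w_def norm_power norm_power_int)
    then show "cmod (poly R (w ^ k) * w powi (- int j * int k)) \<le> M"
      using assms[of "w ^ k"] by (simp add: norm_mult)
  qed
  also have "\<dots> = N * M" by simp
  finally show ?thesis by (simp add: N_def del: of_nat_Suc)
next
  case False
  have "0 \<le> M" using assms[of 1] by (smt (verit) norm_ge_zero norm_one)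
  then show ?thesis using False by (simp add: coeff_eq_0)
qed

section \<open>Algebraic rules and norm limits in a C*-algebra\<close>

context cstar_algebra
begin

lemmas cstar_closed [simp] = mult_closed star_closed

lemma smult_add: "\<lbrakk>x \<in> carrier A; y \<in> carrier A\<rbrakk> \<Longrightarrow> c \<odot> (x \<oplus> y) = c \<odot> x \<oplus> c \<odot> y"
  using smult_r_distr[of c x y] by (simp add: complex_ring_def)

lemma add_smult: "x \<in> carrier A \<Longrightarrow> (c + d) \<odot> x = c \<odot> x \<oplus> d \<odot> x"
  using smult_l_distr[of c d x] by (simp add: complex_ring_def)

lemma smult_smult [simp]: "x \<in> carrier A \<Longrightarrow> c \<odot> (d \<odot> x) = (c * d) \<odot> x"
  using smult_assoc1[of c d x] by (simp add: complex_ring_def)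

lemma one_smult [simp]: "x \<in> carrier A \<Longrightarrow> 1 \<odot> x = x"
  using smult_one[of x] by (simp add: complex_ring_def)

lemma zero_smult [simp]: "x \<in> carrier A \<Longrightarrow> 0 \<odot> x = \<zero>"
  using smult_l_null[of x] by (simp add: complex_ring_def)

lemma smult_zero [simp]: "c \<odot> \<zero> = \<zero>"
  using smult_r_null[of c] by (simp add: complex_ring_def)

lemma zero_mult [simp]: "x \<in> carrier A \<Longrightarrow> \<zero> \<otimes> x = \<zero>"
  using smult_mult_left[of \<zero> x 0] by simp

lemma mult_zero [simp]: "x \<in> carrier A \<Longrightarrow> x \<otimes> \<zero> = \<zero>"
  using smult_mult_right[of x \<zero> 0] by simp

lemma star_zero [simp]: "star A \<zero> = \<zero>"
  using star_smult[of \<zero> 0] by simp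

lemma diff_closed [simp]: "\<lbrakk>x \<in> carrier A; y \<in> carrier A\<rbrakk> \<Longrightarrow> x \<ominus> y \<in> carrier A"
  by simp

lemma star_diff: "\<lbrakk>x \<in> carrier A; y \<in> carrier A\<rbrakk> \<Longrightarrow> star A (x \<ominus> y) = star A x \<ominus> star A y"
  by (simp add: diff_eq star_add star_smult)

lemma mult_diff_left: "\<lbrakk>x \<in> carrier A; y \<in> carrier A; z \<in> carrier A\<rbrakk> \<Longrightarrow> x \<otimes> (y \<ominus> z) = x \<otimes> y \<ominus> x \<otimes> z"
  by (simp add: diff_eq distrib_left smult_mult_right)

lemma mult_diff_right: "\<lbrakk>x \<in> carrier A; y \<in> carrier A; z \<in> carrier A\<rbrakk> \<Longrightarrow> (y \<ominus> z) \<otimes> x = y \<otimes> x \<ominus> z \<otimes> x"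
  by (simp add: diff_eq distrib_right smult_mult_left)

lemma smult_diff: "\<lbrakk>x \<in> carrier A; y \<in> carrier A\<rbrakk> \<Longrightarrow> c \<odot> (x \<ominus> y) = c \<odot> x \<ominus> c \<odot> y"
  by (simp add: diff_eq smult_add)

lemma diff_zero_right [simp]: "x \<in> carrier A \<Longrightarrow> x \<ominus> \<zero> = x"
  by (simp add: diff_eq)

lemma diff_self [simp]: "x \<in> carrier A \<Longrightarrow> x \<ominus> x = \<zero>"
  by (simp add: diff_eq_zero_iff)

lemma diff_add_cancel: "\<lbrakk>x \<in> carrier A; y \<in> carrier A\<rbrakk> \<Longrightarrow> (x \<ominus> y) \<oplus> y = x"
  by (simp add: a_minus_def M.a_assoc M.l_neg)

lemma add_diff_add:
  "\<lbrakk>x \<in> carrier A; y \<in> carrier A; u \<in> carrier A; v \<in> carrier A\<rbrakk> \<Longrightarrow>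
    (x \<oplus> y) \<ominus> (u \<oplus> v) = (x \<ominus> u) \<oplus> (y \<ominus> v)"
  by (simp add: diff_eq smult_add M.a_ac)

lemma nrm_le_diff: "\<lbrakk>x \<in> carrier A; y \<in> carrier A\<rbrakk> \<Longrightarrow> nrm A x \<le> nrm A (x \<ominus> y) + nrm A y"
  using nrm_triangle[of "x \<ominus> y" y] by (simp add: diff_add_cancel)

lemma add_eq_diff: "\<lbrakk>x \<in> carrier A; y \<in> carrier A; z \<in> carrier A\<rbrakk> \<Longrightarrow> x \<oplus> y = z \<longleftrightarrow> x = z \<ominus> y"
  by (auto simp: a_minus_def M.a_assoc M.l_neg M.r_neg)

text \<open>Limits are reduced to real null sequences. For closed sets this agrees with the metric
  topology, by \<open>closedin_conv\<close> and its converse \<open>closedin_convI\<close>.\<close>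

definition conv :: "(nat \<Rightarrow> 'a) \<Rightarrow> 'a \<Rightarrow> bool" where
  "conv f l \<longleftrightarrow> range f \<subseteq> carrier A \<and> l \<in> carrier A \<and> (\<lambda>n. nrm A (f n \<ominus> l)) \<longlonglongrightarrow> 0"

lemma conv_closed: "conv f l \<Longrightarrow> f n \<in> carrier A" "conv f l \<Longrightarrow> l \<in> carrier A"
  by (auto simp: conv_def)

lemma convI:
  assumes "\<And>n. f n \<in> carrier A" "l \<in> carrier A" "g \<longlonglongrightarrow> 0" "\<And>n. nrm A (f n \<ominus> l) \<le> g n"
  shows "conv f l"
proof -
  have "(\<lambda>n. nrm A (f n \<ominus> l)) \<longlonglongrightarrow> 0"
    by (rule tendsto_sandwich[OF _ _ tendsto_const assms(3)])
      (use assms in \<open>auto intro!: always_eventually nrm_nonneg\<close>)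
  then show ?thesis using assms by (auto simp: conv_def)
qed

lemma conv_const: "x \<in> carrier A \<Longrightarrow> conv (\<lambda>_. x) x"
  by (auto simp: conv_def)

lemma conv_add:
  assumes "conv f a" "conv g b"
  shows "conv (\<lambda>n. f n \<oplus> g n) (a \<oplus> b)"
proof (rule convI)
  note c = conv_closed[OF assms(1)] conv_closed[OF assms(2)]
  show "(\<lambda>n. nrm A (f n \<ominus> a) + nrm A (g n \<ominus> b)) \<longlonglongrightarrow> 0"
    using assms tendsto_add[of "\<lambda>n. nrm A (f n \<ominus> a)" 0] by (fastforce simp: conv_def)
  show "nrm A (f n \<oplus> g n \<ominus> (a \<oplus> b)) \<le> nrm A (f n \<ominus> a) + nrm A (g n \<ominus> b)" for n
    using c nrm_triangle[of "f n \<ominus> a" "g n \<ominus> b"] by (simp add: add_diff_add)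
qed (use assms in \<open>auto simp: conv_closed\<close>)

lemma conv_smult:
  assumes "conv f a"
  shows "conv (\<lambda>n. c \<odot> f n) (c \<odot> a)"
proof (rule convI)
  note c = conv_closed[OF assms(1)]
  show "(\<lambda>n. cmod c * nrm A (f n \<ominus> a)) \<longlonglongrightarrow> 0"
    using assms tendsto_mult_right_zero[of "\<lambda>n. nrm A (f n \<ominus> a)"] by (auto simp: conv_def)
  show "nrm A (c \<odot> f n \<ominus> c \<odot> a) \<le> cmod c * nrm A (f n \<ominus> a)" for n
    using c by (simp add: smult_diff[symmetric] nrm_smult)
qed (use assms in \<open>auto simp: conv_closed\<close>)

lemma conv_star:
  assumes "conv f a"
  shows "conv (\<lambda>n. star A (f n)) (star A a)"
proof (rule convI)
  note c = conv_closed[OF assms(1)]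
  show "(\<lambda>n. nrm A (f n \<ominus> a)) \<longlonglongrightarrow> 0"
    using assms by (simp add: conv_def)
  show "nrm A (star A (f n) \<ominus> star A a) \<le> nrm A (f n \<ominus> a)" for n
    using c by (simp add: star_diff[symmetric] nrm_star)
qed (use assms in \<open>auto simp: conv_closed\<close>)

lemma conv_mult:
  assumes "conv f a" "conv g b"
  shows "conv (\<lambda>n. f n \<otimes> g n) (a \<otimes> b)"
proof (rule convI)
  note c = conv_closed[OF assms(1)] conv_closed[OF assms(2)]
  define u v where "u n = nrm A (f n \<ominus> a)" and "v n = nrm A (g n \<ominus> b)" for n
  have uv: "u \<longlonglongrightarrow> 0" "v \<longlonglongrightarrow> 0"
    using assms unfolding conv_def u_def[abs_def] v_def[abs_def] by auto
  have "(\<lambda>n. u n * (v n + nrm A b) + nrm A a * v n) \<longlonglongrightarrow> 0 * (0 + nrm A b) + nrm A a * 0"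
    by (intro tendsto_intros uv)
  then show "(\<lambda>n. u n * (v n + nrm A b) + nrm A a * v n) \<longlonglongrightarrow> 0" by simp
  show "nrm A (f n \<otimes> g n \<ominus> a \<otimes> b) \<le> u n * (v n + nrm A b) + nrm A a * v n" for n
  proof -
    have "nrm A (f n \<otimes> g n \<ominus> a \<otimes> b) \<le> nrm A (f n \<otimes> g n \<ominus> a \<otimes> g n) + nrm A (a \<otimes> g n \<ominus> a \<otimes> b)"
      using c by (intro nrm_diff_triangle) auto
    also have "\<dots> = nrm A ((f n \<ominus> a) \<otimes> g n) + nrm A (a \<otimes> (g n \<ominus> b))"
      using c by (simp add: mult_diff_left mult_diff_right)
    also have "\<dots> \<le> u n * nrm A (g n) + nrm A a * v n"
      unfolding u_def v_def using c by (intro add_mono nrm_mult) auto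
    also have "\<dots> \<le> u n * (v n + nrm A b) + nrm A a * v n"
      unfolding u_def v_def using c by (intro add_right_mono mult_left_mono nrm_le_diff) (auto simp: nrm_nonneg)
    finally show ?thesis .
  qed
qed (use assms in \<open>auto simp: conv_closed\<close>)

lemma conv_nrm:
  assumes "conv f a"
  shows "(\<lambda>n. nrm A (f n)) \<longlonglongrightarrow> nrm A a"
proof (rule LIM_zero_cancel, rule tendsto_rabs_zero_cancel, rule tendsto_sandwich[OF _ _ tendsto_const])
  note c = conv_closed[OF assms(1)]
  show "(\<lambda>n. nrm A (f n \<ominus> a)) \<longlonglongrightarrow> 0" using assms by (simp add: conv_def)
  have "\<bar>nrm A (f n) - nrm A a\<bar> \<le> nrm A (f n \<ominus> a)" for n
    using c nrm_le_diff[of "f n" a] nrm_le_diff[of a "f n"] nrm_diff_commute[of a "f n"] by simp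
  then show "\<forall>\<^sub>F n in sequentially. \<bar>nrm A (f n) - nrm A a\<bar> \<le> nrm A (f n \<ominus> a)" by simp
qed simp

lemma conv_unique:
  assumes "conv f a" "conv f b"
  shows "a = b"
proof -
  note c = conv_closed[OF assms(1)] conv_closed[OF assms(2)]
  have "conv (\<lambda>n. f n \<oplus> (-1) \<odot> f n) (a \<oplus> (-1) \<odot> b)"
    using assms by (intro conv_add conv_smult)
  moreover have "f n \<oplus> (-1) \<odot> f n = \<zero>" "a \<oplus> (-1) \<odot> b = a \<ominus> b" for n
    using c by (auto simp: diff_eq[symmetric])
  ultimately have "conv (\<lambda>n. \<zero>) (a \<ominus> b)" by simp
  from conv_nrm[OF this] have "nrm A (a \<ominus> b) = 0" by (simp add: LIMSEQ_const_iff)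
  then show ?thesis using c by (simp add: nrm_eq_0_iff diff_eq_zero_iff)
qed

lemma conv_Suc: "conv f a \<Longrightarrow> conv (\<lambda>n. f (Suc n)) a"
  unfolding conv_def by (auto intro: LIMSEQ_Suc[of "\<lambda>n. nrm A (f n \<ominus> a)"])

lemma cauchy_imp_conv:
  assumes "\<And>n. f n \<in> carrier A"
    and "\<And>\<epsilon>. \<epsilon> > 0 \<Longrightarrow> \<exists>N. \<forall>m\<ge>N. \<forall>n\<ge>N. nrm A (f m \<ominus> f n) < \<epsilon>"
  shows "\<exists>l. conv f l"
proof -
  have "metric.MCauchy f"
    unfolding metric.MCauchy_def using assms by (auto simp: cdist_def)
  then obtain l where "limitin metric.mtopology f l sequentially"
    using complete unfolding metric.mcomplete_def by blast
  then have l: "l \<in> carrier A" "\<And>\<epsilon>. \<epsilon> > 0 \<Longrightarrow> \<exists>N. \<forall>n\<ge>N. f n \<in> carrier A \<and> cdist A (f n) l < \<epsilon>"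
    by (auto simp: metric.limit_metric_sequentially)
  have "(\<lambda>n. nrm A (f n \<ominus> l)) \<longlonglongrightarrow> 0"
    unfolding LIMSEQ_iff
    using l assms(1) by (auto simp: cdist_def nrm_nonneg)
  then show ?thesis using l assms by (auto simp: conv_def)
qed

lemma closedin_conv:
  assumes "closedin metric.mtopology D" "conv f l" "\<And>n. f n \<in> D"
  shows "l \<in> D"
proof -
  have "limitin metric.mtopology f l sequentially"
    unfolding metric.limit_metric_sequentially
  proof (intro conjI allI impI)
    fix e :: real assume "e > 0"
    then have "\<forall>\<^sub>F n in sequentially. nrm A (f n \<ominus> l) < e"
      using assms(2) by (auto simp: conv_def intro: order_tendstoD)
    then show "\<exists>N. \<forall>n\<ge>N. f n \<in> carrier A \<and> cdist A (f n) l < e"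
      using conv_closed[OF assms(2)] by (auto simp: eventually_sequentially cdist_def)
  qed (use conv_closed[OF assms(2)] in auto)
  then show ?thesis
    using limitin_closedin[of metric.mtopology f l sequentially D] assms(1,3) by auto
qed

lemma nrm_square_sa:
  assumes "x \<in> carrier A" "star A x = x"
  shows "nrm A (x \<otimes> x) = (nrm A x)\<^sup>2"
  using cstar_identity[OF assms(1)] assms(2) by simp

end

section \<open>Contractivity of *-homomorphisms\<close>

context cstar_algebra
begin

lemma geometric_imp_conv:
  assumes f: "\<And>n. f n \<in> carrier A" and r: "0 \<le> r" "r < 1"
    and le: "\<And>n. nrm A (f (Suc n) \<ominus> f n) \<le> K * r ^ n"
  shows "\<exists>l. conv f l"
proof (rule cauchy_imp_conv[OF f])
  have K: "0 \<le> K" using le[of 0] nrm_nonneg[of "f 1 \<ominus> f 0"] f by simp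
  \<comment> \<open>The bound is the tail \<open>K * (r ^ n + r ^ (n + 1) + ...)\<close> of the
    geometric series, summed.\<close>
  have tail: "nrm A (f (n + k) \<ominus> f n) \<le> K * r ^ n / (1 - r)" for n k
  proof (induction k arbitrary: n)
    case 0
    then show ?case using f r K by simp
  next
    case (Suc k)
    have "nrm A (f (n + Suc k) \<ominus> f n) \<le> nrm A (f (Suc n + k) \<ominus> f (Suc n)) + nrm A (f (Suc n) \<ominus> f n)"
      using f nrm_diff_triangle[of "f (Suc n + k)" "f (Suc n)" "f n"] by simp
    also have "\<dots> \<le> K * r ^ Suc n / (1 - r) + K * r ^ n"
      by (rule add_mono[OF Suc le])
    also have "\<dots> = K * r ^ n / (1 - r)"
      using r by (simp add: field_simps)
    finally show ?case .
  qed
  fix \<epsilon> :: real assume e: "\<epsilon> > 0"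
  have "(\<lambda>n. K * r ^ n / (1 - r)) \<longlonglongrightarrow> K * 0 / (1 - r)"
    using r by (intro tendsto_intros LIMSEQ_power_zero) auto
  then have "\<forall>\<^sub>F n in sequentially. K * r ^ n / (1 - r) < \<epsilon>"
    using e by (intro order_tendstoD) auto
  then obtain N where N: "\<And>n. n \<ge> N \<Longrightarrow> K * r ^ n / (1 - r) < \<epsilon>"
    by (auto simp: eventually_sequentially)
  have main: "nrm A (f m \<ominus> f n) < \<epsilon>" if "m \<ge> n" "n \<ge> N" for m n
    using tail[of n "m - n"] N[OF that(2)] that(1) by simp
  show "\<exists>N. \<forall>m\<ge>N. \<forall>n\<ge>N. nrm A (f m \<ominus> f n) < \<epsilon>"
    using main nrm_diff_commute f by (metis nle_le)
qed

text \<open>The element \<open>c\<close> plays the role of \<open>1 - sqrt (1 - a\<^sup>2)\<close>, which makes sense without a unit.\<close>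

lemma one_minus_sqrt:
  assumes a: "a \<in> carrier A" "star A a = a" "nrm A a < 1"
  obtains c where "c \<in> carrier A" "star A c = c" "a \<otimes> c = c \<otimes> a" "c \<oplus> c = a \<otimes> a \<oplus> c \<otimes> c"
proof -
  define r where "r = nrm A a"
  have r: "0 \<le> r" "r < 1" using a by (auto simp: r_def nrm_nonneg)
  \<comment> \<open>A fixed point c of this map satisfies 2 c = a^2 + c^2, that is (1 - c)^2 = 1 -
    a^2. On the ball of radius r = \<open>nrm A a\<close> the map stays inside, since r^2 \<le> r,
    and contracts by the factor r.\<close>
  define g where "g n = ((\<lambda>c. (1/2) \<odot> (a \<otimes> a \<oplus> c \<otimes> c)) ^^ n) \<zero>" for n
  have g0: "g 0 = \<zero>" and gS: "g (Suc n) = (1/2) \<odot> (a \<otimes> a \<oplus> g n \<otimes> g n)" for n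
    by (simp_all add: g_def)
  have g: "g n \<in> carrier A \<and> star A (g n) = g n \<and> a \<otimes> g n = g n \<otimes> a \<and> nrm A (g n) \<le> r" for n
  proof (induction n)
    case 0
    then show ?case using a r by (simp add: g0)
  next
    case (Suc n)
    have "nrm A (g (Suc n)) \<le> (1/2) * (nrm A (a \<otimes> a) + nrm A (g n \<otimes> g n))"
      using Suc a nrm_triangle[of "a \<otimes> a" "g n \<otimes> g n"] by (simp add: gS nrm_smult)
    also have "\<dots> \<le> (1/2) * (r * r + r * r)"
      using Suc a nrm_square_sa[of a] nrm_mult[of "g n" "g n"] mult_mono[of "nrm A (g n)" r "nrm A (g n)" r]
      by (simp add: r_def power2_eq_square nrm_nonneg)
    also have "\<dots> \<le> r" using r by (simp add: mult_left_le_one_le)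
    finally have n: "nrm A (g (Suc n)) \<le> r" .
    have "a \<otimes> (g n \<otimes> g n) = (g n \<otimes> a) \<otimes> g n"
      using Suc a by (simp add: mult_assoc[symmetric])
    also have "\<dots> = (g n \<otimes> g n) \<otimes> a" using Suc a by (simp add: mult_assoc)
    finally show ?case
      using Suc a n by (simp add: gS star_smult star_add star_mult smult_mult_left smult_mult_right
          distrib_left distrib_right mult_assoc)
  qed
  have "\<exists>c. conv g c"
  proof (rule geometric_imp_conv)
    fix n
    show "nrm A (g (Suc n) \<ominus> g n) \<le> nrm A (g 1) * r ^ n"
    proof (induction n)
      case 0
      then show ?case using g[of 1] by (simp add: g0)
    next
      case (Suc n)
      define x y where "x = g (Suc n)" and "y = g n"
      have c: "x \<in> carrier A" "y \<in> carrier A" "nrm A x \<le> r" "nrm A y \<le> r"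
        using g by (auto simp: x_def y_def)
      \<comment> \<open>A difference of squares without commuting factors; each summand carries one
        factor of norm at most r.\<close>
      have "x \<otimes> x \<ominus> y \<otimes> y = (x \<otimes> x \<ominus> y \<otimes> x) \<oplus> (y \<otimes> x \<ominus> y \<otimes> y)"
        using c by (simp add: a_minus_def M.a_assoc[symmetric]) (simp add: M.a_assoc M.l_neg)
      also have "\<dots> = (x \<ominus> y) \<otimes> x \<oplus> y \<otimes> (x \<ominus> y)"
        using c by (simp add: mult_diff_left mult_diff_right)
      finally have eq: "x \<otimes> x \<ominus> y \<otimes> y = (x \<ominus> y) \<otimes> x \<oplus> y \<otimes> (x \<ominus> y)" .
      have "g (Suc (Suc n)) \<ominus> g (Suc n) = (1/2) \<odot> ((a \<otimes> a \<oplus> x \<otimes> x) \<ominus> (a \<otimes> a \<oplus> y \<otimes> y))"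
        using a c by (simp add: smult_diff x_def[symmetric] gS[of "Suc n"]) (simp add: x_def y_def gS)
      also have "\<dots> = (1/2) \<odot> ((x \<ominus> y) \<otimes> x \<oplus> y \<otimes> (x \<ominus> y))"
        using a c by (simp add: add_diff_add eq)
      finally have "nrm A (g (Suc (Suc n)) \<ominus> g (Suc n))
          \<le> (1/2) * (nrm A ((x \<ominus> y) \<otimes> x) + nrm A (y \<otimes> (x \<ominus> y)))"
        using c nrm_triangle[of "(x \<ominus> y) \<otimes> x" "y \<otimes> (x \<ominus> y)"] by (simp add: nrm_smult)
      also have "\<dots> \<le> (1/2) * (nrm A (x \<ominus> y) * r + r * nrm A (x \<ominus> y))"
        using c r by (intro mult_left_mono add_mono order_trans[OF nrm_mult] mult_mono)
          (auto simp: nrm_nonneg)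
      also have "\<dots> = nrm A (x \<ominus> y) * r" by simp
      also have "\<dots> \<le> nrm A (g 1) * r ^ n * r"
        using Suc r by (intro mult_right_mono) (auto simp: x_def y_def)
      finally show ?case by (simp add: mult_ac)
    qed
  qed (use g r in auto)
  then obtain c where c: "conv g c" ..
  have cc: "c \<in> carrier A" using c by (rule conv_closed)
  have "conv g (star A c)" using conv_star[OF c] g by simp
  then have 1: "star A c = c" using c by (rule conv_unique)
  have "conv (\<lambda>n. g n \<otimes> a) (a \<otimes> c)"
    using conv_mult[OF conv_const[OF a(1)] c] g by simp
  moreover have "conv (\<lambda>n. g n \<otimes> a) (c \<otimes> a)"
    using conv_mult[OF c conv_const[OF a(1)]] by simp
  ultimately have 2: "a \<otimes> c = c \<otimes> a" by (rule conv_unique)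
  have "conv (\<lambda>n. g (Suc n)) ((1/2) \<odot> (a \<otimes> a \<oplus> c \<otimes> c))"
    unfolding gS using a by (intro conv_smult conv_add conv_mult c conv_const) auto
  then have 3: "c = (1/2) \<odot> (a \<otimes> a \<oplus> c \<otimes> c)"
    using conv_Suc[OF c] by (metis conv_unique)
  have "c \<oplus> c = (1/2 + 1/2) \<odot> (a \<otimes> a \<oplus> c \<otimes> c)"
    by (subst add_smult, use a cc in simp, simp only: 3[symmetric])
  then have "c \<oplus> c = a \<otimes> a \<oplus> c \<otimes> c" using a cc by simp
  then show ?thesis using that cc 1 2 by blast
qed

end

locale cstar_hom = A: cstar_algebra A + B: cstar_algebra B
  for A :: "('a, 'm) cstar_scheme" and B :: "('c, 'n) cstar_scheme" +
  fixes \<phi> :: "'a \<Rightarrow> 'c"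
  assumes star_hom: "star_hom A B \<phi>"
begin

lemma hom_closed [simp]: "x \<in> carrier A \<Longrightarrow> \<phi> x \<in> carrier B"
  and hom_add: "\<lbrakk>x \<in> carrier A; y \<in> carrier A\<rbrakk> \<Longrightarrow> \<phi> (x \<oplus>\<^bsub>A\<^esub> y) = \<phi> x \<oplus>\<^bsub>B\<^esub> \<phi> y"
  and hom_smult: "x \<in> carrier A \<Longrightarrow> \<phi> (c \<odot>\<^bsub>A\<^esub> x) = c \<odot>\<^bsub>B\<^esub> \<phi> x"
  and hom_mult: "\<lbrakk>x \<in> carrier A; y \<in> carrier A\<rbrakk> \<Longrightarrow> \<phi> (x \<otimes>\<^bsub>A\<^esub> y) = \<phi> x \<otimes>\<^bsub>B\<^esub> \<phi> y"
  and hom_star: "x \<in> carrier A \<Longrightarrow> \<phi> (star A x) = star B (\<phi> x)"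
  using star_hom by (auto simp: star_hom_def)

lemma hom_zero [simp]: "\<phi> \<zero>\<^bsub>A\<^esub> = \<zero>\<^bsub>B\<^esub>"
  using hom_smult[of "\<zero>\<^bsub>A\<^esub>" 0] by simp

lemma hom_diff: "\<lbrakk>x \<in> carrier A; y \<in> carrier A\<rbrakk> \<Longrightarrow> \<phi> (x \<ominus>\<^bsub>A\<^esub> y) = \<phi> x \<ominus>\<^bsub>B\<^esub> \<phi> y"
  by (simp add: A.diff_eq B.diff_eq hom_add hom_smult)

end

context cstar_algebra
begin

text \<open>The square of the self-adjoint element \<open>x\<close>, iterated; it replaces powers, for which
  HOL-Algebra would need a unit.\<close>

definition sq :: "nat \<Rightarrow> 'a \<Rightarrow> 'a" where
  "sq n x = ((\<lambda>y. y \<otimes> y) ^^ n) x"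

lemma sq_simps [simp]: "sq 0 x = x" "sq (Suc n) x = sq n x \<otimes> sq n x"
  by (simp_all add: sq_def)

lemma sq_sa:
  assumes "x \<in> carrier A" "star A x = x"
  shows "sq n x \<in> carrier A" "star A (sq n x) = sq n x" "nrm A (sq n x) = nrm A x ^ (2 ^ n)"
proof -
  have "sq n x \<in> carrier A \<and> star A (sq n x) = sq n x \<and> nrm A (sq n x) = nrm A x ^ (2 ^ n)"
  proof (induction n)
    case (Suc n)
    then show ?case using assms
      by (simp add: star_mult nrm_square_sa power_mult[symmetric] mult.commute)
  qed (use assms in auto)
  then show "sq n x \<in> carrier A" "star A (sq n x) = sq n x" "nrm A (sq n x) = nrm A x ^ (2 ^ n)"
    by auto
qed

text \<open>Otherwise said, \<open>1 - d + \<i> l\<close> is unitary.\<close>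

lemma unitary_part_bounded:
  assumes l: "l \<in> carrier A" "star A l = l" and d: "d \<in> carrier A" "star A d = d"
    and com: "l \<otimes> d = d \<otimes> l" and eq: "d \<oplus> d = l \<otimes> l \<oplus> d \<otimes> d"
  shows "nrm A l \<le> 2"
proof -
  \<comment> \<open>\<open>v\<close> stands for the unitary minus the unit. Unitarity reads
    \<open>star A v \<otimes> v = (-1) \<odot> (v \<oplus> star A v)\<close>, which bounds
    \<open>nrm A v\<close> by 2, and l is the imaginary part of v.\<close>
  define v where "v = (-1) \<odot> d \<oplus> \<i> \<odot> l"
  have v: "v \<in> carrier A" using l d by (simp add: v_def)
  have sv: "star A v = (-1) \<odot> d \<oplus> (-\<i>) \<odot> l"
    using l d by (simp add: v_def star_add star_smult)
  have "star A v \<otimes> v = (d \<otimes> d \<oplus> \<i> \<odot> (d \<otimes> l)) \<oplus> ((-\<i>) \<odot> (d \<otimes> l) \<oplus> l \<otimes> l)"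
    unfolding sv unfolding v_def using l d
    by (simp add: distrib_left distrib_right smult_mult_left smult_mult_right smult_add com)
  also have "\<dots> = d \<otimes> d \<oplus> ((\<i> \<odot> (d \<otimes> l) \<oplus> (-\<i>) \<odot> (d \<otimes> l)) \<oplus> l \<otimes> l)"
    using l d by (simp add: M.a_assoc)
  also have "\<i> \<odot> (d \<otimes> l) \<oplus> (-\<i>) \<odot> (d \<otimes> l) = \<zero>"
    using l d by (simp add: add_smult[symmetric])
  also have "d \<otimes> d \<oplus> (\<zero> \<oplus> l \<otimes> l) = d \<oplus> d"
    using l d by (simp add: eq M.a_comm)
  finally have 1: "star A v \<otimes> v = 2 \<odot> d" 
    using d add_smult[of d 1 1] by simp
  have "v \<oplus> star A v = ((-1) \<odot> d \<oplus> (-1) \<odot> d) \<oplus> (\<i> \<odot> l \<oplus> (-\<i>) \<odot> l)"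
    using l d unfolding sv unfolding v_def by (simp add: M.a_ac)
  also have "\<dots> = (-2) \<odot> d"
    using l d by (simp add: add_smult[symmetric])
  finally have "2 \<odot> d = (-1) \<odot> (v \<oplus> star A v)" using d by simp
  then have "(nrm A v)\<^sup>2 = nrm A (v \<oplus> star A v)"
    using cstar_identity[OF v] v by (simp add: 1 nrm_smult)
  also have "\<dots> \<le> nrm A v + nrm A v"
    using nrm_triangle[of v "star A v"] v by (simp add: nrm_star)
  finally have nv: "nrm A v \<le> 2"
    using nrm_nonneg[OF v] by (cases "nrm A v = 0") (auto simp: power2_eq_square)
  have "v \<ominus> star A v = ((-1) \<odot> d \<oplus> 1 \<odot> d) \<oplus> (\<i> \<odot> l \<oplus> \<i> \<odot> l)"
    using l d unfolding sv unfolding v_def by (simp add: diff_eq smult_add M.a_ac)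
  also have "(-1) \<odot> d \<oplus> 1 \<odot> d = \<zero>"
    using d by (simp only: add_smult[symmetric]) simp
  finally have "v \<ominus> star A v = (2 * \<i>) \<odot> l"
    using l by (simp add: add_smult[symmetric])
  then have "2 * nrm A l = nrm A (v \<ominus> star A v)" using l by (simp add: nrm_smult norm_mult)
  also have "\<dots> \<le> nrm A v + nrm A v"
    using nrm_triangle[of v "(-1) \<odot> star A v"] v by (simp add: diff_eq nrm_star nrm_smult)
  finally show ?thesis using nv by simp
qed

end

context cstar_hom
begin

lemma hom_sq: "x \<in> carrier A \<Longrightarrow> star A x = x \<Longrightarrow> \<phi> (A.sq n x) = B.sq n (\<phi> x)"
  by (induction n) (simp_all add: hom_mult A.sq_sa)

text \<open>Boundedness comes without spectra: the equation that ties c to a is algebraic, so it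
  survives in the image, where it forces norm at most 2. The constant 4 is this 2 divided by the
  norm 1/2 to which x is scaled.\<close>

lemma hom_bounded_sa:
  assumes x: "x \<in> carrier A" "star A x = x"
  shows "nrm B (\<phi> x) \<le> 4 * nrm A x"
proof (cases "x = \<zero>\<^bsub>A\<^esub>")
  case False
  then have nx: "nrm A x > 0" using x A.nrm_nonneg[of x] A.nrm_eq_0_iff[of x] by force
  define a where "a = complex_of_real (1 / (2 * nrm A x)) \<odot>\<^bsub>A\<^esub> x"
  have a: "a \<in> carrier A" "star A a = a" "nrm A a < 1"
    using x nx by (auto simp: a_def A.star_smult A.nrm_smult norm_mult norm_divide)
  obtain c where c: "c \<in> carrier A" "star A c = c" "a \<otimes>\<^bsub>A\<^esub> c = c \<otimes>\<^bsub>A\<^esub> a"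
    "c \<oplus>\<^bsub>A\<^esub> c = a \<otimes>\<^bsub>A\<^esub> a \<oplus>\<^bsub>A\<^esub> c \<otimes>\<^bsub>A\<^esub> c"
    using A.one_minus_sqrt[OF a] .
  have "nrm B (\<phi> a) \<le> 2"
  proof (rule B.unitary_part_bounded)
    show "star B (\<phi> a) = \<phi> a" "star B (\<phi> c) = \<phi> c" using a c by (simp_all add: hom_star[symmetric])
    show "\<phi> a \<otimes>\<^bsub>B\<^esub> \<phi> c = \<phi> c \<otimes>\<^bsub>B\<^esub> \<phi> a" using a c by (simp add: hom_mult[symmetric])
    show "\<phi> c \<oplus>\<^bsub>B\<^esub> \<phi> c = \<phi> a \<otimes>\<^bsub>B\<^esub> \<phi> a \<oplus>\<^bsub>B\<^esub> \<phi> c \<otimes>\<^bsub>B\<^esub> \<phi> c"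
      using a c(1,4) by (simp add: hom_mult[symmetric] hom_add[symmetric])
  qed (use a c in auto)
  moreover have "nrm B (\<phi> a) = nrm B (\<phi> x) / (2 * nrm A x)"
    using x nx unfolding a_def hom_smult[OF x(1)] by (subst B.nrm_smult) (auto simp: norm_mult norm_divide)
  ultimately show ?thesis using nx by (simp add: field_simps)
qed simp

text \<open>Along iterated squares of x* x the constant 4 stays fixed while both norms are raised to
  the power \<open>2 ^ m\<close>, so it drops out. The C*-identity carries the result from x* x back
  to x.\<close>

lemma hom_contractive:
  assumes x: "x \<in> carrier A"
  shows "nrm B (\<phi> x) \<le> nrm A x"
proof -
  define h where "h = star A x \<otimes>\<^bsub>A\<^esub> x"
  have h: "h \<in> carrier A" "star A h = h" using x by (simp_all add: h_def A.star_mult A.star_star)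
  then have h': "\<phi> h \<in> carrier B" "star B (\<phi> h) = \<phi> h" by (simp_all add: hom_star[symmetric])
  have "nrm B (\<phi> h) \<le> nrm A h"
  proof (rule power_bound_imp_le[where a = 0 and b = 4])
    fix m
    have "nrm B (\<phi> (A.sq m h)) \<le> 4 * nrm A (A.sq m h)"
      using h A.sq_sa[OF h] by (intro hom_bounded_sa)
    then show "nrm B (\<phi> h) ^ (2 ^ m) \<le> (0 * 2 ^ m + 4) * nrm A h ^ (2 ^ m)"
      using h h' by (simp add: hom_sq A.sq_sa B.sq_sa)
  qed (use h h' in \<open>auto simp: A.nrm_nonneg B.nrm_nonneg\<close>)
  moreover have "nrm B (\<phi> h) = (nrm B (\<phi> x))\<^sup>2"
    using x by (simp add: h_def hom_mult hom_star B.cstar_identity)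
  ultimately have "(nrm B (\<phi> x))\<^sup>2 \<le> (nrm A x)\<^sup>2"
    using x by (simp add: h_def A.cstar_identity)
  then show ?thesis using A.nrm_nonneg[OF x] by (rule power2_le_imp_le)
qed

lemma hom_conv:
  assumes "A.conv f l"
  shows "B.conv (\<lambda>n. \<phi> (f n)) (\<phi> l)"
proof (rule B.convI)
  note c = A.conv_closed[OF assms]
  show "(\<lambda>n. nrm A (f n \<ominus>\<^bsub>A\<^esub> l)) \<longlonglongrightarrow> 0" using assms by (simp add: A.conv_def)
  show "nrm B (\<phi> (f n) \<ominus>\<^bsub>B\<^esub> \<phi> l) \<le> nrm A (f n \<ominus>\<^bsub>A\<^esub> l)" for n
    using c hom_contractive[of "f n \<ominus>\<^bsub>A\<^esub> l"] by (simp add: hom_diff)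
qed (use A.conv_closed[OF assms] in auto)

end

section \<open>Injective *-homomorphisms are isometric\<close>

lemma map_poly_of_real_simps:
  "map_poly complex_of_real (pCons a p) = pCons (complex_of_real a) (map_poly complex_of_real p)"
  "map_poly complex_of_real (Polynomial.smult a p) = Polynomial.smult (complex_of_real a) (map_poly complex_of_real p)"
  "map_poly complex_of_real (p - q) = map_poly complex_of_real p - map_poly complex_of_real q"
  by (simp_all add: map_poly_pCons poly_eq_iff coeff_map_poly)

lemma poly_map_poly_of_real:
  "poly (map_poly complex_of_real q) (complex_of_real t) = complex_of_real (poly q t)"
  by (induction q) (simp_all add: map_poly_of_real_simps)

section \<open>Polynomials applied to an operator, and the norm bound of the functional
  calculus\<close>

context cstar_algebra
begin

lemma add_neg_cancel:
  assumes "x \<in> carrier A" "y \<in> carrier A"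
  shows "x \<oplus> ((-1) \<odot> x \<oplus> y) = y" "(-1) \<odot> x \<oplus> (x \<oplus> y) = y"
  using assms by (simp_all add: minus_eq_smult[symmetric] M.a_assoc[symmetric] M.r_neg M.l_neg)

definition linop :: "('a \<Rightarrow> 'a) \<Rightarrow> bool" where
  "linop T \<longleftrightarrow> T \<in> carrier A \<rightarrow> carrier A \<and>
    (\<forall>x\<in>carrier A. \<forall>y\<in>carrier A. T (x \<oplus> y) = T x \<oplus> T y) \<and>
    (\<forall>c. \<forall>x\<in>carrier A. T (c \<odot> x) = c \<odot> T x)"

lemma linopD:
  assumes "linop T"
  shows "x \<in> carrier A \<Longrightarrow> T x \<in> carrier A"
    "\<lbrakk>x \<in> carrier A; y \<in> carrier A\<rbrakk> \<Longrightarrow> T (x \<oplus> y) = T x \<oplus> T y"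
    "x \<in> carrier A \<Longrightarrow> T (c \<odot> x) = c \<odot> T x"
    "T \<zero> = \<zero>"
  using assms zero_smult[of \<zero>] zero_smult[of "T \<zero>"] by (auto simp: linop_def Pi_iff) (metis M.zero_closed zero_smult)

lemma linop_mult: "h \<in> carrier A \<Longrightarrow> linop (\<lambda>b. h \<otimes> b)"
  by (simp add: linop_def distrib_left smult_mult_right)

text \<open>Horner's scheme for \<open>p(T) b\<close>. Without a unit, a polynomial with constant
  term has no value at h, but it can be applied to b. With left multiplication by h as T and b = h
  the result is the value at h of the polynomial \<open>t * p t\<close>.\<close>

definition pact :: "('a \<Rightarrow> 'a) \<Rightarrow> complex poly \<Rightarrow> 'a \<Rightarrow> 'a" where
  "pact T p b = fold_coeffs (\<lambda>a y. a \<odot> b \<oplus> T y) p \<zero>"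

lemma pact_0 [simp]: "pact T 0 b = \<zero>"
  by (simp add: pact_def)

lemma pact_pCons:
  assumes "linop T" "b \<in> carrier A"
  shows "pact T (pCons a p) b = a \<odot> b \<oplus> T (pact T p b)"
  using assms by (cases "p = 0 \<and> a = 0") (auto simp: pact_def linopD)

lemma pact_closed [simp]:
  assumes "linop T" "b \<in> carrier A"
  shows "pact T p b \<in> carrier A"
  using assms by (induction p) (simp_all add: pact_pCons linopD)

lemma pact_add:
  assumes "linop T" "b \<in> carrier A"
  shows "pact T (p + q) b = pact T p b \<oplus> pact T q b"
proof (induction p q rule: poly_induct2)
  case (pCons a p c q)
  then show ?case using assms by (simp add: pact_pCons linopD add_smult M.a_ac)
qed simp

lemma pact_smult:
  assumes "linop T" "b \<in> carrier A"
  shows "pact T (Polynomial.smult a p) b = a \<odot> pact T p b"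
  using assms by (induction p) (simp_all add: pact_pCons linopD smult_add)

lemma pact_mult:
  assumes "linop T" "b \<in> carrier A"
  shows "pact T (p * q) b = pact T p (pact T q b)"
  using assms by (induction p) (simp_all add: pact_pCons pact_add pact_smult linopD)

lemma linop_pact:
  assumes "linop T"
  shows "linop (pact T p)"
proof -
  have "pact T p (x \<oplus> y) = pact T p x \<oplus> pact T p y" "pact T p (c \<odot> x) = c \<odot> pact T p x"
    if "x \<in> carrier A" "y \<in> carrier A" for x y c
    using assms that by (induction p) (simp_all add: pact_pCons linopD smult_add M.a_ac mult.commute)
  then show ?thesis using assms unfolding linop_def[of "pact T p"] by (metis M.zero_closed Pi_I pact_closed)
qed

lemma pact_1: "linop T \<Longrightarrow> b \<in> carrier A \<Longrightarrow> pact T [:a:] b = a \<odot> b"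
  by (simp add: pact_pCons linopD)

lemma pact_monom:
  assumes "linop T" "b \<in> carrier A"
  shows "pact T (monom a n) b = a \<odot> (T ^^ n) b \<and> (T ^^ n) b \<in> carrier A"
  using assms by (induction n) (simp_all add: monom_0 monom_Suc pact_pCons linopD)

text \<open>The crude triangle inequality, one term for each coefficient. Its loss is linear in the
  degree, which the passage to high powers can absorb.\<close>

lemma pact_nrm_le:
  fixes M :: real
  assumes T: "linop T" "\<And>x. x \<in> carrier A \<Longrightarrow> nrm A (T x) \<le> nrm A x" and b: "b \<in> carrier A"
    and M: "\<And>j. cmod (coeff p j) \<le> M"
  shows "nrm A (pact T p b) \<le> (degree p + 1) * M * nrm A b"
  using M
proof (induction p)
  case 0
  have "0 \<le> M" using 0[of 0] by simp
  then show ?case using b by (simp add: nrm_nonneg)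
next
  case (pCons a p)
  have a: "cmod a \<le> M" using pCons.prems[of 0] by simp
  have M': "cmod (coeff p j) \<le> M" for j using pCons.prems[of "Suc j"] by simp
  show ?case
  proof (cases "p = 0")
    case True
    then show ?thesis using a b T
      by (simp add: pact_pCons linopD nrm_smult mult_right_mono nrm_nonneg)
  next
    case False
    have "nrm A (pact T (pCons a p) b) \<le> nrm A (a \<odot> b) + nrm A (T (pact T p b))"
      using T b by (simp add: pact_pCons nrm_triangle linopD)
    also have "\<dots> \<le> M * nrm A b + (degree p + 1) * M * nrm A b"
      using T(1) b a by (intro add_mono order_trans[OF T(2) pCons.IH[OF M']])
        (auto simp: nrm_smult mult_right_mono nrm_nonneg)
    also have "\<dots> = (degree (pCons a p) + 1) * M * nrm A b"
      using False by (simp add: algebra_simps)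
    finally show ?thesis .
  qed
qed

text \<open>The function \<open>R\<close> below is \<open>z ^ N * q ((z + 1/z) / 2)\<close> on the unit circle.\<close>

lemma pact_eq_laurent:
  assumes h: "h \<in> carrier A" and U: "linop U"
    and rel: "\<And>b. b \<in> carrier A \<Longrightarrow> U (h \<otimes> b) = (1/2) \<odot> (U (U b) \<oplus> b)"
    and b: "b \<in> carrier A"
  shows "degree q \<le> N \<Longrightarrow> \<exists>R. degree R \<le> 2 * N \<and>
    (\<forall>z. cmod z = 1 \<longrightarrow> poly R z = z ^ N * poly q (complex_of_real (Re z))) \<and>
    (U ^^ N) (pact ((\<otimes>) h) q b) = pact U R b"
proof (induction q arbitrary: N)
  case 0
  have "(U ^^ N) \<zero> = \<zero>" using U by (induction N) (auto simp: linopD)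
  then show ?case by (intro exI[of _ 0]) simp
next
  case (pCons a q)
  have L: "linop ((\<otimes>) h)" using linop_mult[OF h] .
  show ?case
  proof (cases "q = 0")
    case True
    have "(U ^^ N) (a \<odot> b) = a \<odot> (U ^^ N) b"
      using U b by (induction N) (simp_all add: linopD pact_monom[OF U b, THEN conjunct2])
    then show ?thesis using True U b h L
      by (intro exI[of _ "monom a N"])
        (auto simp: poly_monom pact_monom pact_1 intro: order_trans[OF degree_monom_le])
  next
    case False
    with pCons.prems obtain K where K: "N = Suc K" "degree q \<le> K"
      by (cases N) auto
    from pCons.IH[OF this(2)] obtain R where R: "degree R \<le> 2 * K"
      "\<And>z. cmod z = 1 \<Longrightarrow> poly R z = z ^ K * poly q (complex_of_real (Re z))"
      "(U ^^ K) (pact ((\<otimes>) h) q b) = pact U R b" by blast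
    define y where "y = pact ((\<otimes>) h) q b"
    have y: "y \<in> carrier A" unfolding y_def using L b by simp
    have Un: "(U ^^ n) x \<in> carrier A" if "x \<in> carrier A" for n x
      using that U by (induction n) (auto simp: linopD)
    \<comment> \<open>This is h = (U + U^-1) / 2 multiplied by U^n; for n > 0 it involves
      nonnegative powers of U only.\<close>
    have Uh: "(U ^^ n) (h \<otimes> x) = (1/2) \<odot> (U ((U ^^ n) x) \<oplus> (U ^^ (n-1)) x)"
      if "x \<in> carrier A" "n > 0" for n x
      using that(2)
    proof (induction n)
      case (Suc n)
      then show ?case
      proof (cases n)
        case (Suc m)
        then show ?thesis using Suc.IH Suc.prems that(1) U Un h by (simp add: linopD)
      qed (use rel that in simp)
    qed simp
    \<comment> \<open>Horner step for \<open>pCons a q\<close>: multiplying by Re z = (z + 1/z) / 2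
      and raising the power of z by one turns R into (1 + z^2) R / 2, and the constant a becomes a
      z^N.\<close>
    define R' where "R' = monom a N + Polynomial.smult (1/2) ([:1, 0, 1:] * R)"
    have "degree R' \<le> 2 * N"
      unfolding R'_def
    proof (intro degree_add_le order_trans[OF degree_monom_le] order_trans[OF degree_smult_le])
      have "degree ([:1, 0, 1:] * R) \<le> 2 + degree R"
        by (rule order_trans[OF degree_mult_le]) simp
      then show "degree ([:1, 0, 1:] * R) \<le> 2 * N" using R(1) K by simp
    qed (use K in auto)
    moreover have "poly R' z = z ^ N * poly (pCons a q) (complex_of_real (Re z))" if "cmod z = 1" for z
    proof -
      have "z * cnj z = 1" using that by (simp add: complex_mult_cnj cmod_def)
      then have "1 + z * z = z * (z + cnj z)" by (simp add: algebra_simps)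
      also have "z + cnj z = 2 * complex_of_real (Re z)" by (simp add: complex_add_cnj)
      finally have "1 + z * z = z * (2 * complex_of_real (Re z))" .
      moreover have "poly R' z = a * z ^ N + (1/2) * ((1 + z * z) * poly R z)"
        by (simp add: R'_def poly_monom algebra_simps)
      ultimately show ?thesis by (simp add: R(2)[OF that] K algebra_simps)
    qed
    moreover have "(U ^^ N) (pact ((\<otimes>) h) (pCons a q) b) = pact U R' b"
    proof -
      have "linop (U ^^ n)" for n
        using U by (induction n) (auto simp: linop_def Pi_iff)
      note Ul = linopD[OF this]
      have "(U ^^ N) (pact ((\<otimes>) h) (pCons a q) b) = a \<odot> (U ^^ N) b \<oplus> (U ^^ N) (h \<otimes> y)"
        using L b h y by (simp add: pact_pCons Ul y_def del: funpow.simps)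
      also have "(U ^^ N) (h \<otimes> y) = (1/2) \<odot> (U (U (pact U R b)) \<oplus> pact U R b)"
        using Uh[OF y, of N] R(3) by (simp add: K(1) y_def)
      also have "a \<odot> (U ^^ N) b \<oplus> \<dots> = pact U R' b"
        using U b by (simp add: R'_def pact_add pact_smult pact_mult pact_monom pact_pCons linopD M.a_comm)
      finally show ?thesis .
    qed
    ultimately show ?thesis by blast
  qed
qed

text \<open>U is left multiplication by h + i sqrt(1 - h^2), an element that in general lies in the
  unitization only; as an operator on the algebra it makes sense through c = 1 - sqrt(1 - h^2). The
  relation says h U = (U^2 + 1) / 2, and the C*-identity turns modulus one into preservation of
  norms.\<close>

lemma sa_dilation:
  assumes h: "h \<in> carrier A" "star A h = h" "nrm A h < 1"
  obtains U where "linop U" "\<And>b. b \<in> carrier A \<Longrightarrow> nrm A (U b) = nrm A b"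
    "\<And>b. b \<in> carrier A \<Longrightarrow> U (h \<otimes> b) = (1/2) \<odot> (U (U b) \<oplus> b)"
proof -
  obtain c where c: "c \<in> carrier A" "star A c = c" "h \<otimes> c = c \<otimes> h" "c \<oplus> c = h \<otimes> h \<oplus> c \<otimes> c"
    using one_minus_sqrt[OF h] .
  \<comment> \<open>\<open>y\<close> applies the root of 1 - h^2: its square is computed in
    \<open>yy\<close>, and \<open>syz\<close> says that it is self-adjoint.\<close>
  define y where "y b = b \<ominus> c \<otimes> b" for b
  define U where "U b = h \<otimes> b \<oplus> \<i> \<odot> y b" for b
  have y: "y b \<in> carrier A" if "b \<in> carrier A" for b using that c by (simp add: y_def)
  have yl: "y (a \<oplus> b) = y a \<oplus> y b" "y (z \<odot> a) = z \<odot> y a" "h \<otimes> y a = y (h \<otimes> a)"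
    if "a \<in> carrier A" "b \<in> carrier A" for a b z
    using that c h
    by (simp_all add: y_def distrib_left smult_mult_right add_diff_add smult_diff mult_diff_left
        mult_assoc[symmetric])
  have Uc: "U b \<in> carrier A" if "b \<in> carrier A" for b using that h y by (simp add: U_def)
  have yy: "y (y b) = b \<ominus> h \<otimes> (h \<otimes> b)" if b: "b \<in> carrier A" for b
  proof -
    have "y (y b) = b \<ominus> (c \<otimes> b \<oplus> c \<otimes> b) \<oplus> c \<otimes> (c \<otimes> b)"
      using b c by (simp add: y_def mult_diff_left diff_eq smult_add M.a_ac smult_mult_right distrib_left)
    also have "c \<otimes> b \<oplus> c \<otimes> b = (h \<otimes> h \<oplus> c \<otimes> c) \<otimes> b"
      using b c(1) by (simp add: distrib_right[symmetric] c(4))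
    also have "\<dots> = h \<otimes> (h \<otimes> b) \<oplus> c \<otimes> (c \<otimes> b)"
      using b c h by (simp add: distrib_right mult_assoc)
    also have "b \<ominus> \<dots> = b \<ominus> h \<otimes> (h \<otimes> b) \<ominus> c \<otimes> (c \<otimes> b)"
      using b c h by (simp add: diff_eq smult_add M.a_assoc)
    also have "\<dots> \<oplus> c \<otimes> (c \<otimes> b) = b \<ominus> h \<otimes> (h \<otimes> b)"
      using b c h by (simp add: diff_add_cancel)
    finally show ?thesis .
  qed
  have lin: "linop U"
    unfolding linop_def using h y
    by (auto simp: U_def distrib_left smult_mult_right yl smult_add M.a_ac mult.commute)
  have iso: "nrm A (U b) = nrm A b" if b: "b \<in> carrier A" for b
  proof -
    define s where "s = star A b"
    have s: "s \<in> carrier A" using b by (simp add: s_def)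
    have sy: "star A (y b) = s \<ominus> s \<otimes> c"
      using b c by (simp add: y_def star_diff star_mult s_def)
    have syz: "star A (y b) \<otimes> z = s \<otimes> y z" if "z \<in> carrier A" for z
      unfolding sy using that s c by (simp add: y_def mult_diff_left mult_diff_right mult_assoc)
    have "star A (U b) = s \<otimes> h \<oplus> (-\<i>) \<odot> star A (y b)"
      using b h y by (simp add: U_def star_add star_mult star_smult s_def)
    then have "star A (U b) \<otimes> U b = s \<otimes> (h \<otimes> U b) \<oplus> (-\<i>) \<odot> (s \<otimes> y (U b))"
      using b h y[OF b] s Uc[OF b] syz[OF Uc[OF b]] by (simp add: distrib_right smult_mult_left mult_assoc)
    also have "\<dots> = s \<otimes> (h \<otimes> (h \<otimes> b) \<oplus> \<i> \<odot> y (h \<otimes> b) \<oplus> (-\<i>) \<odot> (y (h \<otimes> b) \<oplus> \<i> \<odot> y (y b)))"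
      using b h y s by (simp add: U_def yl smult_mult_right distrib_left)
    also have "\<dots> = s \<otimes> (h \<otimes> (h \<otimes> b) \<oplus> (\<i> \<odot> y (h \<otimes> b) \<oplus> (-\<i>) \<odot> y (h \<otimes> b)) \<oplus> y (y b))"
      using b h y s by (simp add: smult_add M.a_assoc)
    also have "\<i> \<odot> y (h \<otimes> b) \<oplus> (-\<i>) \<odot> y (h \<otimes> b) = \<zero>"
      using b h y by (simp add: add_smult[symmetric])
    also have "h \<otimes> (h \<otimes> b) \<oplus> \<zero> \<oplus> y (y b) = b"
      using b h by (simp add: yy diff_add_cancel M.a_comm[of "h \<otimes> (h \<otimes> b)"])
    finally have "star A (U b) \<otimes> U b = star A b \<otimes> b" by (simp add: s_def)
    then have "(nrm A (U b))\<^sup>2 = (nrm A b)\<^sup>2"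
      using cstar_identity[OF b] cstar_identity[OF Uc[OF b]] by simp
    then show ?thesis using nrm_nonneg b Uc by simp
  qed
  have rel: "U (h \<otimes> b) = (1/2) \<odot> (U (U b) \<oplus> b)" if b: "b \<in> carrier A" for b
  proof -
    have "U (U b) \<oplus> b = h \<otimes> (h \<otimes> b) \<oplus> \<i> \<odot> y (h \<otimes> b) \<oplus> (\<i> \<odot> y (h \<otimes> b) \<oplus> (-1) \<odot> (b \<ominus> h \<otimes> (h \<otimes> b))) \<oplus> b"
      using b h y by (simp add: U_def distrib_left smult_mult_right yl smult_add yy)
    also have "\<dots> = (h \<otimes> (h \<otimes> b) \<oplus> \<i> \<odot> y (h \<otimes> b)) \<oplus> (\<i> \<odot> y (h \<otimes> b) \<oplus> h \<otimes> (h \<otimes> b)) \<oplus> (b \<ominus> b)"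
      using b h y by (simp add: diff_eq smult_add M.a_ac add_neg_cancel)
    also have "\<dots> = U (h \<otimes> b) \<oplus> U (h \<otimes> b)"
      using b h y by (simp add: U_def M.a_ac)
    also have "\<dots> = 2 \<odot> U (h \<otimes> b)"
      using Uc[of "h \<otimes> b"] b h add_smult[of "U (h \<otimes> b)" 1 1] by simp
    finally show ?thesis using Uc[of "h \<otimes> b"] b h by simp
  qed
  from lin iso rel show ?thesis by (rule that)
qed

text \<open>As z runs through the circle, Re z runs through [-1, 1], so M bounds the polynomial R
  there and hence each of its coefficients. There are at most 2 N + 1 of them, and
  \<open>U ^^ N\<close> does not change norms.\<close>

lemma pact_bound_crude:
  fixes M :: real
  assumes h: "h \<in> carrier A" "star A h = h" "nrm A h < 1" and b: "b \<in> carrier A"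
    and M: "\<And>t::real. \<bar>t\<bar> \<le> 1 \<Longrightarrow> cmod (poly q (complex_of_real t)) \<le> M"
  shows "nrm A (pact ((\<otimes>) h) q b) \<le> (2 * degree q + 1) * M * nrm A b"
proof -
  obtain U where U: "linop U" "\<And>b. b \<in> carrier A \<Longrightarrow> nrm A (U b) = nrm A b"
    "\<And>b. b \<in> carrier A \<Longrightarrow> U (h \<otimes> b) = (1/2) \<odot> (U (U b) \<oplus> b)"
    using sa_dilation[OF h] by blast
  define N where "N = degree q"
  obtain R where R: "degree R \<le> 2 * N"
    "\<And>z. cmod z = 1 \<Longrightarrow> poly R z = z ^ N * poly q (complex_of_real (Re z))"
    "(U ^^ N) (pact ((\<otimes>) h) q b) = pact U R b"
    using pact_eq_laurent[OF h(1) U(1,3) b, of q N] by (auto simp: N_def)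
  have "0 \<le> M" using M[of 0] by (smt (verit) norm_ge_zero abs_0)
  have "cmod (coeff R j) \<le> M" for j
  proof (rule coeff_bound_unit_circle)
    fix z :: complex assume z: "cmod z = 1"
    then have "\<bar>Re z\<bar> \<le> 1" using abs_Re_le_cmod[of z] by simp
    then show "cmod (poly R z) \<le> M" using M z by (simp add: R(2) norm_mult norm_power)
  qed
  then have "nrm A (pact U R b) \<le> (degree R + 1) * M * nrm A b"
    using U b by (intro pact_nrm_le) auto
  also have "\<dots> \<le> (2 * N + 1) * M * nrm A b"
    using R(1) \<open>0 \<le> M\<close> b by (intro mult_right_mono) (auto simp: nrm_nonneg)
  finally have "nrm A (pact U R b) \<le> (2 * N + 1) * M * nrm A b" .
  moreover have "nrm A ((U ^^ n) x) = nrm A x \<and> (U ^^ n) x \<in> carrier A" if "x \<in> carrier A" for n x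
    using that U by (induction n) (auto simp: linopD)
  ultimately show ?thesis
    using R(3) linop_mult[OF h(1)] b by (simp add: N_def flip: R(3))
qed

lemma pact_left_mult:
  assumes h: "h \<in> carrier A" and b: "b \<in> carrier A"
  shows "pact ((\<otimes>) h) p h \<otimes> b = pact ((\<otimes>) h) p (h \<otimes> b)"
    "pact ((\<otimes>) h) (pCons 0 p) b = pact ((\<otimes>) h) p h \<otimes> b"
proof -
  note L = linop_mult[OF h]
  show 1: "pact ((\<otimes>) h) p h \<otimes> b = pact ((\<otimes>) h) p (h \<otimes> b)"
    using h b L by (induction p) (simp_all add: pact_pCons distrib_right smult_mult_left mult_assoc)
  have "pact ((\<otimes>) h) p (h \<otimes> b) = h \<otimes> pact ((\<otimes>) h) p b"
    using h b L by (induction p) (simp_all add: pact_pCons distrib_left smult_mult_right)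
  then show "pact ((\<otimes>) h) (pCons 0 p) b = pact ((\<otimes>) h) p h \<otimes> b"
    using h b L by (simp add: pact_pCons 1)
qed

lemma pact_real_sa:
  assumes h: "h \<in> carrier A" "star A h = h"
  shows "star A (pact ((\<otimes>) h) (map_poly complex_of_real q) h) = pact ((\<otimes>) h) (map_poly complex_of_real q) h"
proof -
  define w where "w = pact ((\<otimes>) h) (map_poly complex_of_real q) h"
  note L = linop_mult[OF h(1)]
  \<comment> \<open>Commuting with h is carried through the induction, because the adjoint of h v is
    v h.\<close>
  have "star A w = w \<and> h \<otimes> w = w \<otimes> h"
    unfolding w_def
  proof (induction q)
    case (pCons a q)
    define v where "v = pact ((\<otimes>) h) (map_poly complex_of_real q) h"
    have v: "v \<in> carrier A" "star A v = v" "h \<otimes> v = v \<otimes> h"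
      using pCons h L by (simp_all add: v_def)
    have "h \<otimes> (h \<otimes> v) = (h \<otimes> v) \<otimes> h" using mult_assoc[OF h(1) v(1) h(1)] by (simp add: v(3))
    then show ?case using h L v
      by (simp add: map_poly_of_real_simps pact_pCons star_add star_smult star_mult v_def[symmetric]
        distrib_left distrib_right smult_mult_left smult_mult_right)
  qed (use h in simp)
  then show ?thesis by (simp add: w_def)
qed

text \<open>The element is the value at h of P = t q(t), and its iterated squares belong to powers
  of P. The degree of \<open>P ^ (2 ^ n)\<close> is at most \<open>degree P * 2 ^ n\<close>, so the
  crude factor is linear in \<open>2 ^ n\<close> and disappears.\<close>

lemma pact_real_bound_1:
  fixes M :: real
  assumes h: "h \<in> carrier A" "star A h = h" "nrm A h < 1"
    and M: "\<And>t. \<bar>t\<bar> \<le> 1 \<Longrightarrow> \<bar>t * poly q t\<bar> \<le> M"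
  shows "nrm A (pact ((\<otimes>) h) (map_poly complex_of_real q) h) \<le> M"
proof -
  note L = linop_mult[OF h(1)]
  define p where "p = map_poly complex_of_real q"
  define w where "w = pact ((\<otimes>) h) p h"
  have w: "w \<in> carrier A" "star A w = w"
    using h L pact_real_sa[OF h(1,2)] by (auto simp: w_def p_def)
  have M0: "0 \<le> M" using M[of 0] by simp
  define P where "P = pCons 0 p"
  have sqP: "sq n w \<otimes> b = pact ((\<otimes>) h) (P ^ (2 ^ n)) b" if "b \<in> carrier A" for n b
    using that
  proof (induction n arbitrary: b)
    case 0
    then show ?case using pact_left_mult(2)[OF h(1)] by (simp add: P_def w_def)
  next
    case (Suc n)
    have "P ^ (2 ^ Suc n) = P ^ (2 ^ n) * P ^ (2 ^ n)"
      by (simp add: power_add[symmetric] mult_2)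
    then show ?case
      using Suc.prems L sq_sa[OF w] by (simp add: pact_mult Suc.IH[symmetric] mult_assoc)
  qed
  have "nrm A w \<le> M"
  proof (rule power_bound_imp_le[where a = "2 * degree P" and b = 1])
    fix n
    define y where "y = nrm A w ^ (2 ^ n)"
    have y: "y = nrm A (sq n w)" "y \<ge> 0" using w by (auto simp: y_def sq_sa nrm_nonneg)
    \<comment> \<open>The polynomial has to act on some element. The choice of \<open>sq n w\<close>
      itself makes the left side a square, from which one factor \<open>y\<close> is cancelled
      afterwards.\<close>
    have "nrm A (sq n w \<otimes> sq n w) \<le> (2 * degree (P ^ (2 ^ n)) + 1) * M ^ (2 ^ n) * nrm A (sq n w)"
      unfolding sqP[OF sq_sa(1)[OF w]]
    proof (rule pact_bound_crude[OF h])
      fix t :: real assume t: "\<bar>t\<bar> \<le> 1"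
      have "cmod (poly P (complex_of_real t)) = \<bar>t * poly q t\<bar>"
        by (simp add: P_def p_def poly_map_poly_of_real norm_mult abs_mult)
      then show "cmod (poly (P ^ (2 ^ n)) (complex_of_real t)) \<le> M ^ (2 ^ n)"
        using M[OF t] by (simp add: poly_power norm_power power_mono)
    qed (use w sq_sa in auto)
    also have "\<dots> \<le> (2 * degree P * 2 ^ n + 1) * M ^ (2 ^ n) * y"
    proof -
      have "real (degree (P ^ (2 ^ n))) \<le> real (degree P * 2 ^ n)"
        using degree_power_le[of P "2 ^ n"] by (simp only: of_nat_le_iff)
      then show ?thesis
        unfolding y(1)[symmetric] using y(2) M0 by (intro mult_right_mono) auto
    qed
    finally have "y * y \<le> (2 * degree P * 2 ^ n + 1) * M ^ (2 ^ n) * y"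
      using w sq_sa[OF w] by (simp add: nrm_square_sa power2_eq_square y)
    then have "y \<le> (2 * degree P * 2 ^ n + 1) * M ^ (2 ^ n)"
      using y(2) M0 by (cases "y = 0") auto
    then show "nrm A w ^ (2 ^ n) \<le> (real (2 * degree P) * 2 ^ n + 1) * M ^ (2 ^ n)"
      by (simp add: y_def add.commute)
  qed (use w M0 in \<open>auto simp: nrm_nonneg\<close>)
  then show ?thesis by (simp add: w_def p_def)
qed

text \<open>The substitution t = r u reduces to norm below 1. The strict bound on h is what the
  construction of the square root asks for.\<close>

lemma pact_real_bound:
  fixes M r :: real
  assumes h: "h \<in> carrier A" "star A h = h" "nrm A h < r"
    and M: "\<And>t. \<bar>t\<bar> \<le> r \<Longrightarrow> \<bar>t * poly q t\<bar> \<le> M"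
  shows "nrm A (pact ((\<otimes>) h) (map_poly complex_of_real q) h) \<le> M"
proof -
  have r: "r > 0" using h nrm_nonneg[of h] by linarith
  define k where "k = complex_of_real (1 / r) \<odot> h"
  have k: "k \<in> carrier A" "star A k = k" "nrm A k < 1" and hk: "h = complex_of_real r \<odot> k"
    using h r by (auto simp: k_def star_smult nrm_smult norm_divide field_simps)
  note Lh = linop_mult[OF h(1)] and Lk = linop_mult[OF k(1)]
  define c where "c q = pcompose q [:0, r:]" for q
  have cc: "c (pCons a q) = pCons a (Polynomial.smult r (c q))" for a q
    by (simp add: c_def pcompose_pCons)
  have scale: "pact ((\<otimes>) h) (map_poly complex_of_real q) b = pact ((\<otimes>) k) (map_poly complex_of_real (c q)) b"
    if "b \<in> carrier A" for b
  proof (induction q)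
    case 0
    then show ?case by (simp add: c_def)
  next
    case (pCons a q)
    then show ?case using that Lh Lk k(1) h(1)
      by (simp add: cc map_poly_of_real_simps pact_pCons pact_smult smult_mult_right)
        (simp add: hk smult_mult_left)
  qed
  have "pact ((\<otimes>) h) (map_poly complex_of_real q) h
      = pact ((\<otimes>) k) (map_poly complex_of_real (Polynomial.smult r (c q))) k"
    unfolding scale[OF h(1)] using linopD(3)[OF linop_pact[OF Lk] k(1)]
    by (subst hk) (use Lk k in \<open>simp add: map_poly_of_real_simps pact_smult\<close>)
  moreover have "nrm A \<dots> \<le> M"
  proof (rule pact_real_bound_1[OF k])
    fix t :: real assume "\<bar>t\<bar> \<le> 1"
    then have "\<bar>r * t\<bar> \<le> r" using r by (simp add: abs_mult mult_left_le)
    from M[OF this] show "\<bar>t * poly (Polynomial.smult r (c q)) t\<bar> \<le> M"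
      by (simp add: c_def poly_pcompose mult_ac)
  qed
  ultimately show ?thesis by simp
qed

end

lemma poly_approximation:
  fixes g :: "real \<Rightarrow> real"
  assumes "continuous_on {-r..r} g" "e > 0"
  obtains q :: "real poly" where "\<And>t. \<bar>t\<bar> \<le> r \<Longrightarrow> \<bar>g t - poly q t\<bar> < e"
proof -
  obtain f where f: "real_polynomial_function f" "\<And>t. t \<in> {-r..r} \<Longrightarrow> \<bar>g t - f t\<bar> < e"
    using Stone_Weierstrass_real_polynomial_function[OF compact_Icc assms] by blast
  then obtain a n where "f = (\<lambda>x. \<Sum>i\<le>n. a i * x ^ i)"
    by (auto simp: real_polynomial_function_iff_sum)
  then have "f t = poly (\<Sum>i\<le>n. monom (a i) i) t" for t
    by (simp add: poly_sum poly_monom)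
  with f(2) show ?thesis by (intro that[of "\<Sum>i\<le>n. monom (a i) i"]) (simp add: abs_le_iff)
qed

context cstar_hom
begin

lemma hom_pact:
  assumes "h \<in> carrier A" "b \<in> carrier A"
  shows "\<phi> (A.pact ((\<otimes>\<^bsub>A\<^esub>) h) p b) = B.pact ((\<otimes>\<^bsub>B\<^esub>) (\<phi> h)) p (\<phi> b)"
  using assms A.linop_mult[OF assms(1)] B.linop_mult[OF hom_closed[OF assms(1)]]
  by (induction p) (simp_all add: A.pact_pCons B.pact_pCons hom_add hom_smult hom_mult)

text \<open>If the image \<open>k\<close> of \<open>h\<close> had smaller norm \<open>s\<close>, then a function of \<open>h\<close> that vanishes on
  \<open>[-s, s]\<close> and differs from the identity by at most \<open>s\<close> would be in the kernel.\<close>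

lemma inj_isometric_sa:
  assumes inj: "inj_on \<phi> (carrier A)" and h: "h \<in> carrier A" "star A h = h"
  shows "nrm A h \<le> nrm B (\<phi> h)"
proof (rule ccontr)
  assume "\<not> nrm A h \<le> nrm B (\<phi> h)"
  then obtain s where s: "nrm B (\<phi> h) < s" "s < nrm A h" 
    using dense[of "nrm B (\<phi> h)" "nrm A h"] by (auto simp: not_le)
  have k: "\<phi> h \<in> carrier B" "star B (\<phi> h) = \<phi> h" using h by (simp_all add: hom_star[symmetric])
  have s0: "s > 0" using s(1) B.nrm_nonneg[OF k(1)] by linarith
  define r where "r = nrm A h + 1"
  have r: "nrm A h < r" "s < r" "r > 0" using s s0 by (auto simp: r_def)
  \<comment> \<open>t g(t) is soft thresholding: 0 on [-s, s], and t moved by s towards 0 outside.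
    Approximating g instead of t g(t) makes every approximant a polynomial without constant
    term.\<close>
  define g where "g t = 1 - s / max s \<bar>t\<bar>" for t :: real
  have g: "continuous_on {-r..r} g"
    unfolding g_def using s0 by (intro continuous_intros) auto
  have "\<exists>q::real poly. \<forall>t. \<bar>t\<bar> \<le> r \<longrightarrow> \<bar>g t - poly q t\<bar> < 1 / Suc n" for n
  proof -
    have "1 / real (Suc n) > 0" by simp
    from poly_approximation[OF g this] show ?thesis by blast
  qed
  then obtain q :: "nat \<Rightarrow> real poly" where q: "\<And>n t. \<bar>t\<bar> \<le> r \<Longrightarrow> \<bar>g t - poly (q n) t\<bar> < 1 / Suc n"
    by metis
  have L: "A.linop ((\<otimes>\<^bsub>A\<^esub>) h)" using A.linop_mult[OF h(1)] .
  define w where "w n = A.pact ((\<otimes>\<^bsub>A\<^esub>) h) (map_poly complex_of_real (q n)) h" for n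
  have w: "w n \<in> carrier A" for n using L h by (simp add: w_def)
  have wd: "A.pact ((\<otimes>\<^bsub>A\<^esub>) h) (map_poly complex_of_real (u - v)) h =
      A.pact ((\<otimes>\<^bsub>A\<^esub>) h) (map_poly complex_of_real u) h \<ominus>\<^bsub>A\<^esub> A.pact ((\<otimes>\<^bsub>A\<^esub>) h) (map_poly complex_of_real v) h" for u v
  proof -
    have "map_poly complex_of_real (u - v)
        = map_poly complex_of_real u + Polynomial.smult (-1) (map_poly complex_of_real v)"
      by (simp add: map_poly_of_real_simps(3))
    then show ?thesis
      using L h by (simp only: A.pact_add A.pact_smult A.diff_eq A.pact_closed)
  qed
  have lim: "(\<lambda>n. K * (1 / real (Suc n))) \<longlonglongrightarrow> 0" for K
    using tendsto_mult_right_zero[OF LIMSEQ_inverse_real_of_nat, of K] by (simp add: inverse_eq_divide)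
  have "\<exists>y. A.conv w y"
  proof (rule A.cauchy_imp_conv[OF w])
    fix e :: real assume "e > 0"
    then have "\<forall>\<^sub>F n in sequentially. r * (1 / real (Suc n)) < e / 2"
      using lim[of r] by (intro order_tendstoD) auto
    then obtain N where N: "\<And>n. n \<ge> N \<Longrightarrow> r * (1 / real (Suc n)) < e / 2"
      by (auto simp: eventually_sequentially)
    have "nrm A (w m \<ominus>\<^bsub>A\<^esub> w n) < e" if "m \<ge> N" "n \<ge> N" for m n
    proof -
      have "nrm A (w m \<ominus>\<^bsub>A\<^esub> w n) \<le> r * (1 / Suc m + 1 / Suc n)"
            unfolding w_def wd[symmetric]
      proof (rule A.pact_real_bound[OF h r(1)])
        fix t :: real assume t: "\<bar>t\<bar> \<le> r"
        have "\<bar>poly (q m - q n) t\<bar> \<le> 1 / Suc m + 1 / Suc n"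
          using q[OF t, of m] q[OF t, of n] unfolding poly_diff by linarith
        then show "\<bar>t * poly (q m - q n) t\<bar> \<le> r * (1 / Suc m + 1 / Suc n)"
          unfolding abs_mult using t r by (intro mult_mono) auto
      qed
      also have "\<dots> < e" using N[OF that(1)] N[OF that(2)] unfolding distrib_left by linarith
      finally show ?thesis .
    qed
    then show "\<exists>N. \<forall>m\<ge>N. \<forall>n\<ge>N. nrm A (w m \<ominus>\<^bsub>A\<^esub> w n) < e" by blast
  qed
  then obtain y where y: "A.conv w y" ..
  \<comment> \<open>The interval [-s, s] is large enough for the image of h, and g vanishes on it,
    so the images of \<open>w n\<close> are small; the limit y of w is therefore in the
    kernel.\<close>
  have "B.conv (\<lambda>n. \<phi> (w n)) \<zero>\<^bsub>B\<^esub>"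
  proof (rule B.convI[OF _ _ lim[of s]])
    fix n
    have "nrm B (B.pact ((\<otimes>\<^bsub>B\<^esub>) (\<phi> h)) (map_poly complex_of_real (q n)) (\<phi> h)) \<le> s * (1 / Suc n)"
    proof (rule B.pact_real_bound[OF k s(1)])
      fix t :: real assume t: "\<bar>t\<bar> \<le> s"
      then have "g t = 0" using s0 by (simp add: g_def)
      then have "\<bar>poly (q n) t\<bar> \<le> 1 / Suc n" using q[of t n] t r by simp
      then show "\<bar>t * poly (q n) t\<bar> \<le> s * (1 / Suc n)"
        unfolding abs_mult using t s0 by (intro mult_mono) auto
    qed
    then show "nrm B (\<phi> (w n) \<ominus>\<^bsub>B\<^esub> \<zero>\<^bsub>B\<^esub>) \<le> s * (1 / real (Suc n))"
      using hom_closed[OF w[of n]] h by (simp add: w_def hom_pact del: hom_closed)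
  qed (use w in auto)
  with hom_conv[OF y] have "\<phi> y = \<zero>\<^bsub>B\<^esub>" by (rule B.conv_unique)
  then have "\<phi> y = \<phi> \<zero>\<^bsub>A\<^esub>" by simp
  then have "y = \<zero>\<^bsub>A\<^esub>"
    by (rule inj_onD[OF inj]) (use A.conv_closed[OF y] in auto)
  \<comment> \<open>\<open>[:1:]\<close> applied to h returns h, so the difference belongs to t (1 -
    q(t)) with q = \<open>q n\<close>. Up to r / (n + 1) this is t s / max(s, |t|), which is bounded
    by s.\<close>
  have hw: "nrm A (h \<ominus>\<^bsub>A\<^esub> w n) \<le> s + r * (1 / Suc n)" for n
  proof -
    have "map_poly complex_of_real [:1:] = [:1:]" by (simp add: map_poly_of_real_simps)
    then have hw: "h \<ominus>\<^bsub>A\<^esub> w n = A.pact ((\<otimes>\<^bsub>A\<^esub>) h) (map_poly complex_of_real ([:1:] - q n)) h"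
      unfolding wd w_def using L h by (simp add: A.pact_1)
    show ?thesis
      unfolding hw
    proof (rule A.pact_real_bound[OF h r(1)])
      fix t :: real assume t: "\<bar>t\<bar> \<le> r"
      have "\<bar>t\<bar> * (s / max s \<bar>t\<bar>) \<le> s"
        using s0 t by (cases "\<bar>t\<bar> \<le> s") (simp_all add: max.absorb1 max.absorb2)
      moreover have "\<bar>t * poly ([:1:] - q n) t\<bar> \<le> \<bar>t\<bar> * (s / max s \<bar>t\<bar> + 1 / Suc n)"
      proof -
        have "0 \<le> s / max s \<bar>t\<bar>" using s0 by simp
        then have "\<bar>1 - poly (q n) t\<bar> \<le> s / max s \<bar>t\<bar> + 1 / Suc n"
          using q[OF t, of n] unfolding g_def by linarith
        then show ?thesis by (simp add: abs_mult mult_left_mono)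
      qed
      moreover have "\<bar>t\<bar> * (1 / Suc n) \<le> r * (1 / Suc n)"
        using t by (intro mult_right_mono) auto
      ultimately show "\<bar>t * poly ([:1:] - q n) t\<bar> \<le> s + r * (1 / Suc n)"
        unfolding distrib_left by linarith
    qed
  qed
  then have le: "nrm A h \<le> s + r * (1 / Suc n) + nrm A (w n)" for n
    using A.nrm_le_diff[OF h(1) w[of n]] hw[of n] by linarith
  have "(\<lambda>n. s + r * (1 / Suc n) + nrm A (w n)) \<longlonglongrightarrow> s + 0 + 0"
  proof (intro tendsto_add lim tendsto_const)
    show "(\<lambda>n. nrm A (w n)) \<longlonglongrightarrow> 0" using A.conv_nrm[OF y] \<open>y = _\<close> by simp
  qed
  then have "nrm A h \<le> s + 0 + 0"
    by (rule tendsto_lowerbound) (simp_all only: le eventually_True trivial_limit_sequentially not_False_eq_True)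
  with s(2) show False by simp
qed

lemma inj_isometric:
  assumes inj: "inj_on \<phi> (carrier A)" and x: "x \<in> carrier A"
  shows "nrm B (\<phi> x) = nrm A x"
proof (rule antisym[OF hom_contractive[OF x]])
  have "nrm A (star A x \<otimes>\<^bsub>A\<^esub> x) \<le> nrm B (\<phi> (star A x \<otimes>\<^bsub>A\<^esub> x))"
    using x by (intro inj_isometric_sa inj) (auto simp: A.star_mult A.star_star)
  then have "(nrm A x)\<^sup>2 \<le> (nrm B (\<phi> x))\<^sup>2"
    using x by (simp add: hom_mult hom_star A.cstar_identity B.cstar_identity)
  then show "nrm A x \<le> nrm B (\<phi> x)"
    by (rule power2_le_imp_le) (use x in \<open>simp add: B.nrm_nonneg\<close>)
qed

end

section \<open>Words in a Cuntz--Krieger family\<close>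

lemma diff_le: "A - B \<le> (A :: 'b::generalized_boolean_algebra)"
  using sup_inf_diff[of A B] by (metis sup.cobounded2)

lemma inf_diff_bot: "inf B (A - B) = (bot :: 'b::generalized_boolean_algebra)"
  by (metis diff_le inf.absorb_iff2 inf.assoc inf.commute inf_inf_diff)

inductive_set joins :: "'b::generalized_boolean_algebra set \<Rightarrow> 'b set" for \<A> where
  joins_bot: "bot \<in> joins \<A>"
| joins_sup: "\<lbrakk>A \<in> \<A>; x \<in> joins \<A>\<rbrakk> \<Longrightarrow> sup A x \<in> joins \<A>"

lemma joins_base: "A \<in> \<A> \<Longrightarrow> A \<in> joins \<A>"
  using joins_sup[OF _ joins_bot, of A] by (simp add: sup_absorb1)

lemma joins_closed:
  assumes "x \<in> joins \<A>" "y \<in> joins \<A>"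
  shows "sup x y \<in> joins \<A>"
  using assms by induction (simp_all add: sup_absorb2 sup_assoc joins_sup)

lemma joins_subset:
  assumes "x \<in> joins \<A>" "\<A> \<subseteq> joins \<B>"
  shows "x \<in> joins \<B>"
  using assms by induction (auto intro: joins_bot joins_closed)

text \<open>The witness is the join of the set; the second clause is distributivity, in the form in
  which the refinement below treats the part of a new element inside \<open>u\<close>.\<close>

lemma finite_join:
  fixes \<A> :: "'b::generalized_boolean_algebra set"
  assumes "finite \<A>"
  shows "\<exists>u. (\<forall>A\<in>\<A>. A \<le> u) \<and> (\<forall>e \<B>. (\<forall>A\<in>\<A>. inf A e \<in> joins \<B>) \<longrightarrow> inf u e \<in> joins \<B>)"
  using assms
proof induction
  case empty
  then show ?case by (intro exI[of _ bot]) (auto simp: inf_absorb1 joins_bot)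
next
  case (insert A \<A>)
  then obtain u where u: "\<forall>A\<in>\<A>. A \<le> u"
    "\<And>e \<B>. (\<forall>A\<in>\<A>. inf A e \<in> joins \<B>) \<Longrightarrow> inf u e \<in> joins \<B>" by blast
  then show ?case
    by (intro exI[of _ "sup A u"]) (auto simp: inf_sup_distrib2 joins_closed le_supI2)
qed

text \<open>The family is built like the atoms of the finite Boolean ring generated by E. A further
  element e cuts each member into its parts inside and outside e, and contributes what is left of e
  after removing the join of all members.\<close>

lemma finite_disjoint_refinement:
  fixes E :: "'b::generalized_boolean_algebra set"
  assumes "finite E"
  shows "\<exists>\<A>. finite \<A> \<and> bot \<notin> \<A> \<and> (\<forall>A\<in>\<A>. \<forall>B\<in>\<A>. A \<noteq> B \<longrightarrow> inf A B = bot) \<and> E \<subseteq> joins \<A>"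
  using assms
proof induction
  case empty
  then show ?case by (intro exI[of _ "{}"]) auto
next
  case (insert e E)
  then obtain \<A> where \<A>: "finite \<A>" "bot \<notin> \<A>" "E \<subseteq> joins \<A>"
    and dis: "\<And>A B. \<lbrakk>A \<in> \<A>; B \<in> \<A>; A \<noteq> B\<rbrakk> \<Longrightarrow> inf A B = bot" by blast
  obtain u where u: "\<And>A. A \<in> \<A> \<Longrightarrow> A \<le> u"
    "\<And>e \<B>. (\<forall>A\<in>\<A>. inf A e \<in> joins \<B>) \<Longrightarrow> inf u e \<in> joins \<B>"
    using finite_join[OF \<A>(1)] by blast
  define \<C> where "\<C> = (\<lambda>A. inf A e) ` \<A> \<union> (\<lambda>A. A - e) ` \<A> \<union> {e - u}"
  define \<B> where "\<B> = \<C> - {bot}"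
  have \<C>: "x \<in> joins \<B>" if "x \<in> \<C>" for x
    using that by (cases "x = bot") (auto simp: \<B>_def joins_bot intro: joins_base)
  have "A \<in> joins \<B>" if "A \<in> \<A>" for A
    using joins_closed[OF \<C>[of "inf A e"] \<C>[of "A - e"]] that by (simp add: \<C>_def sup_inf_diff)
  then have E: "E \<subseteq> joins \<B>"
    using joins_subset \<A>(3) by blast
  have e: "e \<in> joins \<B>"
  proof -
    have "inf u e \<in> joins \<B>" by (rule u(2)) (auto intro: \<C> simp: \<C>_def)
    then have "sup (inf u e) (e - u) \<in> joins \<B>"
      by (rule joins_closed) (auto intro: \<C> simp: \<C>_def)
    then show ?thesis by (simp add: inf_commute[of u] sup_inf_diff)
  qed
  have bot: "x = bot" if "x \<le> inf A B" "inf A B = bot" for x A B :: 'b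
    using that by (simp add: bot_unique)
  have dis': "inf x y = bot" if xy: "x \<in> \<C>" "y \<in> \<C>" "x \<noteq> y" for x y
  proof -
    have 1: "inf (inf A e) (inf B e) = bot" "inf (A - e) (B - e) = bot" if "A \<in> \<A>" "B \<in> \<A>" "A \<noteq> B" for A B
      by (rule bot[OF _ dis[OF that]], meson diff_le inf_le1 inf_le2 inf_mono order_trans)+
    have 2: "inf (inf A e) (B - e) = bot" "inf (B - e) (inf A e) = bot" for A B
      using bot[OF inf_mono[OF inf_le2 order_refl] inf_diff_bot, of A e B] by (simp_all add: inf_commute)
    have 3: "inf z (e - u) = bot" "inf (e - u) z = bot" if "z \<le> u" for z
      using bot[OF inf_mono[OF that order_refl] inf_diff_bot, of e] by (simp_all add: inf_commute)
    have 4: "inf A e \<le> u" "A - e \<le> u" if "A \<in> \<A>" for A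
      using u(1)[OF that] diff_le[of A e] by (auto intro: le_infI1)
    have u': "z \<le> u" if "z \<in> \<C>" "z \<noteq> e - u" for z
      using that 4 by (auto simp: \<C>_def)
    show ?thesis
    proof (cases "x = e - u \<or> y = e - u")
      case True
      then show ?thesis using xy 3[OF u'[OF xy(1)]] 3[OF u'[OF xy(2)]] by metis
    next
      case False
      then obtain A B where "A \<in> \<A>" "B \<in> \<A>" "x = inf A e \<or> x = A - e" "y = inf B e \<or> y = B - e"
        using xy by (auto simp: \<C>_def)
      then show ?thesis using xy(3) 1[of A B] 2 by (cases "A = B") auto
    qed
  qed
  show ?case
  proof (intro exI[of _ \<B>] conjI ballI impI)
    show "finite \<B>" using \<A>(1) by (simp add: \<B>_def \<C>_def)
    show "bot \<notin> \<B>" by (simp add: \<B>_def)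
    show "insert e E \<subseteq> joins \<B>" using e E by simp
    show "inf x y = bot" if "x \<in> \<B>" "y \<in> \<B>" "x \<noteq> y" for x y
      using that by (intro dis') (simp_all add: \<B>_def)
  qed
qed

lemma boolean_idealD:
  assumes "boolean_ideal J"
  shows "J \<noteq> {}" "\<lbrakk>A \<in> J; B \<in> J\<rbrakk> \<Longrightarrow> sup A B \<in> J" "A \<in> J \<Longrightarrow> inf A B \<in> J"
  using assms unfolding boolean_ideal_def by blast+

lemma boolean_ideal_down:
  assumes "boolean_ideal J" "B \<in> J" "E \<le> B"
  shows "E \<in> J"
  using boolean_idealD(3)[OF assms(1,2), of E] assms(3) by (simp add: inf_absorb2)

lemma boolean_ideal_upper_bound:
  assumes "boolean_ideal J" "finite G" "G \<subseteq> J"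
  shows "\<exists>D\<in>J. \<forall>B\<in>G. B \<le> D"
  using assms(2,3)
proof induction
  case empty
  then show ?case using boolean_idealD(1)[OF assms(1)] by auto
next
  case (insert B G)
  then have "B \<in> J" "\<exists>D\<in>J. \<forall>B\<in>G. B \<le> D" by simp_all
  then obtain D where D: "D \<in> J" "\<And>B. B \<in> G \<Longrightarrow> B \<le> D" by auto
  have "C \<le> sup B D" if "C \<in> insert B G" for C
    using that D(2) by (auto intro: le_supI2)
  then show ?case
    using boolean_idealD(2)[OF assms(1) \<open>B \<in> J\<close> D(1)] by (intro bexI ballI)
qed

section \<open>Linear spans and finite sums\<close>

context cstar_algebra
begin

inductive_set lspan :: "'a set \<Rightarrow> 'a set" for G where
  lspan_zero: "\<zero> \<in> lspan G"
| lspan_step: "\<lbrakk>x \<in> lspan G; g \<in> G\<rbrakk> \<Longrightarrow> x \<oplus> c \<odot> g \<in> lspan G"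

lemma lspan_closed: "G \<subseteq> carrier A \<Longrightarrow> x \<in> lspan G \<Longrightarrow> x \<in> carrier A"
  by (rotate_tac, induction rule: lspan.induct) auto

lemma lspan_base: "G \<subseteq> carrier A \<Longrightarrow> g \<in> G \<Longrightarrow> g \<in> lspan G"
  using lspan_step[OF lspan_zero, of g G 1] by (auto simp: subset_iff)

lemma lspan_add:
  assumes G: "G \<subseteq> carrier A" and "x \<in> lspan G" "y \<in> lspan G"
  shows "x \<oplus> y \<in> lspan G"
  using assms(3)
proof induction
  case lspan_zero
  then show ?case using lspan_closed[OF G assms(2)] assms(2) by simp
next
  case (lspan_step y g c)
  have "x \<oplus> (y \<oplus> c \<odot> g) = (x \<oplus> y) \<oplus> c \<odot> g"
    using lspan_step G lspan_closed[OF G] assms(2) by (auto simp: M.a_assoc subset_iff)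
  then show ?case using lspan_step by (simp add: lspan.lspan_step)
qed

lemma lspan_smult:
  assumes G: "G \<subseteq> carrier A" and "x \<in> lspan G"
  shows "c \<odot> x \<in> lspan G"
  using assms(2)
proof induction
  case lspan_zero
  then show ?case by (simp add: lspan.lspan_zero)
next
  case (lspan_step y g d)
  have "c \<odot> (y \<oplus> d \<odot> g) = c \<odot> y \<oplus> (c * d) \<odot> g"
    using lspan_step G lspan_closed[OF G] by (auto simp: smult_add subset_iff)
  then show ?case using lspan_step by (simp add: lspan.lspan_step)
qed

text \<open>The scalar \<open>d\<close> is left open so that linear maps and the conjugate linear
  involution fall under one rule.\<close>

lemma lspan_induct_linear:
  assumes G: "G \<subseteq> carrier A" and x: "x \<in> lspan G"
    and f: "f \<in> carrier A \<rightarrow> carrier A" "f \<zero> = \<zero>"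
      "\<And>x y c. \<lbrakk>x \<in> carrier A; y \<in> carrier A\<rbrakk> \<Longrightarrow> \<exists>d. f (x \<oplus> c \<odot> y) = f x \<oplus> d \<odot> f y"
    and H: "H \<subseteq> carrier A" "\<And>g. g \<in> G \<Longrightarrow> f g \<in> lspan H"
  shows "f x \<in> lspan H"
  using x
proof induction
  case lspan_zero
  then show ?case by (simp add: f lspan.lspan_zero)
next
  case (lspan_step x g c)
  obtain d where "f (x \<oplus> c \<odot> g) = f x \<oplus> d \<odot> f g"
    using f(3) lspan_step G lspan_closed[OF G] by blast
  then show ?case using lspan_step H by (simp add: lspan_add lspan_smult)
qed

lemma lspan_mult:
  assumes G: "G1 \<subseteq> carrier A" "G2 \<subseteq> carrier A" "H \<subseteq> carrier A"
    and gh: "\<And>g h. \<lbrakk>g \<in> G1; h \<in> G2\<rbrakk> \<Longrightarrow> g \<otimes> h \<in> lspan H"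
    and x: "x \<in> lspan G1" and y: "y \<in> lspan G2"
  shows "x \<otimes> y \<in> lspan H"
proof (rule lspan_induct_linear[OF G(1) x _ _ _ G(3), of "\<lambda>x. x \<otimes> y"])
  note yc = lspan_closed[OF G(2) y]
  fix g assume g: "g \<in> G1"
  then have gc: "g \<in> carrier A" using G by auto
  show "g \<otimes> y \<in> lspan H"
    by (rule lspan_induct_linear[OF G(2) y _ _ _ G(3), of "\<lambda>y. g \<otimes> y"])
      (use gc gh g in \<open>auto simp: distrib_left smult_mult_right\<close>)
qed (use lspan_closed[OF G(2) y] in \<open>auto simp: distrib_right smult_mult_left\<close>)

lemma lspan_star:
  assumes G: "G \<subseteq> carrier A" "H \<subseteq> carrier A"
    and gh: "\<And>g. g \<in> G \<Longrightarrow> star A g \<in> lspan H"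
    and x: "x \<in> lspan G"
  shows "star A x \<in> lspan H"
  by (rule lspan_induct_linear[OF G(1) x _ _ _ G(2), of "star A"])
    (auto simp: star_add star_smult gh)

lemma lspan_mono: "x \<in> lspan G \<Longrightarrow> G \<subseteq> H \<Longrightarrow> x \<in> lspan H"
  by (induction rule: lspan.induct) (auto intro: lspan.intros)

lemma lspan_finite:
  assumes "x \<in> lspan G"
  shows "\<exists>E\<subseteq>G. finite E \<and> x \<in> lspan E"
  using assms
proof induction
  case lspan_zero
  then show ?case by (intro exI[of _ "{}"]) (auto intro: lspan.lspan_zero)
next
  case (lspan_step x g c)
  then obtain E where "E \<subseteq> G" "finite E" "x \<in> lspan E" by blast
  then show ?case using lspan_step(2)
    by (intro exI[of _ "insert g E"]) (auto intro!: lspan.lspan_step intro: lspan_mono)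
qed

lemma finsum_lspan:
  assumes G: "G \<subseteq> carrier A" and "finite K" "\<And>k. k \<in> K \<Longrightarrow> f k \<in> lspan G"
  shows "finsum A f K \<in> lspan G"
  using assms(2,3)
proof (induction rule: finite_induct)
  case empty
  then show ?case by (simp add: lspan_zero)
next
  case (insert k K)
  then show ?case using lspan_closed[OF G] by (subst M.finsum_insert) (auto intro: lspan_add[OF G])
qed

lemma finsum_linear:
  assumes "f \<in> carrier A \<rightarrow> carrier A" "f \<zero> = \<zero>"
    "\<And>x y. \<lbrakk>x \<in> carrier A; y \<in> carrier A\<rbrakk> \<Longrightarrow> f (x \<oplus> y) = f x \<oplus> f y"
    "g \<in> K \<rightarrow> carrier A"
  shows "f (finsum A g K) = finsum A (\<lambda>k. f (g k)) K"
  using finsum_hom[of A A "carrier A" f g K] assms by (simp add: M.abelian_group_axioms)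

lemma mult_finsum:
  assumes "y \<in> carrier A" "g \<in> K \<rightarrow> carrier A"
  shows "y \<otimes> finsum A g K = finsum A (\<lambda>k. y \<otimes> g k) K" "finsum A g K \<otimes> y = finsum A (\<lambda>k. g k \<otimes> y) K"
  by (rule finsum_linear, use assms in \<open>auto simp: distrib_left distrib_right\<close>)+

lemma nrm_finsum:
  assumes "finite K" "g \<in> K \<rightarrow> carrier A"
  shows "nrm A (finsum A g K) \<le> (\<Sum>k\<in>K. nrm A (g k))"
  using assms
proof (induction rule: finite_induct)
  case (insert k K)
  then have "nrm A (finsum A g (insert k K)) \<le> nrm A (g k) + nrm A (finsum A g K)"
    by (simp add: M.finsum_insert nrm_triangle Pi_iff)
  then show ?case using insert by (simp add: Pi_iff)
qed simp

lemma finsum_single: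
  assumes "finite K" "i \<in> K" "g i \<in> carrier A" "\<And>k. \<lbrakk>k \<in> K; k \<noteq> i\<rbrakk> \<Longrightarrow> g k = \<zero>"
  shows "finsum A g K = g i"
proof -
  have "finsum A g K = finsum A (\<lambda>k. if i = k then g k else \<zero>) K"
    by (rule M.finsum_cong') (use assms in \<open>auto\<close>)
  also have "\<dots> = finsum A (\<lambda>k. if i = k then (\<lambda>_. g i) k else \<zero>) K"
    by (rule M.finsum_cong') (use assms in \<open>auto\<close>)
  also have "\<dots> = g i" by (rule M.finsum_singleton) (use assms in auto)
  finally show ?thesis .
qed

lemma projection_nrm:
  assumes "projection A x"
  shows "nrm A x = 0 \<or> nrm A x = 1" "nrm A x \<le> 1"
proof -
  have "nrm A x = (nrm A x)\<^sup>2"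
    using assms cstar_identity[of x] by (auto simp: projection_def)
  then show "nrm A x = 0 \<or> nrm A x = 1" by (simp add: power2_eq_square)
  then show "nrm A x \<le> 1" by auto
qed

end

section \<open>Words, degrees and the dense graded subalgebra\<close>

context cuntz_krieger_representation
begin

lemmas CK_closed [simp] = P_closed S_closed

lemma P_simps [simp]: "star A (P E) = P E" "P E \<otimes> P F = P (inf E F)"
  using projection_P[of E] by (auto simp: projection_def P_inf)

lemma nrm_P: "nrm A (P E) \<le> 1" "P E \<noteq> \<zero> \<Longrightarrow> nrm A (P E) = 1"
  using projection_nrm[OF projection_P[of E]] nrm_eq_0_iff[of "P E"] by auto

lemma I_down: "\<lbrakk>\<alpha> \<in> L; B \<in> I \<alpha>; E \<le> B\<rbrakk> \<Longrightarrow> E \<in> I \<alpha>"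
  using boolean_ideal_down[OF ideal_I] .

lemma S_S_same: "\<lbrakk>\<alpha> \<in> L; B \<in> I \<alpha>; B' \<in> I \<alpha>\<rbrakk> \<Longrightarrow> star A (S \<alpha> B) \<otimes> S \<alpha> B' = P (inf B B')"
  using S_S[of \<alpha> B \<alpha> B'] by simp

lemma nrm_S: "\<lbrakk>\<alpha> \<in> L; B \<in> I \<alpha>\<rbrakk> \<Longrightarrow> nrm A (S \<alpha> B) \<le> 1"
  by (rule power2_le_imp_le) (simp_all add: S_S_same cstar_identity[symmetric] nrm_P)

text \<open>For the two sides u and v, the four products u*u, u*v, v*u and v*v are the same
  projection, so \<open>star A (u \<ominus> v) \<otimes> (u \<ominus> v)\<close> vanishes and the
  C*-identity gives u = v.\<close>

lemma S_P:
  assumes "\<alpha> \<in> L" "B \<in> I \<alpha>"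
  shows "S \<alpha> B \<otimes> P E = S \<alpha> (inf B E)"
proof -
  define u where "u = S \<alpha> B \<otimes> P E"
  define v where "v = S \<alpha> (inf B E)"
  have B: "inf B E \<in> I \<alpha>" using I_down[OF assms] by simp
  have c: "u \<in> carrier A" "v \<in> carrier A" using assms B by (simp_all add: u_def v_def)
  have su: "star A u = P E \<otimes> star A (S \<alpha> B)" using assms by (simp add: u_def star_mult)
  have SuS: "star A u \<otimes> S \<alpha> B' = P (inf E (inf B B'))" if "B' \<in> I \<alpha>" for B'
    using that assms unfolding su by (simp add: mult_assoc S_S_same)
  have uu: "star A u \<otimes> u = P (inf B E)"
    using c assms SuS[of B] by (simp add: u_def mult_assoc[symmetric] inf_aci)
  have uv: "star A u \<otimes> v = P (inf B E)"
    using SuS[OF B] by (simp add: v_def inf_aci)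
  have vu: "star A v \<otimes> u = P (inf B E)"
    using assms B by (simp add: v_def u_def mult_assoc[symmetric] S_S_same inf_aci)
  have vv: "star A v \<otimes> v = P (inf B E)"
    using assms B by (simp add: v_def S_S_same)
  have "star A (u \<ominus> v) \<otimes> (u \<ominus> v) = (star A u \<otimes> u \<ominus> star A v \<otimes> u) \<ominus> (star A u \<otimes> v \<ominus> star A v \<otimes> v)"
    using c by (simp add: star_diff mult_diff_left mult_diff_right)
  also have "\<dots> = \<zero>" by (simp add: uu uv vu vv)
  finally have "nrm A (u \<ominus> v) = 0" using c cstar_identity[of "u \<ominus> v"] by simp
  then show ?thesis using c by (simp add: nrm_eq_0_iff diff_eq_zero_iff u_def v_def)
qed

lemma S_le: "\<lbrakk>\<alpha> \<in> L; D \<in> I \<alpha>; B \<le> D\<rbrakk> \<Longrightarrow> S \<alpha> B = S \<alpha> D \<otimes> P B"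
  by (simp add: S_P inf_absorb2)

lemma S_star_P:
  assumes "\<alpha> \<in> L" "B \<in> I \<alpha>"
  shows "star A (S \<alpha> B) \<otimes> P E = P (\<theta> \<alpha> E) \<otimes> star A (S \<alpha> B)"
  using arg_cong[OF P_S[OF assms, of E], of "star A"] assms by (simp add: star_mult)

text \<open>The index counts letters. The projection at the end of each word takes up the
  projections that cancellation produces and \<open>P_S\<close> pushes to the right.\<close>

primrec words :: "nat \<Rightarrow> 'a set" where
  "words 0 = range P"
| "words (Suc j) = {S \<alpha> B \<otimes> m |\<alpha> B m. \<alpha> \<in> L \<and> B \<in> I \<alpha> \<and> m \<in> words j}"

lemma words_Suc: "\<lbrakk>\<alpha> \<in> L; B \<in> I \<alpha>; m \<in> words j\<rbrakk> \<Longrightarrow> S \<alpha> B \<otimes> m \<in> words (Suc j)"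
  unfolding words.simps by blast

lemma words_closed: "m \<in> words j \<Longrightarrow> m \<in> carrier A"
  by (induction j arbitrary: m) auto

lemma P_words: "m \<in> words j \<Longrightarrow> P E \<otimes> m \<in> words j"
proof (induction j arbitrary: m E)
  case (Suc j)
  then obtain \<alpha> B m' where m: "m = S \<alpha> B \<otimes> m'" "\<alpha> \<in> L" "B \<in> I \<alpha>" "m' \<in> words j" by auto
  then have "P E \<otimes> m = S \<alpha> B \<otimes> (P (\<theta> \<alpha> E) \<otimes> m')"
    using words_closed[OF m(4)] by (simp add: mult_assoc[symmetric] P_S)
  then show ?case using words_Suc[OF m(2,3) Suc.IH[OF m(4)]] by simp
qed auto

lemma words_mult: "\<lbrakk>m \<in> words i; n \<in> words j\<rbrakk> \<Longrightarrow> m \<otimes> n \<in> words (i + j)"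
proof (induction i arbitrary: m)
  case (Suc i)
  then obtain \<alpha> B m' where m: "m = S \<alpha> B \<otimes> m'" "\<alpha> \<in> L" "B \<in> I \<alpha>" "m' \<in> words i" by auto
  then have "m \<otimes> n = S \<alpha> B \<otimes> (m' \<otimes> n)"
    using words_closed[OF m(4)] words_closed[OF Suc.prems(2)] by (simp add: mult_assoc)
  then show ?case using words_Suc[OF m(2,3) Suc.IH[OF m(4) Suc.prems(2)]] by simp
qed (auto simp: P_words)

text \<open>Letters cancel one by one from the inside: different labels give 0, equal ones leave a
  projection, which is absorbed by the rest of n.\<close>

lemma star_words_mult:
  "\<lbrakk>m \<in> words i; n \<in> words (i + j)\<rbrakk> \<Longrightarrow> star A m \<otimes> n \<in> insert \<zero> (words j)"
proof (induction i arbitrary: m n)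
  case (Suc i)
  then obtain \<alpha> B m' where m: "m = S \<alpha> B \<otimes> m'" "\<alpha> \<in> L" "B \<in> I \<alpha>" "m' \<in> words i" by auto
  from Suc.prems obtain \<beta> E n' where n: "n = S \<beta> E \<otimes> n'" "\<beta> \<in> L" "E \<in> I \<beta>" "n' \<in> words (i + j)" by auto
  have c: "m' \<in> carrier A" "n' \<in> carrier A" using m n words_closed by auto
  have "star A m \<otimes> n = star A m' \<otimes> ((star A (S \<alpha> B) \<otimes> S \<beta> E) \<otimes> n')"
    using m n c by (simp add: star_mult mult_assoc)
  also have "\<dots> = (if \<alpha> = \<beta> then star A m' \<otimes> (P (inf B E) \<otimes> n') else \<zero>)"
    using m n c by (simp add: S_S)
  finally show ?case using Suc.IH[OF m(4) P_words[OF n(4)]] by auto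
qed (auto simp: P_words)

text \<open>Monomials of degree n. A gauge map multiplies their images by the n-th power of z, as
  \<open>gauge_homogeneous\<close> shows; degree 0 spans the core.\<close>

definition homogeneous :: "int \<Rightarrow> 'a set" where
  "homogeneous n = {m \<otimes> star A m' |i j m m'. m \<in> words i \<and> m' \<in> words j \<and> int i - int j = n}"

lemma homogeneous_closed: "homogeneous n \<subseteq> carrier A"
  by (auto simp: homogeneous_def words_closed)

lemma homogeneousI: "\<lbrakk>m \<in> words i; m' \<in> words j; int i - int j = n\<rbrakk> \<Longrightarrow> m \<otimes> star A m' \<in> homogeneous n"
  by (auto simp: homogeneous_def)

lemma star_homogeneous: "x \<in> homogeneous n \<Longrightarrow> star A x \<in> homogeneous (- n)"
  unfolding homogeneous_def
proof (elim CollectE exE conjE, intro CollectI exI conjI)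
  fix i j m m' assume m: "x = m \<otimes> star A m'" "m \<in> words i" "m' \<in> words j" "int i - int j = n"
  show "star A x = m' \<otimes> star A m" "m' \<in> words j" "m \<in> words i" "int j - int i = - n"
    using m words_closed by (simp_all add: star_mult star_star)
qed

text \<open>The two inner words cancel against each other; d counts the letters left over from the
  longer one, which join the outer word on that side.\<close>

lemma homogeneous_mult:
  assumes "x \<in> homogeneous n" "y \<in> homogeneous k"
  shows "x \<otimes> y \<in> lspan (homogeneous (n + k))"
proof -
  obtain i1 j1 m1 m1' where x: "x = m1 \<otimes> star A m1'" "m1 \<in> words i1" "m1' \<in> words j1" "int i1 - int j1 = n"
    using assms(1) by (auto simp: homogeneous_def)
  obtain i2 j2 m2 m2' where y: "y = m2 \<otimes> star A m2'" "m2 \<in> words i2" "m2' \<in> words j2" "int i2 - int j2 = k"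
    using assms(2) by (auto simp: homogeneous_def)
  note c = words_closed[OF x(2)] words_closed[OF x(3)] words_closed[OF y(2)] words_closed[OF y(3)]
  have "x \<otimes> y \<in> insert \<zero> (homogeneous (n + k))"
  proof (cases "j1 \<le> i2")
    case True
    then obtain d where d: "i2 = j1 + d" by (metis le_iff_add)
    define m3 where "m3 = star A m1' \<otimes> m2"
    have m3: "m3 \<in> insert \<zero> (words d)" "m3 \<in> carrier A"
      unfolding m3_def using star_words_mult[OF x(3)] y(2) c by (auto simp: d)
    have "x \<otimes> y = (m1 \<otimes> m3) \<otimes> star A m2'"
      using c x y by (simp add: m3_def mult_assoc)
    moreover have "m1 \<otimes> m3 \<in> insert \<zero> (words (i1 + d))"
      using m3(1) c words_mult[OF x(2)] by auto
    ultimately show ?thesis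
      using homogeneousI[OF _ y(3), of "m1 \<otimes> m3" "i1 + d" "n + k"] c x(4) y(4) d by auto
  next
    case False
    then obtain d where d: "j1 = i2 + d" by (metis le_iff_add nat_le_linear)
    define m3 where "m3 = star A m2 \<otimes> m1'"
    have m3: "m3 \<in> insert \<zero> (words d)" "m3 \<in> carrier A"
      unfolding m3_def using star_words_mult[OF y(2)] x(3) c by (auto simp: d)
    have "x \<otimes> y = m1 \<otimes> star A (m2' \<otimes> m3)"
      using c x y by (simp add: m3_def mult_assoc star_mult star_star)
    moreover have "m2' \<otimes> m3 \<in> insert \<zero> (words (j2 + d))"
      using m3(1) c words_mult[OF y(3)] by auto
    ultimately show ?thesis
      using homogeneousI[OF x(2), of "m2' \<otimes> m3" "j2 + d" "n + k"] c x(4) y(4) d by auto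
  qed
  then show ?thesis using lspan_base[OF homogeneous_closed] lspan_zero by auto
qed

text \<open>A filtration by the absolute value of the degree. Products add the bounds, so the bound
  for iterated squares doubles at each step.\<close>

definition alg :: "nat \<Rightarrow> 'a set" where
  "alg d = lspan (\<Union>n\<in>{- int d..int d}. homogeneous n)"

lemma alg_base_closed: "(\<Union>n\<in>{- int d..int d}. homogeneous n) \<subseteq> carrier A"
  using homogeneous_closed by auto

lemma alg_closed: "x \<in> alg d \<Longrightarrow> x \<in> carrier A"
  unfolding alg_def by (rule lspan_closed[OF alg_base_closed])

lemma alg_zero: "\<zero> \<in> alg d"
  unfolding alg_def by (rule lspan_zero)

lemma homogeneous_alg: "x \<in> lspan (homogeneous n) \<Longrightarrow> \<bar>n\<bar> \<le> int d \<Longrightarrow> x \<in> alg d"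
  unfolding alg_def by (erule lspan_mono) force

lemma alg_mono: "x \<in> alg d \<Longrightarrow> d \<le> e \<Longrightarrow> x \<in> alg e"
  unfolding alg_def by (erule lspan_mono) force

lemma alg_add: "\<lbrakk>x \<in> alg d; y \<in> alg d\<rbrakk> \<Longrightarrow> x \<oplus> y \<in> alg d"
  unfolding alg_def by (rule lspan_add[OF alg_base_closed])

lemma alg_smult: "x \<in> alg d \<Longrightarrow> c \<odot> x \<in> alg d"
  unfolding alg_def by (rule lspan_smult[OF alg_base_closed])

lemma alg_mult: "\<lbrakk>x \<in> alg d; y \<in> alg e\<rbrakk> \<Longrightarrow> x \<otimes> y \<in> alg (d + e)"
  unfolding alg_def
proof (rule lspan_mult[OF alg_base_closed alg_base_closed alg_base_closed])
  fix g h assume "g \<in> (\<Union>n\<in>{- int d..int d}. homogeneous n)" "h \<in> (\<Union>n\<in>{- int e..int e}. homogeneous n)"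
  then obtain n k where "g \<in> homogeneous n" "h \<in> homogeneous k" "\<bar>n\<bar> \<le> int d" "\<bar>k\<bar> \<le> int e" by force
  then show "g \<otimes> h \<in> lspan (\<Union>n\<in>{- int (d + e)..int (d + e)}. homogeneous n)"
    using homogeneous_alg[OF homogeneous_mult, of g n h k "d + e"] by (simp add: alg_def)
qed

lemma alg_star: "x \<in> alg d \<Longrightarrow> star A x \<in> alg d"
  unfolding alg_def
proof (rule lspan_star[OF alg_base_closed alg_base_closed])
  fix g assume "g \<in> (\<Union>n\<in>{- int d..int d}. homogeneous n)"
  then obtain n where "g \<in> homogeneous n" "\<bar>n\<bar> \<le> int d" by force
  then show "star A g \<in> lspan (\<Union>n\<in>{- int d..int d}. homogeneous n)"
    using star_homogeneous[of g n] by (intro lspan_base[OF alg_base_closed]) (auto intro!: bexI[of _ "- n"])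
qed

text \<open>Values of terms approximate every element of the generated algebra, by
  \<open>generated_subset_limits\<close>, so the filtered pieces together are dense in it.\<close>

lemma val_alg: "\<exists>d. val t \<in> alg d"
proof (induction t)
  case (Proj E)
  have "P E \<otimes> star A (P E) \<in> homogeneous 0" by (rule homogeneousI[of _ 0 _ 0]) auto
  then have "P E \<in> alg 0"
    using homogeneous_alg[OF lspan_base[OF homogeneous_closed], of "P E" 0 0] by simp
  then show ?case by auto
next
  case (Iso \<alpha> B)
  show ?case
  proof (cases "\<alpha> \<in> L \<and> B \<in> I \<alpha>")
    case True
    have "S \<alpha> B \<otimes> P B \<in> words (Suc 0)" "P B \<in> words 0"
      using True by (auto intro: words_Suc simp del: words.simps(2))
    from homogeneousI[OF this] have "S \<alpha> B \<otimes> P B \<otimes> star A (P B) \<in> homogeneous 1" by simp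
    moreover have "S \<alpha> B \<otimes> P B \<otimes> star A (P B) = S \<alpha> B"
      using True by (simp add: mult_assoc S_P)
    ultimately have "S \<alpha> B \<in> alg 1"
      using homogeneous_alg[OF lspan_base[OF homogeneous_closed], of "S \<alpha> B" 1 1] by simp
    then show ?thesis using True by auto
  next
    case False
    then have "val (Iso \<alpha> B) = \<zero>" by auto
    then show ?thesis using alg_zero by metis
  qed
next
  case Null
  then show ?case using alg_zero by auto
next
  case (Plus t u)
  then obtain d e where "val t \<in> alg d" "val u \<in> alg e" by blast
  then have "val t \<in> alg (max d e)" "val u \<in> alg (max d e)" by (auto elim: alg_mono)
  then show ?case using alg_add by auto
next
  case (Scale c t)
  then show ?case using alg_smult by auto
next
  case (Times t u)
  then show ?case using alg_mult by (metis val.simps(6))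
next
  case (Adj t)
  then show ?case using alg_star by auto
qed

lemma alg_decomposition:
  assumes "x \<in> alg d"
  shows "\<exists>a. (\<forall>n. a n \<in> lspan (homogeneous n)) \<and> x = finsum A a {- int d..int d}"
  using assms unfolding alg_def
proof induction
  case lspan_zero
  then show ?case by (intro exI[of _ "\<lambda>_. \<zero>"]) (auto intro: lspan.lspan_zero)
next
  case (lspan_step x g c)
  then obtain a k where a: "\<And>n. a n \<in> lspan (homogeneous n)" "x = finsum A a {- int d..int d}"
    and g: "g \<in> homogeneous k" "k \<in> {- int d..int d}" by blast
  define b where "b n = (if n = k then c \<odot> g else \<zero>)" for n
  have b: "b n \<in> lspan (homogeneous n)" for n
    using g lspan_smult[OF homogeneous_closed lspan_base[OF homogeneous_closed]]
    by (auto simp: b_def intro: lspan.lspan_zero)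
  have ac: "a n \<in> carrier A" "b n \<in> carrier A" for n
    using a b lspan_closed[OF homogeneous_closed] by auto
  have "finsum A b {- int d..int d} = c \<odot> g"
    using g ac(2)[of k] by (subst finsum_single[of _ k]) (auto simp: b_def)
  then have "x \<oplus> c \<odot> g = finsum A (\<lambda>n. a n \<oplus> b n) {- int d..int d}"
    using ac by (subst M.finsum_addf) (auto simp: a(2))
  moreover have "a n \<oplus> b n \<in> lspan (homogeneous n)" for n
    by (rule lspan_add[OF homogeneous_closed a(1) b])
  ultimately show ?case by (intro exI[of _ "\<lambda>n. a n \<oplus> b n"] conjI allI)
qed

end

section \<open>The core of the gauge action\<close>

context cstar_hom
begin

lemma hom_finsum:
  assumes "g \<in> K \<rightarrow> carrier A"
  shows "\<phi> (finsum A g K) = finsum B (\<lambda>k. \<phi> (g k)) K"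
  using finsum_hom[of A B "carrier A" \<phi> g K] assms
  by (simp add: A.M.abelian_group_axioms B.M.abelian_group_axioms hom_add)

end

locale ck_morphism =
  C: cuntz_krieger_representation L \<theta> I C p s + X: cuntz_krieger_representation L \<theta> I X P S +
  cstar_hom C X \<pi>
  for L :: "'l set" and \<theta> :: "'l \<Rightarrow> 'b::generalized_boolean_algebra \<Rightarrow> 'b" and I :: "'l \<Rightarrow> 'b set"
    and C :: "('c, 'm) cstar_scheme" and p :: "'b \<Rightarrow> 'c" and s :: "'l \<Rightarrow> 'b \<Rightarrow> 'c"
    and X :: "('x, 'n) cstar_scheme" and P :: "'b \<Rightarrow> 'x" and S :: "'l \<Rightarrow> 'b \<Rightarrow> 'x"
    and \<pi> :: "'c \<Rightarrow> 'x" +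
  assumes hom_p: "\<pi> (p E) = P E"
    and hom_s: "\<lbrakk>\<alpha> \<in> L; B \<in> I \<alpha>\<rbrakk> \<Longrightarrow> \<pi> (s \<alpha> B) = S \<alpha> B"
begin

text \<open>The constant may be anything; closure under products is what lets iterated squares
  remove it in \<open>core_le\<close>.\<close>

definition bounded_below :: "'c set \<Rightarrow> bool" where
  "bounded_below V \<longleftrightarrow> V \<subseteq> carrier C \<and> \<zero>\<^bsub>C\<^esub> \<in> V \<and> (\<forall>x\<in>V. \<forall>y\<in>V. x \<oplus>\<^bsub>C\<^esub> y \<in> V) \<and>
    (\<forall>c. \<forall>x\<in>V. c \<odot>\<^bsub>C\<^esub> x \<in> V) \<and> (\<forall>x\<in>V. \<forall>y\<in>V. x \<otimes>\<^bsub>C\<^esub> y \<in> V) \<and>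
    (\<exists>K\<ge>0. \<forall>x\<in>V. nrm C x \<le> K * nrm X (\<pi> x))"

lemma bounded_belowD:
  assumes "bounded_below V"
  shows "x \<in> V \<Longrightarrow> x \<in> carrier C" "\<zero>\<^bsub>C\<^esub> \<in> V" "\<lbrakk>x \<in> V; y \<in> V\<rbrakk> \<Longrightarrow> x \<oplus>\<^bsub>C\<^esub> y \<in> V"
    "x \<in> V \<Longrightarrow> c \<odot>\<^bsub>C\<^esub> x \<in> V" "\<lbrakk>x \<in> V; y \<in> V\<rbrakk> \<Longrightarrow> x \<otimes>\<^bsub>C\<^esub> y \<in> V"
    "\<exists>K\<ge>0. \<forall>x\<in>V. nrm C x \<le> K * nrm X (\<pi> x)"
  using assms unfolding bounded_below_def by blast+

lemma bounded_below_lspan: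
  assumes V: "bounded_below V" and "E \<subseteq> V" "x \<in> C.lspan E"
  shows "x \<in> V"
  using assms(3) by induction (use assms(2) in \<open>auto intro: bounded_belowD[OF V]\<close>)

lemma bounded_below_joins:
  assumes V: "bounded_below V" and "p ` \<A> \<subseteq> V" "e \<in> joins \<A>"
  shows "p e \<in> V"
  using assms(3)
proof induction
  case joins_bot
  then show ?case by (simp add: C.P_bot bounded_belowD(2)[OF V])
next
  case (joins_sup A e)
  have A: "p A \<in> V" using joins_sup assms(2) by auto
  have "p (inf A e) = p A \<otimes>\<^bsub>C\<^esub> p e" by simp
  then have "p (inf A e) \<in> V" using bounded_belowD(5)[OF V A joins_sup(3)] by simp
  then have "p A \<oplus>\<^bsub>C\<^esub> p e \<oplus>\<^bsub>C\<^esub> (-1) \<odot>\<^bsub>C\<^esub> p (inf A e) \<in> V"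
    using A joins_sup(3) by (intro bounded_belowD(3,4)[OF V])
  then show ?case by (simp add: C.P_sup C.diff_eq)
qed

text \<open>The element \<open>t\<close> reads off the coefficient of \<open>P A\<close>. If \<open>A\<close> is not regular, it exists because
  some nonzero \<open>B \<le> A\<close> emits either no label, and then \<open>t = P B\<close>, or infinitely many, and then \<open>t\<close>
  is the partial isometry of a label outside \<open>F\<close>. Regular \<open>A\<close> need no coefficient: their projections
  are sums of elements \<open>s \<alpha> (D \<alpha>) w (s \<alpha> (D \<alpha>))*\<close>.\<close>

lemma bounded_below_extend:
  fixes \<A> :: "'b set" and F :: "'l set" and D :: "'l \<Rightarrow> 'b"
  assumes fin: "finite \<A>" "finite F"
    and dis: "\<And>A B. \<lbrakk>A \<in> \<A>; B \<in> \<A>; A \<noteq> B\<rbrakk> \<Longrightarrow> inf A B = bot"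
    and F: "F \<subseteq> L" and D: "\<And>\<alpha>. \<alpha> \<in> F \<Longrightarrow> D \<alpha> \<in> I \<alpha>"
    and W: "bounded_below W"
    and pW: "\<And>\<alpha> A. \<lbrakk>\<alpha> \<in> F; A \<in> \<A>\<rbrakk> \<Longrightarrow> p (\<theta> \<alpha> A) \<in> W" "\<And>\<alpha>. \<alpha> \<in> F \<Longrightarrow> p (D \<alpha>) \<in> W"
    and detect: "\<And>A. A \<in> \<A> \<Longrightarrow> \<exists>t E. t \<in> carrier X \<and> nrm X t \<le> 1 \<and> P E \<noteq> \<zero>\<^bsub>X\<^esub> \<and>
      (\<forall>B\<in>\<A>. star X t \<otimes>\<^bsub>X\<^esub> (P B \<otimes>\<^bsub>X\<^esub> t) = (if B = A then P E else \<zero>\<^bsub>X\<^esub>)) \<and>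
      (\<forall>\<alpha>\<in>F. star X t \<otimes>\<^bsub>X\<^esub> S \<alpha> (D \<alpha>) = \<zero>\<^bsub>X\<^esub>)"
  shows "\<exists>V. bounded_below V \<and> p ` \<A> \<subseteq> V \<and>
    (\<forall>\<alpha>\<in>F. \<forall>\<beta>\<in>F. \<forall>w\<in>W. s \<alpha> (D \<alpha>) \<otimes>\<^bsub>C\<^esub> (w \<otimes>\<^bsub>C\<^esub> star C (s \<beta> (D \<beta>))) \<in> V)"
proof -
  define S' where "S' \<alpha> = S \<alpha> (D \<alpha>)" for \<alpha>
  define s' where "s' \<alpha> = s \<alpha> (D \<alpha>)" for \<alpha>
  have s': "s' \<alpha> \<in> carrier C" "S' \<alpha> \<in> carrier X" "\<pi> (s' \<alpha>) = S' \<alpha>"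
    "nrm C (s' \<alpha>) \<le> 1" "nrm X (S' \<alpha>) \<le> 1" if "\<alpha> \<in> F" for \<alpha>
    using that F D[OF that] by (auto simp: s'_def S'_def hom_s C.nrm_S X.nrm_S)
  have ss: "star C (s' \<alpha>) \<otimes>\<^bsub>C\<^esub> s' \<beta> = (if \<alpha> = \<beta> then p (D \<alpha>) else \<zero>\<^bsub>C\<^esub>)" if "\<alpha> \<in> F" "\<beta> \<in> F" for \<alpha> \<beta>
    using that F D[OF that(1)] D[OF that(2)] by (auto simp: s'_def C.S_S subset_iff)
  have sp: "s' \<alpha> \<otimes>\<^bsub>C\<^esub> p (D \<alpha>) = s' \<alpha>" "p A \<otimes>\<^bsub>C\<^esub> s' \<alpha> = s' \<alpha> \<otimes>\<^bsub>C\<^esub> p (\<theta> \<alpha> A)"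
    "p (D \<alpha>) \<otimes>\<^bsub>C\<^esub> star C (s' \<alpha>) = star C (s' \<alpha>)"
    "star C (s' \<alpha>) \<otimes>\<^bsub>C\<^esub> p A = p (\<theta> \<alpha> A) \<otimes>\<^bsub>C\<^esub> star C (s' \<alpha>)" if "\<alpha> \<in> F" for \<alpha> A
  proof -
    have \<alpha>: "\<alpha> \<in> L" "D \<alpha> \<in> I \<alpha>" using that F D by auto
    show 1: "s' \<alpha> \<otimes>\<^bsub>C\<^esub> p (D \<alpha>) = s' \<alpha>" using \<alpha> by (simp add: s'_def C.S_P)
    show "p A \<otimes>\<^bsub>C\<^esub> s' \<alpha> = s' \<alpha> \<otimes>\<^bsub>C\<^esub> p (\<theta> \<alpha> A)" using \<alpha> by (simp add: s'_def C.P_S)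
    show "p (D \<alpha>) \<otimes>\<^bsub>C\<^esub> star C (s' \<alpha>) = star C (s' \<alpha>)"
      using arg_cong[OF 1, of "star C"] s'[OF that] by (simp add: C.star_mult)
    show "star C (s' \<alpha>) \<otimes>\<^bsub>C\<^esub> p A = p (\<theta> \<alpha> A) \<otimes>\<^bsub>C\<^esub> star C (s' \<alpha>)"
      using \<alpha> by (simp add: s'_def C.S_star_P)
  qed
  note WD = bounded_belowD[OF W]
  \<comment> \<open>The \<open>e \<alpha> \<beta> w\<close> multiply like matrix units with entries
    from W, see \<open>ee\<close>; the product of the entries is taken with
    \<open>p (D \<beta>)\<close> in between.\<close>
  define e where "e \<alpha> \<beta> w = s' \<alpha> \<otimes>\<^bsub>C\<^esub> (w \<otimes>\<^bsub>C\<^esub> star C (s' \<beta>))" for \<alpha> \<beta> w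
  have e_closed: "e \<alpha> \<beta> w \<in> carrier C" if "\<alpha> \<in> F" "\<beta> \<in> F" "w \<in> carrier C" for \<alpha> \<beta> w
    using that s' by (simp add: e_def)
  define G where "G = p ` \<A> \<union> {e \<alpha> \<beta> w |\<alpha> \<beta> w. \<alpha> \<in> F \<and> \<beta> \<in> F \<and> w \<in> W}"
  have GC: "G \<subseteq> carrier C" using e_closed WD(1) by (auto simp: G_def)
  define V where "V = C.lspan G"
  note span = C.lspan_closed[OF GC] C.lspan_base[OF GC]
  have eG: "e \<alpha> \<beta> w \<in> V" if "\<alpha> \<in> F" "\<beta> \<in> F" "w \<in> W" for \<alpha> \<beta> w
    unfolding V_def by (rule span(2)) (use that in \<open>auto simp: G_def\<close>)
  have pG: "p A \<in> V" if "A \<in> \<A>" for A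
    unfolding V_def by (rule span(2)) (use that in \<open>auto simp: G_def\<close>)
  have z: "\<zero>\<^bsub>C\<^esub> \<in> V" by (simp add: V_def C.lspan_zero)
  have pe: "p A \<otimes>\<^bsub>C\<^esub> e \<alpha> \<beta> w = e \<alpha> \<beta> (p (\<theta> \<alpha> A) \<otimes>\<^bsub>C\<^esub> w)"
    "e \<alpha> \<beta> w \<otimes>\<^bsub>C\<^esub> p A = e \<alpha> \<beta> (w \<otimes>\<^bsub>C\<^esub> p (\<theta> \<beta> A))"
    if "\<alpha> \<in> F" "\<beta> \<in> F" "w \<in> carrier C" for A \<alpha> \<beta> w
    using that s' sp by (simp_all add: e_def C.mult_assoc) (simp add: C.mult_assoc[symmetric] sp)
  have ee: "e \<alpha> \<beta> w \<otimes>\<^bsub>C\<^esub> e \<gamma> \<delta> v = (if \<beta> = \<gamma> then e \<alpha> \<delta> (w \<otimes>\<^bsub>C\<^esub> (p (D \<beta>) \<otimes>\<^bsub>C\<^esub> v)) else \<zero>\<^bsub>C\<^esub>)"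
    if "\<alpha> \<in> F" "\<beta> \<in> F" "\<gamma> \<in> F" "\<delta> \<in> F" "w \<in> carrier C" "v \<in> carrier C" for \<alpha> \<beta> \<gamma> \<delta> w v
  proof -
    have "e \<alpha> \<beta> w \<otimes>\<^bsub>C\<^esub> e \<gamma> \<delta> v = s' \<alpha> \<otimes>\<^bsub>C\<^esub> (w \<otimes>\<^bsub>C\<^esub> ((star C (s' \<beta>) \<otimes>\<^bsub>C\<^esub> s' \<gamma>) \<otimes>\<^bsub>C\<^esub> (v \<otimes>\<^bsub>C\<^esub> star C (s' \<delta>))))"
      using that s' by (simp add: e_def C.mult_assoc)
    then show ?thesis using that s' by (simp add: ss e_def C.mult_assoc)
  qed
  have GG: "g \<otimes>\<^bsub>C\<^esub> h \<in> V" if gh: "g \<in> G" "h \<in> G" for g h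
  proof -
    consider A B where "g = p A" "h = p B" "A \<in> \<A>" "B \<in> \<A>"
      | A \<alpha> \<beta> w where "g = p A" "A \<in> \<A>" "h = e \<alpha> \<beta> w" "\<alpha> \<in> F" "\<beta> \<in> F" "w \<in> W"
      | A \<alpha> \<beta> w where "h = p A" "A \<in> \<A>" "g = e \<alpha> \<beta> w" "\<alpha> \<in> F" "\<beta> \<in> F" "w \<in> W"
      | \<alpha> \<beta> w \<gamma> \<delta> v where "g = e \<alpha> \<beta> w" "\<alpha> \<in> F" "\<beta> \<in> F" "w \<in> W" "h = e \<gamma> \<delta> v" "\<gamma> \<in> F" "\<delta> \<in> F" "v \<in> W"
      using gh unfolding G_def by blast
    then show ?thesis
    proof cases
      case 1
      then show ?thesis using dis[of A B] pG z by (cases "A = B") (auto simp: C.P_bot)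
    next
      case 2
      then show ?thesis using pe(1) WD(1,5) pW(1) by (simp add: eG)
    next
      case 3
      then show ?thesis using pe(2) WD(1,5) pW(1) by (simp add: eG)
    next
      case 4
      then show ?thesis using ee WD(1,5) pW(2) z by (simp add: eG)
    qed
  qed
  have e_add: "e \<alpha> \<beta> (w \<oplus>\<^bsub>C\<^esub> v) = e \<alpha> \<beta> w \<oplus>\<^bsub>C\<^esub> e \<alpha> \<beta> v" "e \<alpha> \<beta> (c \<odot>\<^bsub>C\<^esub> w) = c \<odot>\<^bsub>C\<^esub> e \<alpha> \<beta> w"
    "e \<alpha> \<beta> \<zero>\<^bsub>C\<^esub> = \<zero>\<^bsub>C\<^esub>"
    if "\<alpha> \<in> F" "\<beta> \<in> F" "w \<in> carrier C" "v \<in> carrier C" for \<alpha> \<beta> w v c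
    using that s' by (simp_all add: e_def C.distrib_left C.distrib_right C.smult_mult_left C.smult_mult_right)
  \<comment> \<open>Normal form of an element of V: one scalar for each member of
    \<open>\<A>\<close> and one entry from W for each pair of labels. The two kinds of coefficients
    are estimated separately.\<close>
  define N1 where "N1 c = finsum C (\<lambda>A. c A \<odot>\<^bsub>C\<^esub> p A) \<A>" for c
  define N2 where "N2 w = finsum C (\<lambda>k. e (fst k) (snd k) (w k)) (F \<times> F)" for w
  have NF: "\<exists>c w. (\<forall>k. w k \<in> W) \<and> x = N1 c \<oplus>\<^bsub>C\<^esub> N2 w" if "x \<in> V" for x
    using that unfolding V_def
  proof induction
    case lspan_zero
    have "N1 (\<lambda>_. 0) = \<zero>\<^bsub>C\<^esub>" by (simp add: N1_def)
    moreover have "N2 (\<lambda>_. \<zero>\<^bsub>C\<^esub>) = \<zero>\<^bsub>C\<^esub>"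
      unfolding N2_def by (rule C.M.add.finprod_one_eqI) (auto simp: e_add(3)[OF _ _ C.M.zero_closed C.M.zero_closed])
    ultimately show ?case using WD(2) by (intro exI[of _ "\<lambda>_. 0"] exI[of _ "\<lambda>_. \<zero>\<^bsub>C\<^esub>"]) simp
  next
    case (lspan_step x g d)
    then obtain c w where cw: "\<And>k. w k \<in> W" "x = N1 c \<oplus>\<^bsub>C\<^esub> N2 w" by blast
    have wC: "w k \<in> carrier C" for k using cw WD(1) by blast
    have N2c: "N2 v \<in> carrier C" if "\<And>k. v k \<in> carrier C" for v
      unfolding N2_def using e_closed that by (intro C.M.finsum_closed) auto
    have N1c: "N1 c \<in> carrier C" for c
      unfolding N1_def by (intro C.M.finsum_closed) auto
    from lspan_step(2) consider A where "A \<in> \<A>" "g = p A"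
      | \<alpha> \<beta> v where "\<alpha> \<in> F" "\<beta> \<in> F" "v \<in> W" "g = e \<alpha> \<beta> v"
      unfolding G_def by blast
    then show ?case
    proof cases
      case 1
      define c' where "c' B = (if B = A then d else 0)" for B
      have "d \<odot>\<^bsub>C\<^esub> g = N1 c'"
        unfolding N1_def using fin 1 by (subst C.finsum_single[of _ A]) (auto simp: c'_def)
      moreover have "N1 (\<lambda>A. c A + c' A) = N1 c \<oplus>\<^bsub>C\<^esub> N1 c'"
        unfolding N1_def by (simp add: C.add_smult C.M.finsum_addf Pi_def)
      ultimately have "x \<oplus>\<^bsub>C\<^esub> d \<odot>\<^bsub>C\<^esub> g = N1 (\<lambda>A. c A + c' A) \<oplus>\<^bsub>C\<^esub> N2 w"
        using N1c N2c[OF wC] by (simp add: cw(2) C.M.a_ac)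
      then show ?thesis using cw(1) by blast
    next
      case 2
      define u where "u k = (if k = (\<alpha>, \<beta>) then d \<odot>\<^bsub>C\<^esub> v else \<zero>\<^bsub>C\<^esub>)" for k
      have uW: "u k \<in> W" for k using 2 WD by (auto simp: u_def)
      then have uC: "u k \<in> carrier C" for k using WD(1) by blast
      have vC: "v \<in> carrier C" using 2 WD(1) by blast
      have "d \<odot>\<^bsub>C\<^esub> g = N2 u"
        unfolding N2_def using fin 2 vC e_closed[OF 2(1,2) vC]
        by (subst C.finsum_single[of _ "(\<alpha>, \<beta>)"])
          (auto simp: u_def e_add(2)[OF _ _ vC vC] e_add(3)[OF _ _ vC vC])
      moreover have "N2 (\<lambda>k. w k \<oplus>\<^bsub>C\<^esub> u k) = N2 w \<oplus>\<^bsub>C\<^esub> N2 u"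
      proof -
        have "N2 w \<oplus>\<^bsub>C\<^esub> N2 u = finsum C (\<lambda>k. e (fst k) (snd k) (w k) \<oplus>\<^bsub>C\<^esub> e (fst k) (snd k) (u k)) (F \<times> F)"
          unfolding N2_def using wC uC e_closed by (intro C.M.finsum_addf[symmetric]) auto
        also have "\<dots> = N2 (\<lambda>k. w k \<oplus>\<^bsub>C\<^esub> u k)"
          unfolding N2_def using wC uC e_closed by (intro C.M.finsum_cong') (auto simp: e_add(1))
        finally show ?thesis ..
      qed
      ultimately have "x \<oplus>\<^bsub>C\<^esub> d \<odot>\<^bsub>C\<^esub> g = N1 c \<oplus>\<^bsub>C\<^esub> N2 (\<lambda>k. w k \<oplus>\<^bsub>C\<^esub> u k)"
        using N1c N2c[OF wC] N2c[OF uC] by (simp add: cw(2) C.M.a_ac)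
      then show ?thesis using WD(3)[OF cw(1) uW]
        by (intro exI[of _ c] exI[of _ "\<lambda>k. w k \<oplus>\<^bsub>C\<^esub> u k"] conjI allI)
    qed
  qed
  obtain K where K: "K \<ge> 0" "\<And>x. x \<in> W \<Longrightarrow> nrm C x \<le> K * nrm X (\<pi> x)" using WD(6) by blast
  define n where "n = real (card \<A>)"
  define f where "f = real (card (F \<times> F))"
  \<comment> \<open>The scalars are bounded by N = \<open>nrm X (\<pi> x)\<close>, hence N1 by n N.
    What remains is \<open>y\<close>, whose image has norm at most (1 + n) N; each matrix entry
    costs a further factor K, and there are f of them.\<close>
  have lower: "nrm C x \<le> (n + f * (K * (1 + n))) * nrm X (\<pi> x)" if xV: "x \<in> V" for x
  proof -
    obtain c w where cw: "\<And>k. w k \<in> W" "x = N1 c \<oplus>\<^bsub>C\<^esub> N2 w" using NF[OF xV] by blast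
    have wC: "w k \<in> carrier C" for k using cw WD(1) by blast
    have x: "x \<in> carrier C" using xV span(1) by (simp add: V_def)
    define N where "N = nrm X (\<pi> x)"
    have N0: "N \<ge> 0" using x by (simp add: N_def X.nrm_nonneg)
    have ec: "e (fst k) (snd k) (w k) \<in> carrier C" if "k \<in> F \<times> F" for k
      using that e_closed wC by auto
    have N2c: "N2 w \<in> carrier C" unfolding N2_def using ec by (intro C.M.finsum_closed) auto
    have N1c: "N1 c \<in> carrier C" unfolding N1_def by (intro C.M.finsum_closed) auto
    have piN1: "\<pi> (N1 c) = finsum X (\<lambda>A. c A \<odot>\<^bsub>X\<^esub> P A) \<A>"
      unfolding N1_def by (subst hom_finsum) (auto simp: hom_smult hom_p)
    have piN2: "\<pi> (N2 w) = finsum X (\<lambda>k. S' (fst k) \<otimes>\<^bsub>X\<^esub> (\<pi> (w k) \<otimes>\<^bsub>X\<^esub> star X (S' (snd k)))) (F \<times> F)"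
      unfolding N2_def using ec wC s'
      by (subst hom_finsum) (auto intro!: X.M.finsum_cong' simp: e_def hom_mult hom_star)
    \<comment> \<open>Compression by t kills N2 and all but one summand of N1, leaving the scalar
      times a projection of norm 1.\<close>
    have c: "cmod (c A) \<le> N" if A: "A \<in> \<A>" for A
    proof -
      obtain t E where t: "t \<in> carrier X" "nrm X t \<le> 1" "P E \<noteq> \<zero>\<^bsub>X\<^esub>"
        "\<And>B. B \<in> \<A> \<Longrightarrow> star X t \<otimes>\<^bsub>X\<^esub> (P B \<otimes>\<^bsub>X\<^esub> t) = (if B = A then P E else \<zero>\<^bsub>X\<^esub>)"
        "\<And>\<alpha>. \<alpha> \<in> F \<Longrightarrow> star X t \<otimes>\<^bsub>X\<^esub> S' \<alpha> = \<zero>\<^bsub>X\<^esub>"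
        using detect[OF A] unfolding S'_def by blast
      have st: "star X t \<in> carrier X" using t by simp
      have piC: "\<pi> (N1 c) \<in> carrier X" "\<pi> (N2 w) \<in> carrier X" "\<pi> x \<in> carrier X"
        using N1c N2c x by simp_all
      have 1: "star X t \<otimes>\<^bsub>X\<^esub> (\<pi> (N1 c) \<otimes>\<^bsub>X\<^esub> t) = finsum X (\<lambda>B. star X t \<otimes>\<^bsub>X\<^esub> (c B \<odot>\<^bsub>X\<^esub> P B \<otimes>\<^bsub>X\<^esub> t)) \<A>"
        unfolding piN1 using t st by (subst X.mult_finsum(2), simp, simp, subst X.mult_finsum(1)) auto
      also have "\<dots> = star X t \<otimes>\<^bsub>X\<^esub> (c A \<odot>\<^bsub>X\<^esub> P A \<otimes>\<^bsub>X\<^esub> t)"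
        using fin A t st by (intro X.finsum_single) (auto simp: X.smult_mult_left X.smult_mult_right)
      also have "\<dots> = c A \<odot>\<^bsub>X\<^esub> P E"
        using A t st by (simp add: X.smult_mult_left X.smult_mult_right)
      finally have 1: "star X t \<otimes>\<^bsub>X\<^esub> (\<pi> (N1 c) \<otimes>\<^bsub>X\<^esub> t) = c A \<odot>\<^bsub>X\<^esub> P E" .
      have "star X t \<otimes>\<^bsub>X\<^esub> \<pi> (N2 w) = finsum X (\<lambda>k. star X t \<otimes>\<^bsub>X\<^esub> (S' (fst k) \<otimes>\<^bsub>X\<^esub> (\<pi> (w k) \<otimes>\<^bsub>X\<^esub> star X (S' (snd k))))) (F \<times> F)"
        unfolding piN2 using st s' wC by (intro X.mult_finsum) auto
      also have "\<dots> = \<zero>\<^bsub>X\<^esub>"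
        using st s' wC t(5) by (intro X.M.add.finprod_one_eqI) (auto simp: X.mult_assoc[symmetric])
      finally have 2: "star X t \<otimes>\<^bsub>X\<^esub> \<pi> (N2 w) = \<zero>\<^bsub>X\<^esub>" .
      have "star X t \<otimes>\<^bsub>X\<^esub> (\<pi> x \<otimes>\<^bsub>X\<^esub> t)
          = star X t \<otimes>\<^bsub>X\<^esub> (\<pi> (N1 c) \<otimes>\<^bsub>X\<^esub> t) \<oplus>\<^bsub>X\<^esub> (star X t \<otimes>\<^bsub>X\<^esub> \<pi> (N2 w)) \<otimes>\<^bsub>X\<^esub> t"
        unfolding cw(2) using N1c N2c piC st t
        by (simp add: hom_add X.distrib_left X.distrib_right X.mult_assoc)
      also have "\<dots> = c A \<odot>\<^bsub>X\<^esub> P E" using t by (simp add: 1 2)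
      finally have "cmod (c A) = nrm X (star X t \<otimes>\<^bsub>X\<^esub> (\<pi> x \<otimes>\<^bsub>X\<^esub> t))"
        using X.nrm_P(2)[OF t(3)] by (simp add: X.nrm_smult)
      also have "\<dots> \<le> nrm X (star X t) * (nrm X (\<pi> x) * nrm X t)"
        using st t piC by (intro order_trans[OF X.nrm_mult] mult_left_mono X.nrm_mult) (auto simp: X.nrm_nonneg)
      also have "\<dots> \<le> 1 * (N * 1)"
        using t N0 by (intro mult_mono) (auto simp: N_def X.nrm_star X.nrm_nonneg)
      finally show ?thesis by simp
    qed
    have nN1: "nrm C (N1 c) \<le> n * N"
    proof -
      have "nrm C (N1 c) \<le> (\<Sum>A\<in>\<A>. nrm C (c A \<odot>\<^bsub>C\<^esub> p A))"
        unfolding N1_def by (intro C.nrm_finsum fin) auto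
      also have "\<dots> \<le> (\<Sum>A\<in>\<A>. N)"
      proof (intro sum_mono)
        fix A assume "A \<in> \<A>"
        then have "cmod (c A) * nrm C (p A) \<le> N * 1"
          using c N0 by (intro mult_mono C.nrm_P) (auto simp: C.nrm_nonneg)
        then show "nrm C (c A \<odot>\<^bsub>C\<^esub> p A) \<le> N" by (simp add: C.nrm_smult)
      qed
      finally show ?thesis by (simp add: n_def)
    qed
    define y where "y = N2 w"
    have y: "y \<in> carrier C" "y = x \<ominus>\<^bsub>C\<^esub> N1 c"
      using N1c N2c by (simp_all add: y_def C.add_eq_diff[symmetric] cw(2) C.M.a_comm)
    have piy: "nrm X (\<pi> y) \<le> (1 + n) * N"
    proof -
      have "nrm X (\<pi> y) \<le> nrm X (\<pi> x) + nrm X ((-1) \<odot>\<^bsub>X\<^esub> \<pi> (N1 c))"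
        unfolding y(2) using x N1c by (simp add: hom_diff X.diff_eq X.nrm_triangle)
      also have "\<dots> \<le> N + n * N"
        using nN1 hom_contractive[OF N1c] N1c by (simp add: X.nrm_smult N_def)
      finally show ?thesis by (simp add: algebra_simps)
    qed
    \<comment> \<open>Compressing y by the \<open>s'\<close> recovers an entry only up to a cut by
      \<open>p (D \<alpha>)\<close> and \<open>p (D \<beta>)\<close>. The cut does not change
      \<open>e\<close>, by \<open>ev\<close>, and keeps the entry in W, where the bound with K
      applies.\<close>
    define v where "v k = star C (s' (fst k)) \<otimes>\<^bsub>C\<^esub> (y \<otimes>\<^bsub>C\<^esub> s' (snd k))" for k
    have v: "v (\<alpha>, \<beta>) = p (D \<alpha>) \<otimes>\<^bsub>C\<^esub> (w (\<alpha>, \<beta>) \<otimes>\<^bsub>C\<^esub> p (D \<beta>))" if ab: "\<alpha> \<in> F" "\<beta> \<in> F" for \<alpha> \<beta>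
    proof -
      have sc: "star C (s' \<alpha>) \<in> carrier C" "s' \<beta> \<in> carrier C" using ab s' by auto
      have "v (\<alpha>, \<beta>) = finsum C (\<lambda>k. star C (s' \<alpha>) \<otimes>\<^bsub>C\<^esub> (e (fst k) (snd k) (w k) \<otimes>\<^bsub>C\<^esub> s' \<beta>)) (F \<times> F)"
      proof -
        have g: "(\<lambda>k. e (fst k) (snd k) (w k)) \<in> F \<times> F \<rightarrow> carrier C"
          "(\<lambda>k. e (fst k) (snd k) (w k) \<otimes>\<^bsub>C\<^esub> s' \<beta>) \<in> F \<times> F \<rightarrow> carrier C"
          using ec sc by auto
        show ?thesis
          unfolding v_def y_def N2_def fst_conv snd_conv C.mult_finsum(2)[OF sc(2) g(1)]
          by (rule C.mult_finsum(1)[OF sc(1) g(2)])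
      qed
      also have "\<dots> = star C (s' \<alpha>) \<otimes>\<^bsub>C\<^esub> (e \<alpha> \<beta> (w (\<alpha>, \<beta>)) \<otimes>\<^bsub>C\<^esub> s' \<beta>)"
      proof (subst C.finsum_single[of _ "(\<alpha>, \<beta>)"])
        fix k assume k: "k \<in> F \<times> F" "k \<noteq> (\<alpha>, \<beta>)"
        then have kF: "fst k \<in> F" "snd k \<in> F" by auto
        have "star C (s' \<alpha>) \<otimes>\<^bsub>C\<^esub> (e (fst k) (snd k) (w k) \<otimes>\<^bsub>C\<^esub> s' \<beta>)
            = (star C (s' \<alpha>) \<otimes>\<^bsub>C\<^esub> s' (fst k)) \<otimes>\<^bsub>C\<^esub> (w k \<otimes>\<^bsub>C\<^esub> (star C (s' (snd k)) \<otimes>\<^bsub>C\<^esub> s' \<beta>))"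
          using sc s'(1)[OF kF(1)] s'(1)[OF kF(2)] wC by (simp add: e_def C.mult_assoc)
        then show "star C (s' \<alpha>) \<otimes>\<^bsub>C\<^esub> (e (fst k) (snd k) (w k) \<otimes>\<^bsub>C\<^esub> s' \<beta>) = \<zero>\<^bsub>C\<^esub>"
          using k(2) ab kF wC by (cases k) (auto simp: ss)
      qed (use fin ab sc e_closed[OF ab wC] in auto)
      also have "\<dots> = (star C (s' \<alpha>) \<otimes>\<^bsub>C\<^esub> s' \<alpha>) \<otimes>\<^bsub>C\<^esub> (w (\<alpha>, \<beta>) \<otimes>\<^bsub>C\<^esub> (star C (s' \<beta>) \<otimes>\<^bsub>C\<^esub> s' \<beta>))"
        using s'(1)[OF ab(1)] s'(1)[OF ab(2)] wC by (simp add: e_def C.mult_assoc)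
      finally show ?thesis using ab by (simp add: ss)
    qed
    have ev: "e \<alpha> \<beta> (v (\<alpha>, \<beta>)) = e \<alpha> \<beta> (w (\<alpha>, \<beta>))" if ab: "\<alpha> \<in> F" "\<beta> \<in> F" for \<alpha> \<beta>
    proof -
      have "e \<alpha> \<beta> (v (\<alpha>, \<beta>)) = (s' \<alpha> \<otimes>\<^bsub>C\<^esub> p (D \<alpha>)) \<otimes>\<^bsub>C\<^esub> (w (\<alpha>, \<beta>) \<otimes>\<^bsub>C\<^esub> (p (D \<beta>) \<otimes>\<^bsub>C\<^esub> star C (s' \<beta>)))"
        unfolding v[OF ab] e_def using s'(1)[OF ab(1)] s'(1)[OF ab(2)] wC by (simp add: C.mult_assoc)
      then show ?thesis using ab by (simp add: sp e_def)
    qed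
    have ne: "nrm C (e (fst k) (snd k) (w k)) \<le> K * ((1 + n) * N)" if k: "k \<in> F \<times> F" for k
    proof -
      obtain \<alpha> \<beta> where ab: "k = (\<alpha>, \<beta>)" "\<alpha> \<in> F" "\<beta> \<in> F" using k by auto
      note sa = s'[OF ab(2)] and sb = s'[OF ab(3)]
      have vW: "v (\<alpha>, \<beta>) \<in> W" unfolding v[OF ab(2,3)] using ab cw(1) pW(2) by (intro WD(5))
      have vC: "v (\<alpha>, \<beta>) \<in> carrier C" using vW by (rule WD(1))
      have "nrm C (e \<alpha> \<beta> (v (\<alpha>, \<beta>))) \<le> nrm C (s' \<alpha>) * (nrm C (v (\<alpha>, \<beta>)) * nrm C (s' \<beta>))"
        unfolding e_def using sa sb vC C.nrm_mult[of "v (\<alpha>, \<beta>)" "star C (s' \<beta>)"]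
        by (intro order_trans[OF C.nrm_mult] mult_left_mono) (auto simp: C.nrm_nonneg C.nrm_star)
      also have "\<dots> \<le> 1 * (nrm C (v (\<alpha>, \<beta>)) * 1)"
        using sa sb vC by (intro mult_mono) (auto simp: C.nrm_nonneg)
      also have "\<dots> \<le> K * nrm X (\<pi> (v (\<alpha>, \<beta>)))" using K(2)[OF vW] by simp
      also have "\<pi> (v (\<alpha>, \<beta>)) = star X (S' \<alpha>) \<otimes>\<^bsub>X\<^esub> (\<pi> y \<otimes>\<^bsub>X\<^esub> S' \<beta>)"
        unfolding v_def using sa sb y(1) by (simp add: hom_mult hom_star)
      also have "nrm X \<dots> \<le> nrm X (S' \<alpha>) * (nrm X (\<pi> y) * nrm X (S' \<beta>))"
        using sa sb y(1) X.nrm_mult[of "\<pi> y" "S' \<beta>"]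
        by (intro order_trans[OF X.nrm_mult]) (auto simp: X.nrm_nonneg X.nrm_star intro!: mult_left_mono)
      also have "\<dots> \<le> 1 * (nrm X (\<pi> y) * 1)"
        using sa sb y(1) by (intro mult_mono) (auto simp: X.nrm_nonneg)
      also have "\<dots> \<le> (1 + n) * N" using piy by simp
      finally show ?thesis using K(1) ab by (simp add: ev mult_left_mono)
    qed
    have "nrm C y \<le> (\<Sum>k\<in>F\<times>F. nrm C (e (fst k) (snd k) (w k)))"
      unfolding y_def N2_def using fin ec by (intro C.nrm_finsum) auto
    also have "\<dots> \<le> (\<Sum>k\<in>F\<times>F. K * ((1 + n) * N))" by (intro sum_mono ne)
    also have "\<dots> = f * (K * ((1 + n) * N))" by (simp add: f_def)
    finally have "nrm C x \<le> n * N + f * (K * ((1 + n) * N))"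
      using C.nrm_triangle[OF N1c N2c] nN1 unfolding cw(2)[symmetric] y_def by linarith
    then show ?thesis by (simp add: N_def algebra_simps)
  qed
  have "bounded_below V"
    unfolding bounded_below_def
  proof (intro conjI ballI allI)
    show "V \<subseteq> carrier C" using span(1) by (auto simp: V_def)
    show "\<exists>K\<ge>0. \<forall>x\<in>V. nrm C x \<le> K * nrm X (\<pi> x)"
      using lower K(1) by (intro exI[of _ "n + f * (K * (1 + n))"]) (auto simp: n_def f_def)
    show "x \<oplus>\<^bsub>C\<^esub> y \<in> V" if "x \<in> V" "y \<in> V" for x y
      using that unfolding V_def by (rule C.lspan_add[OF GC])
    show "c \<odot>\<^bsub>C\<^esub> x \<in> V" if "x \<in> V" for c x
      using that unfolding V_def by (rule C.lspan_smult[OF GC])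
    show "x \<otimes>\<^bsub>C\<^esub> y \<in> V" if "x \<in> V" "y \<in> V" for x y
      using that GG unfolding V_def by (rule C.lspan_mult[OF GC GC GC, rotated])
  qed (rule z)
  then show ?thesis using pG eG unfolding e_def s'_def by blast
qed

end

lemma (in cstar_algebra) sum_smult:
  assumes "x \<in> carrier A" "finite K"
  shows "finsum A (\<lambda>k. c k \<odot> x) K = (\<Sum>k\<in>K. c k) \<odot> x"
  using assms(2) by induction (use assms(1) in \<open>simp_all add: M.finsum_insert add_smult Pi_def\<close>)

section \<open>Levels of the core, and the estimate on it\<close>

context ck_morphism
begin

definition level :: "nat \<Rightarrow> 'c set" where
  "level j = {m \<otimes>\<^bsub>C\<^esub> star C m' |m m'. m \<in> C.words j \<and> m' \<in> C.words j}"

lemma level_0: "level 0 = range p"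
proof
  show "level 0 \<subseteq> range p" by (auto simp: level_def)
  have "p A = p A \<otimes>\<^bsub>C\<^esub> star C (p A)" for A by simp
  then show "range p \<subseteq> level 0" unfolding level_def C.words.simps by blast
qed

text \<open>Peeling the outer letter off both words leaves a monomial one level below; the induction
  over levels runs on this.\<close>

lemma level_Suc:
  assumes "x \<in> level (Suc j)"
  obtains \<alpha> B z \<beta> B' where "\<alpha> \<in> L" "B \<in> I \<alpha>" "\<beta> \<in> L" "B' \<in> I \<beta>" "z \<in> level j"
    "x = s \<alpha> B \<otimes>\<^bsub>C\<^esub> (z \<otimes>\<^bsub>C\<^esub> star C (s \<beta> B'))"
proof -
  obtain \<alpha> B m \<beta> B' m' where 1: "x = (s \<alpha> B \<otimes>\<^bsub>C\<^esub> m) \<otimes>\<^bsub>C\<^esub> star C (s \<beta> B' \<otimes>\<^bsub>C\<^esub> m')"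
    "\<alpha> \<in> L" "B \<in> I \<alpha>" "\<beta> \<in> L" "B' \<in> I \<beta>" "m \<in> C.words j" "m' \<in> C.words j"
    using assms unfolding level_def C.words.simps by blast
  then have "x = s \<alpha> B \<otimes>\<^bsub>C\<^esub> ((m \<otimes>\<^bsub>C\<^esub> star C m') \<otimes>\<^bsub>C\<^esub> star C (s \<beta> B'))"
    using C.words_closed[OF 1(6)] C.words_closed[OF 1(7)] by (simp add: C.mult_assoc C.star_mult)
  moreover have "m \<otimes>\<^bsub>C\<^esub> star C m' \<in> level j" using 1 by (auto simp: level_def)
  ultimately show ?thesis using that 1 by blast
qed

lemma bounded_below_zero: "bounded_below {\<zero>\<^bsub>C\<^esub>}"
  unfolding bounded_below_def by (auto intro!: exI[of _ 0])

lemma finite_Delta: "C.regular A \<Longrightarrow> finite (C.\<Delta> A)"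
proof (cases "A = bot")
  case True
  then have "C.\<Delta> A = {}" using C.theta_bot by (auto simp: C.\<Delta>_def)
  then show ?thesis by simp
qed (simp add: C.regular_def)

text \<open>Induction on the level. The inner parts of the peeled monomials lie in a subalgebra W
  given by the induction hypothesis, and the projections in E are refined to disjoint ones.
  \<open>bounded_below_extend\<close> adjoins those that are not regular; the regular ones then
  follow as sums.\<close>

lemma bounded_below_finite:
  assumes nz: "\<And>E. E \<noteq> bot \<Longrightarrow> P E \<noteq> \<zero>\<^bsub>X\<^esub>"
  shows "finite E \<Longrightarrow> E \<subseteq> (\<Union>j\<le>k. level j) \<Longrightarrow> \<exists>V. bounded_below V \<and> E \<subseteq> V"
proof (induction k arbitrary: E)
  case 0
  then have "E \<subseteq> p ` UNIV" by (simp add: level_0)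
  then obtain Q where Q: "finite Q" "E = p ` Q" using finite_subset_image[OF 0(1)] by blast
  obtain \<A> where \<A>: "finite \<A>" "bot \<notin> \<A>" "\<And>A B. \<lbrakk>A \<in> \<A>; B \<in> \<A>; A \<noteq> B\<rbrakk> \<Longrightarrow> inf A B = bot"
    "Q \<subseteq> joins \<A>"
    using finite_disjoint_refinement[OF Q(1)] by metis
  \<comment> \<open>There are no labels at level 0, so W is the zero subalgebra; disjointness lets
    \<open>P A\<close> itself read off its coefficient.\<close>
  have "\<exists>V. bounded_below V \<and> p ` \<A> \<subseteq> V \<and> (\<forall>\<alpha>\<in>{}. \<forall>\<beta>\<in>{}. \<forall>w\<in>{\<zero>\<^bsub>C\<^esub>}.
      s \<alpha> bot \<otimes>\<^bsub>C\<^esub> (w \<otimes>\<^bsub>C\<^esub> star C (s \<beta> bot)) \<in> V)"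
  proof (rule bounded_below_extend[OF \<A>(1) _ \<A>(3) _ _ bounded_below_zero])
    fix A assume A: "A \<in> \<A>"
    have "star X (P A) \<otimes>\<^bsub>X\<^esub> (P B \<otimes>\<^bsub>X\<^esub> P A) = (if B = A then P A else \<zero>\<^bsub>X\<^esub>)" if "B \<in> \<A>" for B
      using \<A>(3)[OF that A] by (cases "B = A") (auto simp: X.P_bot)
    then show "\<exists>t E. t \<in> carrier X \<and> nrm X t \<le> 1 \<and> P E \<noteq> \<zero>\<^bsub>X\<^esub> \<and>
      (\<forall>B\<in>\<A>. star X t \<otimes>\<^bsub>X\<^esub> (P B \<otimes>\<^bsub>X\<^esub> t) = (if B = A then P E else \<zero>\<^bsub>X\<^esub>)) \<and>
      (\<forall>\<alpha>\<in>{}. star X t \<otimes>\<^bsub>X\<^esub> S \<alpha> bot = \<zero>\<^bsub>X\<^esub>)"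
      using nz[of A] A \<A>(2) X.nrm_P(1)[of A] by (intro exI[of _ "P A"] exI[of _ A] conjI) (auto simp del: X.P_simps)
  qed auto
  then obtain V where V: "bounded_below V" "p ` \<A> \<subseteq> V" by blast
  then show ?case using bounded_below_joins[OF V] \<A>(4) Q(2) by blast
next
  case (Suc k)
  define E0 where "E0 = E \<inter> range p"
  define Lk where "Lk = (\<Union>j\<le>k. level j)"
  define T0 where "T0 = {(\<alpha>, B, z, \<beta>, B') |\<alpha> B z \<beta> B'. \<alpha> \<in> L \<and> B \<in> I \<alpha> \<and> \<beta> \<in> L \<and> B' \<in> I \<beta> \<and> z \<in> Lk}"
  define f where "f = (\<lambda>(\<alpha>, B, z, \<beta>, B'). s \<alpha> B \<otimes>\<^bsub>C\<^esub> (z \<otimes>\<^bsub>C\<^esub> star C (s \<beta> B')))"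
  have "E - range p \<subseteq> f ` T0"
  proof
    fix x assume x: "x \<in> E - range p"
    then obtain j where j: "j \<le> Suc k" "x \<in> level j" using Suc.prems by blast
    with x obtain i where i: "j = Suc i" by (cases j) (auto simp: level_0)
    have "x \<in> level (Suc i)" using j i by simp
    then obtain \<alpha> B z \<beta> B' where 1: "\<alpha> \<in> L" "B \<in> I \<alpha>" "\<beta> \<in> L" "B' \<in> I \<beta>" "z \<in> level i"
      "x = s \<alpha> B \<otimes>\<^bsub>C\<^esub> (z \<otimes>\<^bsub>C\<^esub> star C (s \<beta> B'))"
      by (rule level_Suc)
    then have "(\<alpha>, B, z, \<beta>, B') \<in> T0" using j i by (auto simp: T0_def Lk_def)
    then show "x \<in> f ` T0" using 1(6) by (force simp: f_def)
  qed
  then obtain T where T: "T \<subseteq> T0" "finite T" "E - range p = f ` T"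
    using finite_subset_image[of "E - range p" f T0] Suc.prems(1) by auto
  have "E0 \<subseteq> p ` UNIV" "finite E0" using Suc.prems(1) by (auto simp: E0_def)
  then obtain Q where Q: "finite Q" "E0 = p ` Q" using finite_subset_image by metis
  obtain \<A> where \<A>: "finite \<A>" "bot \<notin> \<A>" "\<And>A B. \<lbrakk>A \<in> \<A>; B \<in> \<A>; A \<noteq> B\<rbrakk> \<Longrightarrow> inf A B = bot"
    "Q \<subseteq> joins \<A>"
    using finite_disjoint_refinement[OF Q(1)] by metis
  \<comment> \<open>Besides the labels occurring in E, the finitely many labels of each regular
    member are included, because its projection is a sum over them.\<close>
  define F where "F = fst ` T \<union> (\<lambda>(\<alpha>, B, z, \<beta>, B'). \<beta>) ` T \<union> (\<Union>A\<in>{A\<in>\<A>. C.regular A}. C.\<Delta> A)"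
  have F: "finite F" "F \<subseteq> L"
    using T \<A>(1) finite_Delta by (auto simp: F_def T0_def C.\<Delta>_def subset_iff)
  \<comment> \<open>All sets that stand next to the label \<alpha>. One upper bound
    \<open>D \<alpha>\<close> of them in the ideal allows a single partial isometry
    \<open>s \<alpha> (D \<alpha>)\<close> for each label.\<close>
  define GI where "GI \<alpha> = {B. \<exists>z \<beta> B'. (\<alpha>, B, z, \<beta>, B') \<in> T} \<union> {B'. \<exists>\<gamma> B z. (\<gamma>, B, z, \<alpha>, B') \<in> T} \<union> \<theta> \<alpha> ` \<A>" for \<alpha>
  have "\<exists>D\<in>I \<alpha>. \<forall>B\<in>GI \<alpha>. B \<le> D" if "\<alpha> \<in> F" for \<alpha>
  proof (rule boolean_ideal_upper_bound)
    show "boolean_ideal (I \<alpha>)" using C.ideal_I F that by auto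
    have "{B. \<exists>z \<beta> B'. (\<alpha>, B, z, \<beta>, B') \<in> T} \<subseteq> (\<lambda>(\<alpha>, B, z, \<beta>, B'). B) ` T"
      by force
    then have 1: "finite {B. \<exists>z \<beta> B'. (\<alpha>, B, z, \<beta>, B') \<in> T}"
      by (rule finite_subset) (simp add: T(2))
    have "{B'. \<exists>\<gamma> B z. (\<gamma>, B, z, \<alpha>, B') \<in> T} \<subseteq> (\<lambda>(\<alpha>, B, z, \<beta>, B'). B') ` T"
      by force
    then have "finite {B'. \<exists>\<gamma> B z. (\<gamma>, B, z, \<alpha>, B') \<in> T}"
      by (rule finite_subset) (simp add: T(2))
    then show "finite (GI \<alpha>)"
      unfolding GI_def using \<A>(1) 1 by simp
    show "GI \<alpha> \<subseteq> I \<alpha>"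
      using T(1) F(2) that C.theta_in_I by (auto simp: GI_def T0_def)
  qed
  then obtain D where D: "\<And>\<alpha>. \<alpha> \<in> F \<Longrightarrow> D \<alpha> \<in> I \<alpha>" "\<And>\<alpha> B. \<lbrakk>\<alpha> \<in> F; B \<in> GI \<alpha>\<rbrakk> \<Longrightarrow> B \<le> D \<alpha>"
    by metis
  \<comment> \<open>Everything that W has to contain, all of it of level at most k: the inner parts
    z, the projections that stand between z and the letters, and those of the images of the
    refinement under \<theta>.\<close>
  define E' where "E' = (\<lambda>(\<alpha>, B, z, \<beta>, B'). z) ` T \<union> (\<lambda>(\<alpha>, B, z, \<beta>, B'). p B) ` T
    \<union> (\<lambda>(\<alpha>, B, z, \<beta>, B'). p B') ` T \<union> (\<lambda>(\<alpha>, A). p (\<theta> \<alpha> A)) ` (F \<times> \<A>) \<union> (\<lambda>\<alpha>. p (D \<alpha>)) ` F"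
  have "range p \<subseteq> Lk" unfolding Lk_def using level_0 by blast
  then have "E' \<subseteq> Lk" using T(1) by (auto simp: E'_def T0_def)
  moreover have "finite E'" using T(2) \<A>(1) F(1) by (simp add: E'_def)
  ultimately obtain W where W: "bounded_below W" "E' \<subseteq> W" 
    using Suc.IH[of E'] unfolding Lk_def by auto
  note WD = bounded_belowD[OF W(1)]
  have pW: "p (\<theta> \<alpha> A) \<in> W" if "\<alpha> \<in> F" "A \<in> \<A>" for \<alpha> A
    using W(2) that by (force simp: E'_def)
  define \<A>' where "\<A>' = {A \<in> \<A>. \<not> C.regular A}"
  have "\<exists>V. bounded_below V \<and> p ` \<A>' \<subseteq> V \<and> (\<forall>\<alpha>\<in>F. \<forall>\<beta>\<in>F. \<forall>w\<in>W.
      s \<alpha> (D \<alpha>) \<otimes>\<^bsub>C\<^esub> (w \<otimes>\<^bsub>C\<^esub> star C (s \<beta> (D \<beta>))) \<in> V)"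
  proof (rule bounded_below_extend[OF _ F(1) _ F(2) D(1) W(1)])
    show "finite \<A>'" using \<A>(1) by (simp add: \<A>'_def)
    show "inf A B = bot" if "A \<in> \<A>'" "B \<in> \<A>'" "A \<noteq> B" for A B
      using that \<A>(3) by (simp add: \<A>'_def)
    show "p (\<theta> \<alpha> A) \<in> W" if "\<alpha> \<in> F" "A \<in> \<A>'" for \<alpha> A
      using that pW by (simp add: \<A>'_def)
    show "p (D \<alpha>) \<in> W" if "\<alpha> \<in> F" for \<alpha>
      using W(2) that by (auto simp: E'_def)
  next
    fix A assume "A \<in> \<A>'"
    then have A: "A \<in> \<A>" "\<not> C.regular A" by (auto simp: \<A>'_def)
    then obtain B where B: "B \<noteq> bot" "B \<le> A" "\<not> (finite (C.\<Delta> B) \<and> 0 < card (C.\<Delta> B))"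
      by (auto simp: C.regular_def)
    have BA: "inf B A' = (if A' = A then B else bot)" if "A' \<in> \<A>'" for A'
    proof (cases "A' = A")
      case False
      then have "inf A A' = bot" using \<A>(3)[OF A(1)] that by (simp add: \<A>'_def)
      then have "inf B A' \<le> bot" using inf_mono[OF B(2) order_refl, of A'] by simp
      then show ?thesis using False by (simp add: bot_unique)
    qed (use B(2) in \<open>simp add: inf_absorb1\<close>)
    have "\<exists>t E. t \<in> carrier X \<and> nrm X t \<le> 1 \<and> E \<noteq> bot \<and>
      (\<forall>A'\<in>\<A>'. star X t \<otimes>\<^bsub>X\<^esub> (P A' \<otimes>\<^bsub>X\<^esub> t) = (if A' = A then P E else \<zero>\<^bsub>X\<^esub>)) \<and>
      (\<forall>\<alpha>\<in>F. star X t \<otimes>\<^bsub>X\<^esub> S \<alpha> (D \<alpha>) = \<zero>\<^bsub>X\<^esub>)"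
    proof (cases "finite (C.\<Delta> B)")
      case True
      then have e: "C.\<Delta> B = {}" using B(3) by auto
      have "star X (P B) \<otimes>\<^bsub>X\<^esub> (P A' \<otimes>\<^bsub>X\<^esub> P B) = (if A' = A then P B else \<zero>\<^bsub>X\<^esub>)" if "A' \<in> \<A>'" for A'
      proof -
        have "inf B (inf A' B) = inf B A'" by (simp add: inf_aci)
        then show ?thesis using BA[OF that] by (simp add: X.P_bot)
      qed
      moreover have "star X (P B) \<otimes>\<^bsub>X\<^esub> S \<alpha> (D \<alpha>) = \<zero>\<^bsub>X\<^esub>" if "\<alpha> \<in> F" for \<alpha>
      proof -
        have "\<alpha> \<in> L" "\<theta> \<alpha> B = bot" using e F(2) that by (auto simp: C.\<Delta>_def)
        then show ?thesis using D(1)[OF that] by (simp add: X.P_S X.P_bot)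
      qed
      ultimately show ?thesis
        using B(1) X.nrm_P(1)[of B] X.P_closed[of B] by blast
    next
      case False
      then have "\<not> C.\<Delta> B \<subseteq> F" using F(1) finite_subset by blast
      then obtain \<gamma> where \<gamma>: "\<gamma> \<in> L" "\<theta> \<gamma> B \<noteq> bot" "\<gamma> \<notin> F" by (auto simp: C.\<Delta>_def)
      define t where "t = S \<gamma> (\<theta> \<gamma> B)"
      have I: "\<theta> \<gamma> B \<in> I \<gamma>" using \<gamma> by (rule_tac C.theta_in_I)
      have t: "t \<in> carrier X" "nrm X t \<le> 1" using \<gamma> I by (simp_all add: t_def X.nrm_S)
      have "star X t \<otimes>\<^bsub>X\<^esub> (P A' \<otimes>\<^bsub>X\<^esub> t) = (if A' = A then P (\<theta> \<gamma> B) else \<zero>\<^bsub>X\<^esub>)" if "A' \<in> \<A>'" for A'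
      proof -
        have "star X t \<otimes>\<^bsub>X\<^esub> (P A' \<otimes>\<^bsub>X\<^esub> t) = (star X t \<otimes>\<^bsub>X\<^esub> t) \<otimes>\<^bsub>X\<^esub> P (\<theta> \<gamma> A')"
          using \<gamma> I t by (simp add: t_def X.P_S X.mult_assoc)
        also have "star X t \<otimes>\<^bsub>X\<^esub> t = P (\<theta> \<gamma> B)"
          unfolding t_def X.S_S_same[OF \<gamma>(1) I I] by simp
        also have "P (\<theta> \<gamma> B) \<otimes>\<^bsub>X\<^esub> P (\<theta> \<gamma> A') = P (\<theta> \<gamma> (inf B A'))"
          by (simp only: X.P_simps C.theta_inf[OF \<gamma>(1)])
        also have "\<dots> = (if A' = A then P (\<theta> \<gamma> B) else \<zero>\<^bsub>X\<^esub>)"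
          unfolding BA[OF that] by (simp add: X.P_bot C.theta_bot[OF \<gamma>(1)])
        finally show ?thesis .
      qed
      moreover have "star X t \<otimes>\<^bsub>X\<^esub> S \<alpha> (D \<alpha>) = \<zero>\<^bsub>X\<^esub>" if "\<alpha> \<in> F" for \<alpha>
        using X.S_S[OF \<gamma>(1) I _ D(1)[OF that]] F(2) that \<gamma>(3) by (auto simp: t_def)
      ultimately show ?thesis using t \<gamma>(2) by blast
    qed
    then show "\<exists>t E. t \<in> carrier X \<and> nrm X t \<le> 1 \<and> P E \<noteq> \<zero>\<^bsub>X\<^esub> \<and>
      (\<forall>A'\<in>\<A>'. star X t \<otimes>\<^bsub>X\<^esub> (P A' \<otimes>\<^bsub>X\<^esub> t) = (if A' = A then P E else \<zero>\<^bsub>X\<^esub>)) \<and>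
      (\<forall>\<alpha>\<in>F. star X t \<otimes>\<^bsub>X\<^esub> S \<alpha> (D \<alpha>) = \<zero>\<^bsub>X\<^esub>)"
      using nz by metis
  qed
  then obtain V where V: "bounded_below V" "p ` \<A>' \<subseteq> V"
    "\<And>\<alpha> \<beta> w. \<lbrakk>\<alpha> \<in> F; \<beta> \<in> F; w \<in> W\<rbrakk> \<Longrightarrow> s \<alpha> (D \<alpha>) \<otimes>\<^bsub>C\<^esub> (w \<otimes>\<^bsub>C\<^esub> star C (s \<beta> (D \<beta>))) \<in> V" by metis
  note VD = bounded_belowD[OF V(1)]
  \<comment> \<open>\<open>s \<alpha> B\<close> is \<open>s \<alpha> (D \<alpha>)\<close> times
    \<open>p B\<close>; the projection moves into the middle, where W is closed under
    products.\<close>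
  have mem: "s \<alpha> B \<otimes>\<^bsub>C\<^esub> (z \<otimes>\<^bsub>C\<^esub> star C (s \<beta> B')) \<in> V"
    if ab: "\<alpha> \<in> F" "\<beta> \<in> F" and BB: "B \<in> GI \<alpha>" "B' \<in> GI \<beta>" and w: "p B \<in> W" "p B' \<in> W" "z \<in> W"
    for \<alpha> \<beta> B B' z
  proof -
    have c: "z \<in> carrier C" "\<alpha> \<in> L" "\<beta> \<in> L" "D \<alpha> \<in> I \<alpha>" "D \<beta> \<in> I \<beta>"
      using WD(1)[OF w(3)] ab F D by auto
    have "s \<alpha> B = s \<alpha> (D \<alpha>) \<otimes>\<^bsub>C\<^esub> p B" "s \<beta> B' = s \<beta> (D \<beta>) \<otimes>\<^bsub>C\<^esub> p B'"
      using D(2)[OF ab(1) BB(1)] D(2)[OF ab(2) BB(2)] c by (auto intro: C.S_le)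
    then have "s \<alpha> B \<otimes>\<^bsub>C\<^esub> (z \<otimes>\<^bsub>C\<^esub> star C (s \<beta> B'))
        = s \<alpha> (D \<alpha>) \<otimes>\<^bsub>C\<^esub> ((p B \<otimes>\<^bsub>C\<^esub> (z \<otimes>\<^bsub>C\<^esub> p B')) \<otimes>\<^bsub>C\<^esub> star C (s \<beta> (D \<beta>)))"
      using c by (simp add: C.mult_assoc C.star_mult)
    then show ?thesis using V(3)[OF ab] WD(5) w by simp
  qed
  have "p A \<in> V" if A: "A \<in> \<A>" for A
  proof (cases "C.regular A")
    case False
    then show ?thesis using A V(2) by (auto simp: \<A>'_def)
  next
    case True
    \<comment> \<open>With a projection inserted in the middle, each summand of the sum for the
      regular A has the form that \<open>mem\<close> covers.\<close>
    have "s \<alpha> (\<theta> \<alpha> A) \<otimes>\<^bsub>C\<^esub> star C (s \<alpha> (\<theta> \<alpha> A)) \<in> V" if \<alpha>: "\<alpha> \<in> C.\<Delta> A" for \<alpha>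
    proof -
      have aF: "\<alpha> \<in> F" using \<alpha> A True by (auto simp: F_def)
      then have aI: "\<alpha> \<in> L" "\<theta> \<alpha> A \<in> I \<alpha>" using F(2) C.theta_in_I by auto
      have "s \<alpha> (\<theta> \<alpha> A) \<otimes>\<^bsub>C\<^esub> (p (\<theta> \<alpha> A) \<otimes>\<^bsub>C\<^esub> star C (s \<alpha> (\<theta> \<alpha> A))) \<in> V"
        by (rule mem[OF aF aF]) (use A aF pW in \<open>auto simp: GI_def\<close>)
      also have "s \<alpha> (\<theta> \<alpha> A) \<otimes>\<^bsub>C\<^esub> (p (\<theta> \<alpha> A) \<otimes>\<^bsub>C\<^esub> star C (s \<alpha> (\<theta> \<alpha> A)))
          = s \<alpha> (\<theta> \<alpha> A) \<otimes>\<^bsub>C\<^esub> star C (s \<alpha> (\<theta> \<alpha> A))"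
        using aI by (simp add: C.mult_assoc[symmetric] C.S_P)
      finally show ?thesis .
    qed
    moreover have "V \<subseteq> carrier C" using VD(1) by blast
    ultimately have "p A \<in> C.lspan V"
      unfolding C.P_regular[OF True]
      by (intro C.finsum_lspan C.lspan_base finite_Delta[OF True]) auto
    then show ?thesis by (rule bounded_below_lspan[OF V(1) subset_refl])
  qed
  then have "E0 \<subseteq> V" using bounded_below_joins[OF V(1), of \<A>] \<A>(4) Q(2) by blast
  moreover have "f t \<in> V" if t: "t \<in> T" for t
  proof -
    obtain \<alpha> B z \<beta> B' where 1: "t = (\<alpha>, B, z, \<beta>, B')" by (cases t)
    have im: "g (\<alpha>, B, z, \<beta>, B') \<in> g ` T" for g :: "'l \<times> 'b \<times> 'c \<times> 'l \<times> 'b \<Rightarrow> 'z"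
      using t 1 by simp
    have 2: "\<alpha> \<in> F" "\<beta> \<in> F"
      unfolding F_def using im[of fst] im[of "\<lambda>(\<alpha>, B, z, \<beta>, B'). \<beta>"] by simp_all
    have 3: "B \<in> GI \<alpha>" "B' \<in> GI \<beta>"
      unfolding GI_def using t 1 by blast+
    have 4: "z \<in> E'" "p B \<in> E'" "p B' \<in> E'"
      unfolding E'_def
      using im[of "\<lambda>(\<alpha>, B, z, \<beta>, B'). z"] im[of "\<lambda>(\<alpha>, B, z, \<beta>, B'). p B"]
        im[of "\<lambda>(\<alpha>, B, z, \<beta>, B'). p B'"] by simp_all
    have "f t = s \<alpha> B \<otimes>\<^bsub>C\<^esub> (z \<otimes>\<^bsub>C\<^esub> star C (s \<beta> B'))" by (simp add: f_def 1)
    also have "\<dots> \<in> V"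
      by (rule mem[OF 2 3]) (use 4 W(2) in auto)
    finally show ?thesis .
  qed
  then have "E - range p \<subseteq> V" unfolding T(3) by (rule image_subsetI)
  ultimately have "E \<subseteq> V" by (auto simp: E0_def)
  then show ?case using V(1) by blast
qed

text \<open>The element h = x* x involves finitely many monomials, so h and its iterated squares lie
  in one subalgebra V with a fixed constant K, and the constant disappears under the powers.\<close>

lemma core_le:
  assumes nz: "\<And>E. E \<noteq> bot \<Longrightarrow> P E \<noteq> \<zero>\<^bsub>X\<^esub>" and x: "x \<in> C.lspan (C.homogeneous 0)"
  shows "nrm C x \<le> nrm X (\<pi> x)"
proof -
  note span = C.lspan_closed[OF C.homogeneous_closed]
  have xc: "x \<in> carrier C" using x by (rule span)
  define h where "h = star C x \<otimes>\<^bsub>C\<^esub> x"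
  have sx: "star C x \<in> C.lspan (C.homogeneous 0)"
  proof (rule C.lspan_star[OF C.homogeneous_closed C.homogeneous_closed _ x])
    fix g assume "g \<in> C.homogeneous 0"
    then have "star C g \<in> C.homogeneous 0" using C.star_homogeneous[of g 0] by simp
    then show "star C g \<in> C.lspan (C.homogeneous 0)" by (rule C.lspan_base[OF C.homogeneous_closed])
  qed
  have "h \<in> C.lspan (C.homogeneous 0)"
    unfolding h_def
    by (rule C.lspan_mult[OF C.homogeneous_closed C.homogeneous_closed C.homogeneous_closed _ sx x])
      (use C.homogeneous_mult[of _ 0 _ 0] in simp)
  then obtain E where E: "E \<subseteq> C.homogeneous 0" "finite E" "h \<in> C.lspan E" using C.lspan_finite by blast
  have "C.homogeneous 0 \<subseteq> (\<Union>j. level j)" by (auto simp: C.homogeneous_def level_def)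
  then have "E \<subseteq> (\<Union>j. level j)" using E(1) by blast
  then have "\<forall>x\<in>E. \<exists>j. x \<in> level j" by blast
  then obtain g where g: "\<And>x. x \<in> E \<Longrightarrow> x \<in> level (g x)" by metis
  have "g x \<le> Max (g ` E)" if "x \<in> E" for x using E(2) that by simp
  then have "E \<subseteq> (\<Union>j\<le>Max (g ` E). level j)" using g by blast
  then obtain V where V: "bounded_below V" "E \<subseteq> V" using bounded_below_finite[OF nz E(2)] by blast
  have hV: "h \<in> V" by (rule bounded_below_lspan[OF V E(3)])
  have sqV: "C.sq m h \<in> V" for m
    by (induction m) (use hV bounded_belowD(5)[OF V(1)] in auto)
  have h: "h \<in> carrier C" "star C h = h" using xc by (simp_all add: h_def C.star_mult C.star_star)
  then have h': "\<pi> h \<in> carrier X" "star X (\<pi> h) = \<pi> h" by (simp_all add: hom_star[symmetric])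
  obtain K where K: "\<And>x. x \<in> V \<Longrightarrow> nrm C x \<le> K * nrm X (\<pi> x)" using bounded_belowD(6)[OF V(1)] by blast
  have "nrm C h \<le> nrm X (\<pi> h)"
  proof (rule power_bound_imp_le[where a = 0 and b = K])
    fix m
    show "nrm C h ^ (2 ^ m) \<le> (0 * 2 ^ m + K) * nrm X (\<pi> h) ^ (2 ^ m)"
      using K[OF sqV[of m]] h h' by (simp add: hom_sq C.sq_sa X.sq_sa)
  qed (use h h' in \<open>auto simp: C.nrm_nonneg X.nrm_nonneg\<close>)
  then have "(nrm C x)\<^sup>2 \<le> (nrm X (\<pi> x))\<^sup>2"
    using xc by (simp add: h_def hom_mult hom_star C.cstar_identity X.cstar_identity)
  then show ?thesis by (rule power2_le_imp_le) (use xc in \<open>simp add: X.nrm_nonneg\<close>)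
qed

end

section \<open>Gauge actions\<close>

context ck_morphism
begin

abbreviation gen :: "'x set" where
  "gen \<equiv> cstar_generated X (generators L I P S)"

lemma gen:
  shows gen_carrier: "x \<in> gen \<Longrightarrow> x \<in> carrier X"
    and gen_zero: "\<zero>\<^bsub>X\<^esub> \<in> gen"
    and gen_add: "\<lbrakk>x \<in> gen; y \<in> gen\<rbrakk> \<Longrightarrow> x \<oplus>\<^bsub>X\<^esub> y \<in> gen"
    and gen_smult: "x \<in> gen \<Longrightarrow> c \<odot>\<^bsub>X\<^esub> x \<in> gen"
    and gen_mult: "\<lbrakk>x \<in> gen; y \<in> gen\<rbrakk> \<Longrightarrow> x \<otimes>\<^bsub>X\<^esub> y \<in> gen"
    and gen_star: "x \<in> gen \<Longrightarrow> star X x \<in> gen"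
  using X.generated_subalgebra(1)[OF X.generators_closed] unfolding cstar_subalgebra_def by blast+

lemma gen_P: "P E \<in> gen"
  using X.generated_subalgebra(2)[OF X.generators_closed] by (auto simp: generators_def)

lemma gen_S: "\<lbrakk>\<alpha> \<in> L; B \<in> I \<alpha>\<rbrakk> \<Longrightarrow> S \<alpha> B \<in> gen"
  using X.generated_subalgebra(2)[OF X.generators_closed] by (auto simp: generators_def)

lemma generated_algebra_simps:
  "carrier (generated_algebra X L I P S) = gen"
  "x \<oplus>\<^bsub>generated_algebra X L I P S\<^esub> y = x \<oplus>\<^bsub>X\<^esub> y"
  "c \<odot>\<^bsub>generated_algebra X L I P S\<^esub> y = c \<odot>\<^bsub>X\<^esub> y"
  "x \<otimes>\<^bsub>generated_algebra X L I P S\<^esub> y = x \<otimes>\<^bsub>X\<^esub> y"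
  "star (generated_algebra X L I P S) x = star X x"
  "nrm (generated_algebra X L I P S) x = nrm X x"
  by (simp_all add: generated_algebra_def)

lemma generated_algebra_cstar: "cstar_algebra (generated_algebra X L I P S)"
  unfolding generated_algebra_def
  by (rule X.cstar_algebra_subalgebra[OF X.generated_subalgebra(1)[OF X.generators_closed]])

definition gauge :: "complex \<Rightarrow> ('x \<Rightarrow> 'x) \<Rightarrow> bool" where
  "gauge z \<beta> \<longleftrightarrow> star_hom (generated_algebra X L I P S) (generated_algebra X L I P S) \<beta> \<and>
    (\<forall>A. \<beta> (P A) = P A) \<and> (\<forall>\<alpha>\<in>L. \<forall>B\<in>I \<alpha>. \<beta> (S \<alpha> B) = z \<odot>\<^bsub>X\<^esub> S \<alpha> B)"

text \<open>The last clause is contractivity inside the generated algebra, which is a C*-algebra in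
  its own right.\<close>

lemma gaugeD:
  assumes "gauge z \<beta>"
  shows "x \<in> gen \<Longrightarrow> \<beta> x \<in> gen"
    "\<lbrakk>x \<in> gen; y \<in> gen\<rbrakk> \<Longrightarrow> \<beta> (x \<oplus>\<^bsub>X\<^esub> y) = \<beta> x \<oplus>\<^bsub>X\<^esub> \<beta> y"
    "x \<in> gen \<Longrightarrow> \<beta> (c \<odot>\<^bsub>X\<^esub> x) = c \<odot>\<^bsub>X\<^esub> \<beta> x"
    "\<lbrakk>x \<in> gen; y \<in> gen\<rbrakk> \<Longrightarrow> \<beta> (x \<otimes>\<^bsub>X\<^esub> y) = \<beta> x \<otimes>\<^bsub>X\<^esub> \<beta> y"
    "x \<in> gen \<Longrightarrow> \<beta> (star X x) = star X (\<beta> x)"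
    "\<beta> (P A) = P A" "\<lbrakk>\<alpha> \<in> L; B \<in> I \<alpha>\<rbrakk> \<Longrightarrow> \<beta> (S \<alpha> B) = z \<odot>\<^bsub>X\<^esub> S \<alpha> B"
    "x \<in> gen \<Longrightarrow> nrm X (\<beta> x) \<le> nrm X x"
proof -
  interpret D: cstar_algebra "generated_algebra X L I P S" by (rule generated_algebra_cstar)
  interpret H: cstar_hom "generated_algebra X L I P S" "generated_algebra X L I P S" \<beta>
    by unfold_locales (use assms in \<open>simp add: gauge_def\<close>)
  show "x \<in> gen \<Longrightarrow> \<beta> x \<in> gen"
    "\<lbrakk>x \<in> gen; y \<in> gen\<rbrakk> \<Longrightarrow> \<beta> (x \<oplus>\<^bsub>X\<^esub> y) = \<beta> x \<oplus>\<^bsub>X\<^esub> \<beta> y"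
    "x \<in> gen \<Longrightarrow> \<beta> (c \<odot>\<^bsub>X\<^esub> x) = c \<odot>\<^bsub>X\<^esub> \<beta> x"
    "\<lbrakk>x \<in> gen; y \<in> gen\<rbrakk> \<Longrightarrow> \<beta> (x \<otimes>\<^bsub>X\<^esub> y) = \<beta> x \<otimes>\<^bsub>X\<^esub> \<beta> y"
    "x \<in> gen \<Longrightarrow> \<beta> (star X x) = star X (\<beta> x)"
    "x \<in> gen \<Longrightarrow> nrm X (\<beta> x) \<le> nrm X x"
    using H.hom_closed[of x] H.hom_add[of x y] H.hom_smult[of x c] H.hom_mult[of x y] H.hom_star[of x]
      H.hom_contractive[of x] by (simp_all add: generated_algebra_simps)
  show "\<beta> (P A) = P A" "\<lbrakk>\<alpha> \<in> L; B \<in> I \<alpha>\<rbrakk> \<Longrightarrow> \<beta> (S \<alpha> B) = z \<odot>\<^bsub>X\<^esub> S \<alpha> B"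
    using assms by (simp_all add: gauge_def)
qed

lemma gauge_words:
  assumes "gauge z \<beta>"
  shows "m \<in> C.words i \<Longrightarrow> \<pi> m \<in> gen \<and> \<beta> (\<pi> m) = (z ^ i) \<odot>\<^bsub>X\<^esub> \<pi> m"
proof (induction i arbitrary: m)
  case 0
  then show ?case using gen_P gaugeD(6)[OF assms] by (auto simp: hom_p)
next
  case (Suc i)
  then obtain \<alpha> B m' where m: "m = s \<alpha> B \<otimes>\<^bsub>C\<^esub> m'" "\<alpha> \<in> L" "B \<in> I \<alpha>" "m' \<in> C.words i" by auto
  have c: "m' \<in> carrier C" using m(4) by (rule C.words_closed)
  have "\<pi> m = S \<alpha> B \<otimes>\<^bsub>X\<^esub> \<pi> m'" using m c by (simp add: hom_mult hom_s)
  then show ?case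
    using Suc.IH[OF m(4)] gen_S[OF m(2,3)] m(2,3) c
    by (simp add: gen_mult gaugeD[OF assms] X.smult_mult_left X.smult_mult_right mult.commute)
qed

lemma gauge_homogeneous:
  assumes \<beta>: "gauge z \<beta>" and z: "cmod z = 1" and x: "x \<in> C.lspan (C.homogeneous n)"
  shows "\<pi> x \<in> gen \<and> \<beta> (\<pi> x) = (z powi n) \<odot>\<^bsub>X\<^esub> \<pi> x"
  using x
proof induction
  case lspan_zero
  have "\<beta> \<zero>\<^bsub>X\<^esub> = 0 \<odot>\<^bsub>X\<^esub> \<beta> \<zero>\<^bsub>X\<^esub>" using gaugeD(3)[OF \<beta> gen_zero, of 0] by simp
  then show ?case using gen_zero gen_carrier[OF gaugeD(1)[OF \<beta> gen_zero]] by simp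
next
  case (lspan_step x g c)
  have xc: "x \<in> carrier C" using lspan_step(1) by (rule C.lspan_closed[OF C.homogeneous_closed])
  obtain i j m m' where g: "g = m \<otimes>\<^bsub>C\<^esub> star C m'" "m \<in> C.words i" "m' \<in> C.words j" "int i - int j = n"
    using lspan_step(2) by (auto simp: C.homogeneous_def)
  have mc: "m \<in> carrier C" "m' \<in> carrier C" using g C.words_closed by auto
  have m: "\<pi> m \<in> gen" "\<beta> (\<pi> m) = (z ^ i) \<odot>\<^bsub>X\<^esub> \<pi> m" "\<pi> m' \<in> gen" "\<beta> (\<pi> m') = (z ^ j) \<odot>\<^bsub>X\<^esub> \<pi> m'"
    using gauge_words[OF \<beta>] g by auto
  \<comment> \<open>On the circle conjugation inverts, so the letters of the adjoint word count
    negatively in the exponent.\<close>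
  have "z * cnj z = 1" using z by (simp add: complex_mult_cnj cmod_def)
  then have "cnj z = inverse z" by (metis inverse_unique)
  moreover have "z \<noteq> 0" using z by auto
  ultimately have zn: "cnj z ^ j * z ^ i = z powi n"
    unfolding g(4)[symmetric] by (simp add: power_int_diff power_inverse divide_inverse)
  have \<pi>g: "\<pi> g = \<pi> m \<otimes>\<^bsub>X\<^esub> star X (\<pi> m')" using mc by (simp add: g hom_mult hom_star)
  have gg: "\<pi> g \<in> gen" unfolding \<pi>g using m by (intro gen_mult gen_star)
  have "\<beta> (\<pi> g) = ((z ^ i) \<odot>\<^bsub>X\<^esub> \<pi> m) \<otimes>\<^bsub>X\<^esub> star X ((z ^ j) \<odot>\<^bsub>X\<^esub> \<pi> m')"
    unfolding \<pi>g using m by (simp add: gaugeD[OF \<beta>] gen_star)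
  also have "\<dots> = (z powi n) \<odot>\<^bsub>X\<^esub> \<pi> g"
    using mc by (simp add: \<pi>g X.star_smult X.smult_mult_left X.smult_mult_right zn)
  finally have \<beta>g: "\<beta> (\<pi> g) = (z powi n) \<odot>\<^bsub>X\<^esub> \<pi> g" .
  have gc: "g \<in> carrier C" using mc by (simp add: g)
  have eq: "\<pi> (x \<oplus>\<^bsub>C\<^esub> c \<odot>\<^bsub>C\<^esub> g) = \<pi> x \<oplus>\<^bsub>X\<^esub> c \<odot>\<^bsub>X\<^esub> \<pi> g"
    using xc gc by (simp add: hom_add hom_smult)
  show ?case
    unfolding eq using lspan_step(3) gg \<beta>g xc gc
    by (simp add: gen_add gen_smult gaugeD(2,3)[OF \<beta>] X.smult_add mult.commute)
qed

text \<open>Fourier coefficients, with the integral over the circle replaced by a sum over the roots of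
  unity of an order exceeding the degrees involved.\<close>

lemma component_le:
  assumes gauge: "\<And>z. cmod z = 1 \<Longrightarrow> \<exists>\<beta>. gauge z \<beta>"
    and a: "\<And>n. a n \<in> C.lspan (C.homogeneous n)" and n: "n \<in> {- int d..int d}"
  shows "nrm X (\<pi> (a n)) \<le> nrm X (\<pi> (finsum C a {- int d..int d}))"
proof -
  \<comment> \<open>Two degrees in J differ by at most 2 d < N, so the roots of unity of order N
    separate them.\<close>
  define N where "N = 2 * d + 1"
  define w where "w = cis (2 * pi / N)"
  define J where "J = {- int d..int d}"
  have w: "cmod (w ^ k) = 1" for k by (simp add: w_def norm_power)
  obtain b where b: "\<And>k. gauge (w ^ k) (b k)" using gauge[OF w] by metis
  define c where "c k = w powi (- n * int k)" for k
  have c: "cmod (c k) = 1" for k by (simp add: c_def w_def norm_power_int)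
  \<comment> \<open>On the image of the finite sum, T is N times the projection to degree n. Its
    norm is at most N because each \<open>b k\<close> is contractive and each \<open>c k\<close> has
    modulus 1.\<close>
  define T where "T y = finsum X (\<lambda>k. c k \<odot>\<^bsub>X\<^esub> b k y) {..<N}" for y
  have ac: "a m \<in> carrier C" for m using a by (rule C.lspan_closed[OF C.homogeneous_closed])
  have ag: "\<pi> (a m) \<in> gen" for m using gauge_homogeneous[OF b w a] by blast
  have bc: "b k y \<in> carrier X" if "y \<in> gen" for k y using gaugeD(1)[OF b that] by (rule gen_carrier)
  have T_closed: "T y \<in> carrier X" if "y \<in> gen" for y
    unfolding T_def using bc[OF that] by (intro X.M.finsum_closed) auto
  have T_add: "T (x \<oplus>\<^bsub>X\<^esub> y) = T x \<oplus>\<^bsub>X\<^esub> T y" if "x \<in> gen" "y \<in> gen" for x y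
    unfolding T_def using that bc
    by (subst X.M.finsum_addf[symmetric]) (auto intro!: X.M.finsum_cong' simp: gaugeD(2)[OF b] X.smult_add)
  have T_a: "T (\<pi> (a m)) = (if m = n then of_nat N else 0) \<odot>\<^bsub>X\<^esub> \<pi> (a m)" if m: "m \<in> J" for m
  proof -
    have nz: "w \<noteq> 0" by (simp add: w_def)
    have e: "c k * (w ^ k) powi m = w powi ((m - n) * int k)" for k
    proof -
      have "(w ^ k) powi m = w powi (int k * m)" by (simp add: power_int_mult)
      then have "c k * (w ^ k) powi m = w powi (- n * int k) * w powi (int k * m)"
        by (simp only: c_def)
      also have "\<dots> = w powi (- n * int k + int k * m)"
        using nz by (intro power_int_add[symmetric]) simp
      also have "- n * int k + int k * m = (m - n) * int k" by (simp add: algebra_simps)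
      finally show ?thesis .
    qed
    have "T (\<pi> (a m)) = finsum X (\<lambda>k. (w powi ((m - n) * int k)) \<odot>\<^bsub>X\<^esub> \<pi> (a m)) {..<N}"
      unfolding T_def using gauge_homogeneous[OF b w a[of m]] ac
      by (intro X.M.finsum_cong') (auto simp: e)
    also have "\<dots> = (\<Sum>k<N. w powi ((m - n) * int k)) \<odot>\<^bsub>X\<^esub> \<pi> (a m)"
      using ac by (intro X.sum_smult) auto
    also have "(\<Sum>k<N. w powi ((m - n) * int k)) = (if m - n = 0 then of_nat N else 0)"
      unfolding w_def by (rule sum_roots_of_unity) (use m n in \<open>auto simp: N_def J_def\<close>)
    finally show ?thesis by simp
  qed
  have T0: "T \<zero>\<^bsub>X\<^esub> = \<zero>\<^bsub>X\<^esub>"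
    using T_add[OF gen_zero gen_zero] T_closed[OF gen_zero] by (simp add: X.M.add.l_cancel_one')
  have "finsum X (\<lambda>m. \<pi> (a m)) J \<in> gen \<and> T (finsum X (\<lambda>m. \<pi> (a m)) J) = finsum X (\<lambda>m. T (\<pi> (a m))) J"
    by (rule finsum_hom[OF X.M.abelian_group_axioms X.M.abelian_group_axioms])
      (use gen_carrier gen_zero gen_add T_closed T0 T_add ag in auto)
  also have "finsum X (\<lambda>m. \<pi> (a m)) J = \<pi> (finsum C a J)"
    using ac by (intro hom_finsum[symmetric]) auto
  also have "finsum X (\<lambda>m. T (\<pi> (a m))) J = T (\<pi> (a n))"
    using n ac T_closed[OF ag] T_a by (intro X.finsum_single) (auto simp: J_def)
  finally have y: "\<pi> (finsum C a J) \<in> gen" "T (\<pi> (finsum C a J)) = of_nat N \<odot>\<^bsub>X\<^esub> \<pi> (a n)"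
    using T_a[of n] n by (auto simp: J_def)
  define y where "y = \<pi> (finsum C a J)"
  have "N * nrm X (\<pi> (a n)) = nrm X (T y)"
    using ac by (simp add: y_def y X.nrm_smult)
  also have "\<dots> \<le> (\<Sum>k<N. nrm X (c k \<odot>\<^bsub>X\<^esub> b k y))"
    unfolding T_def using bc y(1) by (intro X.nrm_finsum) (auto simp: y_def)
  also have "\<dots> \<le> (\<Sum>k<N. nrm X y)"
    using bc y(1) gaugeD(8)[OF b] by (intro sum_mono) (auto simp: X.nrm_smult c y_def)
  also have "\<dots> = N * nrm X y" by simp
  finally show ?thesis by (simp add: N_def y_def J_def)
qed

text \<open>Each component satisfies the inequality, because its adjoint times itself lies in the
  core. A sum of 2 e + 1 components then satisfies it up to that factor, and for the iterated
  squares of h = x* x the factor is linear in 2^m.\<close>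

lemma alg_le:
  assumes nz: "\<And>E. E \<noteq> bot \<Longrightarrow> P E \<noteq> \<zero>\<^bsub>X\<^esub>"
    and gauge: "\<And>z. cmod z = 1 \<Longrightarrow> \<exists>\<beta>. gauge z \<beta>"
    and x: "x \<in> C.alg d"
  shows "nrm C x \<le> nrm X (\<pi> x)"
proof -
  have crude: "nrm C y \<le> (2 * e + 1) * nrm X (\<pi> y)" if "y \<in> C.alg e" for y e
  proof -
    obtain a where a: "\<And>n. a n \<in> C.lspan (C.homogeneous n)" "y = finsum C a {- int e..int e}"
      using C.alg_decomposition[OF \<open>y \<in> C.alg e\<close>] by metis
    have ac: "a m \<in> carrier C" for m using a(1) by (rule C.lspan_closed[OF C.homogeneous_closed])
    have le: "nrm C (a n) \<le> nrm X (\<pi> (a n))" for n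
    proof -
      have st: "star C (a n) \<in> C.lspan (C.homogeneous (- n))"
      proof (rule C.lspan_star[OF C.homogeneous_closed C.homogeneous_closed _ a(1)])
        fix g assume "g \<in> C.homogeneous n"
        then show "star C g \<in> C.lspan (C.homogeneous (- n))"
          by (intro C.lspan_base[OF C.homogeneous_closed] C.star_homogeneous)
      qed
      have "star C (a n) \<otimes>\<^bsub>C\<^esub> a n \<in> C.lspan (C.homogeneous 0)"
        by (rule C.lspan_mult[OF C.homogeneous_closed C.homogeneous_closed C.homogeneous_closed _ st a(1)])
          (use C.homogeneous_mult[of _ "- n" _ n] in simp)
      from core_le[OF nz this] have "(nrm C (a n))\<^sup>2 \<le> (nrm X (\<pi> (a n)))\<^sup>2"
        using ac by (simp add: hom_mult hom_star C.cstar_identity X.cstar_identity)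
      then show ?thesis by (rule power2_le_imp_le) (use ac in \<open>simp add: X.nrm_nonneg\<close>)
    qed
    have "nrm C y \<le> (\<Sum>n\<in>{- int e..int e}. nrm C (a n))"
      unfolding a(2) using ac by (intro C.nrm_finsum) auto
    also have "\<dots> \<le> (\<Sum>n\<in>{- int e..int e}. nrm X (\<pi> y))"
      unfolding a(2) by (intro sum_mono order_trans[OF le] component_le gauge a(1))
    also have "\<dots> = (2 * e + 1) * nrm X (\<pi> y)" by simp
    finally show ?thesis by (simp add: add.commute)
  qed
  have xc: "x \<in> carrier C" using x by (rule C.alg_closed)
  define h where "h = star C x \<otimes>\<^bsub>C\<^esub> x"
  have h: "h \<in> carrier C" "star C h = h" using xc by (simp_all add: h_def C.star_mult C.star_star)
  then have h': "\<pi> h \<in> carrier X" "star X (\<pi> h) = \<pi> h" by (simp_all add: hom_star[symmetric])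
  have hd: "C.sq m h \<in> C.alg (2 * d * 2 ^ m)" for m
  proof (induction m)
    case 0
    have "h \<in> C.alg (d + d)" unfolding h_def using x by (intro C.alg_mult C.alg_star)
    then show ?case by (simp add: mult_2)
  next
    case (Suc m)
    then have "C.sq (Suc m) h \<in> C.alg (2 * d * 2 ^ m + 2 * d * 2 ^ m)"
      unfolding C.sq_simps by (intro C.alg_mult)
    then show ?case by (simp add: mult_2 distrib_left)
  qed
  have "nrm C h \<le> nrm X (\<pi> h)"
  \<comment> \<open>\<open>sq m h\<close> has degree at most 2 d 2^m, hence 2 (2 d 2^m) + 1
    components.\<close>
  proof (rule power_bound_imp_le[where a = "4 * d" and b = 1])
    fix m
    show "nrm C h ^ (2 ^ m) \<le> (real (4 * d) * 2 ^ m + 1) * nrm X (\<pi> h) ^ (2 ^ m)"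
      using crude[OF hd[of m]] h h' by (simp add: hom_sq C.sq_sa X.sq_sa mult_ac)
  qed (use h h' in \<open>auto simp: C.nrm_nonneg X.nrm_nonneg\<close>)
  then have "(nrm C x)\<^sup>2 \<le> (nrm X (\<pi> x))\<^sup>2"
    using xc by (simp add: h_def hom_mult hom_star C.cstar_identity X.cstar_identity)
  then show ?thesis by (rule power2_le_imp_le) (use xc in \<open>simp add: X.nrm_nonneg\<close>)
qed

lemma gauge_invariant_uniqueness:
  assumes nz: "\<And>E. E \<noteq> bot \<Longrightarrow> P E \<noteq> \<zero>\<^bsub>X\<^esub>"
    and gauge: "\<And>z. cmod z = 1 \<Longrightarrow> \<exists>\<beta>. gauge z \<beta>"
    and gen: "cstar_generated C (generators L I p s) = carrier C"
  shows "inj_on \<pi> (carrier C)"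
proof (rule inj_onI)
  \<comment> \<open>If t approximates x to within half the norm of x, then \<open>val t\<close> and
    its difference from x have the same image. So \<open>val t\<close> is no larger than the error,
    and x would be smaller than its own norm.\<close>
  have ker: "x = \<zero>\<^bsub>C\<^esub>" if x: "x \<in> carrier C" "\<pi> x = \<zero>\<^bsub>X\<^esub>" for x
  proof (rule ccontr)
    assume "x \<noteq> \<zero>\<^bsub>C\<^esub>"
    then have "nrm C x \<noteq> 0" using x by (simp add: C.nrm_eq_0_iff)
    then have "nrm C x / 2 > 0" using C.nrm_nonneg[OF x(1)] by simp
    moreover have "x \<in> C.limits" using C.generated_subset_limits gen x(1) by auto
    ultimately obtain t where t: "nrm C (x \<ominus>\<^bsub>C\<^esub> C.val t) < nrm C x / 2"
      using C.limitsD by blast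
    obtain d where d: "C.val t \<in> C.alg d" using C.val_alg by blast
    have vc: "C.val t \<in> carrier C" by (rule C.val_closed)
    have "\<pi> (C.val t \<ominus>\<^bsub>C\<^esub> x) = \<pi> (C.val t)" using vc x by (simp add: hom_diff)
    then have "nrm C (C.val t) \<le> nrm C (C.val t \<ominus>\<^bsub>C\<^esub> x)"
      using alg_le[OF nz gauge d] hom_contractive[of "C.val t \<ominus>\<^bsub>C\<^esub> x"] vc x by simp
    then show False
      using t C.nrm_le_diff[OF x(1) vc] C.nrm_diff_commute[OF x(1) vc] by simp
  qed
  fix x y assume xy: "x \<in> carrier C" "y \<in> carrier C" "\<pi> x = \<pi> y"
  then have "x \<ominus>\<^bsub>C\<^esub> y = \<zero>\<^bsub>C\<^esub>" by (intro ker) (simp_all add: hom_diff)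
  then show "x = y" using xy by (simp add: C.diff_eq_zero_iff)
qed

end

section \<open>Bounded operators on \<open>\<ell>\<^sup>2\<close>\<close>

text \<open>The index type is arbitrary, since the boundary paths may be uncountable.\<close>

typedef 'i ell2 = "{f :: 'i \<Rightarrow> complex. (\<lambda>i. (cmod (f i))\<^sup>2) summable_on UNIV}"
  by (rule exI[of _ "\<lambda>_. 0"]) simp

lemma ell2_summable: "(\<lambda>i. (cmod (Rep_ell2 x i))\<^sup>2) summable_on UNIV"
  using Rep_ell2[of x] by simp

lemma Rep_Abs_ell2: "(\<lambda>i. (cmod (f i))\<^sup>2) summable_on UNIV \<Longrightarrow> Rep_ell2 (Abs_ell2 f) = f"
  by (rule Abs_ell2_inverse) simp

lemma ell2_eqI: "(\<And>i. Rep_ell2 x i = Rep_ell2 y i) \<Longrightarrow> x = y"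
  by (rule Rep_ell2_inject[THEN iffD1], rule ext)

lemma square_summable_add:
  fixes f g :: "'i \<Rightarrow> complex"
  assumes "(\<lambda>i. (cmod (f i))\<^sup>2) summable_on UNIV" "(\<lambda>i. (cmod (g i))\<^sup>2) summable_on UNIV"
  shows "(\<lambda>i. (cmod (f i + g i))\<^sup>2) summable_on UNIV"
proof (rule summable_on_comparison_test)
  show "(\<lambda>i. 2 * (cmod (f i))\<^sup>2 + 2 * (cmod (g i))\<^sup>2) summable_on UNIV"
    using assms by (intro summable_on_add summable_on_cmult_right)
  show "(cmod (f i + g i))\<^sup>2 \<le> 2 * (cmod (f i))\<^sup>2 + 2 * (cmod (g i))\<^sup>2" for i
  proof -
    have "(cmod (f i + g i))\<^sup>2 \<le> (cmod (f i) + cmod (g i))\<^sup>2"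
      by (intro power_mono norm_triangle_ineq) simp
    also have "\<dots> \<le> 2 * (cmod (f i))\<^sup>2 + 2 * (cmod (g i))\<^sup>2"
      using zero_le_power2[of "cmod (f i) - cmod (g i)"] by (simp add: power2_sum power2_diff)
    finally show ?thesis .
  qed
qed simp

lemma square_summable_cmult:
  fixes f :: "'i \<Rightarrow> complex"
  assumes "(\<lambda>i. (cmod (f i))\<^sup>2) summable_on UNIV"
  shows "(\<lambda>i. (cmod (c * f i))\<^sup>2) summable_on UNIV"
  using summable_on_cmult_right[OF assms, of "(cmod c)\<^sup>2"] by (simp add: norm_mult power_mult_distrib)

definition cscale :: "complex \<Rightarrow> 'i ell2 \<Rightarrow> 'i ell2" where
  "cscale c x = Abs_ell2 (\<lambda>i. c * Rep_ell2 x i)"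

lemma Rep_cscale: "Rep_ell2 (cscale c x) i = c * Rep_ell2 x i"
  unfolding cscale_def by (simp only: Rep_Abs_ell2[OF square_summable_cmult[OF ell2_summable]])

lemma ell2_product_summable:
  "(\<lambda>i. Re (Rep_ell2 x i * cnj (Rep_ell2 y i))) summable_on UNIV"
proof -
  have "(\<lambda>i. \<bar>Re (Rep_ell2 x i * cnj (Rep_ell2 y i))\<bar>) summable_on UNIV"
  proof (rule summable_on_comparison_test)
    show "(\<lambda>i. (cmod (Rep_ell2 x i))\<^sup>2 + (cmod (Rep_ell2 y i))\<^sup>2) summable_on UNIV"
      by (intro summable_on_add ell2_summable)
    show "\<bar>Re (Rep_ell2 x i * cnj (Rep_ell2 y i))\<bar> \<le> (cmod (Rep_ell2 x i))\<^sup>2 + (cmod (Rep_ell2 y i))\<^sup>2" for i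
    proof -
      have "\<bar>Re (Rep_ell2 x i * cnj (Rep_ell2 y i))\<bar> \<le> cmod (Rep_ell2 x i) * cmod (Rep_ell2 y i)"
        using abs_Re_le_cmod[of "Rep_ell2 x i * cnj (Rep_ell2 y i)"] by (simp add: norm_mult)
      also have "\<dots> \<le> (cmod (Rep_ell2 x i))\<^sup>2 + (cmod (Rep_ell2 y i))\<^sup>2"
        using zero_le_power2[of "cmod (Rep_ell2 x i) - cmod (Rep_ell2 y i)"]
          mult_nonneg_nonneg[OF norm_ge_zero norm_ge_zero, of "Rep_ell2 x i" "Rep_ell2 y i"]
        unfolding power2_diff by linarith
      finally show ?thesis .
    qed
  qed simp
  then show ?thesis
    by (rule summable_on_iff_abs_summable_on_real[THEN iffD2, unfolded real_norm_def])
qed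

instantiation ell2 :: (type) real_vector
begin

definition "0 = Abs_ell2 (\<lambda>_. 0)"
definition "x + y = Abs_ell2 (\<lambda>i. Rep_ell2 x i + Rep_ell2 y i)"
definition "- x = cscale (- 1) x" for x :: "'a ell2"
definition "x - y = Abs_ell2 (\<lambda>i. Rep_ell2 x i + Rep_ell2 (cscale (- 1) y) i)"
definition "scaleR r x = cscale (complex_of_real r) x" for x :: "'a ell2"

lemma Rep_ell2_simps [simp]:
  "Rep_ell2 0 i = 0"
  "Rep_ell2 (x + y) i = Rep_ell2 x i + Rep_ell2 y i"
  "Rep_ell2 (- x) i = - Rep_ell2 x i"
  "Rep_ell2 (x - y) i = Rep_ell2 x i - Rep_ell2 y i"
  "Rep_ell2 (scaleR r x) i = complex_of_real r * Rep_ell2 x i"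
  "Rep_ell2 (cscale c x) i = c * Rep_ell2 x i"
proof -
  have add: "Rep_ell2 (Abs_ell2 (\<lambda>i. Rep_ell2 x i + Rep_ell2 y i)) i = Rep_ell2 x i + Rep_ell2 y i"
    for x y :: "'a ell2"
    by (simp only: Rep_Abs_ell2[OF square_summable_add[OF ell2_summable ell2_summable]])
  show "Rep_ell2 (x + y) i = Rep_ell2 x i + Rep_ell2 y i" unfolding plus_ell2_def by (rule add)
  show "Rep_ell2 (x - y) i = Rep_ell2 x i - Rep_ell2 y i"
    unfolding minus_ell2_def add by (simp add: Rep_cscale)
  show "Rep_ell2 0 i = 0" by (simp add: zero_ell2_def Rep_Abs_ell2)
qed (simp_all add: scaleR_ell2_def uminus_ell2_def Rep_cscale)

instance
  by (standard; rule ell2_eqI; simp add: algebra_simps)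

end

instantiation ell2 :: (type) real_inner
begin

text \<open>The real part of the complex inner product, to fit the real type classes; complex
  scalars are carried by \<open>cscale\<close>.\<close>

definition "inner x y = (\<Sum>\<^sub>\<infinity>i. Re (Rep_ell2 x i * cnj (Rep_ell2 y i)))"
definition "norm x = sqrt (inner x x)" for x :: "'a ell2"
definition "dist x y = norm (x - y)" for x y :: "'a ell2"
definition "sgn x = x /\<^sub>R norm x" for x :: "'a ell2"
definition "(uniformity :: ('a ell2 \<times> 'a ell2) filter) = (INF e\<in>{0<..}. principal {(x, y). dist x y < e})"
definition "open U = (\<forall>x\<in>U. eventually (\<lambda>(x', y). x' = x \<longrightarrow> y \<in> U) uniformity)" for U :: "'a ell2 set"

instance
proof
  fix x y z :: "'a ell2" and a :: real
  show "dist x y = norm (x - y)" "sgn x = x /\<^sub>R norm x" "norm x = sqrt (inner x x)"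
    by (simp_all add: dist_ell2_def sgn_ell2_def norm_ell2_def)
  show "(uniformity :: ('a ell2 \<times> 'a ell2) filter) = (INF e\<in>{0<..}. principal {(x, y). dist x y < e})"
    by (rule uniformity_ell2_def)
  show "open U = (\<forall>x\<in>U. eventually (\<lambda>(x', y). x' = x \<longrightarrow> y \<in> U) uniformity)" for U :: "'a ell2 set"
    by (rule open_ell2_def)
  show "inner x y = inner y x"
    unfolding inner_ell2_def by (rule infsum_cong) (simp add: mult.commute)
  show "inner (x + y) z = inner x z + inner y z"
  proof -
    have "inner (x + y) z = (\<Sum>\<^sub>\<infinity>i. Re (Rep_ell2 x i * cnj (Rep_ell2 z i)) + Re (Rep_ell2 y i * cnj (Rep_ell2 z i)))"
      unfolding inner_ell2_def by (rule infsum_cong) (simp add: algebra_simps)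
    then show ?thesis
      unfolding inner_ell2_def by (simp only: infsum_add[OF ell2_product_summable ell2_product_summable])
  qed
  show "inner (a *\<^sub>R x) y = a * inner x y"
    unfolding inner_ell2_def
    by (subst infsum_cmult_right'[symmetric]) (auto intro!: infsum_cong simp: algebra_simps)
  have sq: "Re (Rep_ell2 x i * cnj (Rep_ell2 x i)) = (cmod (Rep_ell2 x i))\<^sup>2" for i
    by (simp add: complex_mult_cnj cmod_def power2_eq_square)
  show "0 \<le> inner x x"
    unfolding inner_ell2_def sq by (rule infsum_nonneg) simp
  show "inner x x = 0 \<longleftrightarrow> x = 0"
  proof
    assume 0: "inner x x = 0"
    have "(cmod (Rep_ell2 x i))\<^sup>2 = 0" for i
      using 0 unfolding inner_ell2_def sq
      by (rule nonneg_infsum_le_0D[OF eq_refl _ ]) (auto intro: ell2_summable)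
    then show "x = 0" by (auto intro!: ell2_eqI)
  qed (simp add: inner_ell2_def)
qed

end

lemma ell2_norm_square: "(norm x)\<^sup>2 = (\<Sum>\<^sub>\<infinity>i. (cmod (Rep_ell2 x i))\<^sup>2)"
proof -
  have "Re (Rep_ell2 x i * cnj (Rep_ell2 x i)) = (cmod (Rep_ell2 x i))\<^sup>2" for i
    by (simp add: complex_mult_cnj cmod_def power2_eq_square)
  then show ?thesis
    unfolding power2_norm_eq_inner by (simp add: inner_ell2_def)
qed

lemma ell2_finite_sum_le:
  assumes "finite F"
  shows "(\<Sum>i\<in>F. (cmod (Rep_ell2 x i))\<^sup>2) \<le> (norm x)\<^sup>2"
  unfolding ell2_norm_square using assms by (intro finite_sum_le_infsum ell2_summable) auto

lemma ell2_normI: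
  assumes "\<And>F. finite F \<Longrightarrow> (\<Sum>i\<in>F. (cmod (f i))\<^sup>2) \<le> r\<^sup>2" "0 \<le> r"
  shows "(\<lambda>i. (cmod (f i))\<^sup>2) summable_on UNIV" "norm (Abs_ell2 f) \<le> r"
proof -
  show 1: "(\<lambda>i. (cmod (f i))\<^sup>2) summable_on UNIV"
    by (rule nonneg_bdd_above_summable_on) (auto intro!: bdd_aboveI2[where M = "r\<^sup>2"] assms(1))
  have "(norm (Abs_ell2 f))\<^sup>2 \<le> r\<^sup>2"
    unfolding ell2_norm_square Rep_Abs_ell2[OF 1]
    by (rule infsum_le_finite_sums[OF 1]) (use assms(1) in auto)
  then show "norm (Abs_ell2 f) \<le> r" using assms(2) by (rule power2_le_imp_le)
qed

lemma ell2_component_le: "cmod (Rep_ell2 x i) \<le> norm x"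
  using ell2_finite_sum_le[of "{i}" x] by (auto intro: power2_le_imp_le)

instance ell2 :: (type) banach
proof
  fix X :: "nat \<Rightarrow> 'a ell2" assume X: "Cauchy X"
  have "Cauchy (\<lambda>n. Rep_ell2 (X n) i)" for i
  proof (rule metric_CauchyI)
    fix e :: real assume "e > 0"
    then obtain N where "\<forall>m\<ge>N. \<forall>n\<ge>N. norm (X m - X n) < e"
      using X unfolding Cauchy_iff by blast
    moreover have "dist (Rep_ell2 (X m) i) (Rep_ell2 (X n) i) \<le> norm (X m - X n)" for m n
      using ell2_component_le[of "X m - X n" i] by (simp add: dist_norm)
    ultimately show "\<exists>M. \<forall>m\<ge>M. \<forall>n\<ge>M. dist (Rep_ell2 (X m) i) (Rep_ell2 (X n) i) < e"
      by (meson le_less_trans)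
  qed
  then obtain g where g: "\<And>i. (\<lambda>n. Rep_ell2 (X n) i) \<longlonglongrightarrow> g i"
    unfolding Cauchy_convergent_iff convergent_def by metis
  \<comment> \<open>Finite partial sums for the coordinatewise limit inherit the Cauchy bound; this
    gives both square summability and convergence in norm.\<close>
  have tail: "(\<Sum>i\<in>F. (cmod (g i - Rep_ell2 (X n) i))\<^sup>2) \<le> e\<^sup>2"
    if e: "e > 0" "\<And>m. m \<ge> N \<Longrightarrow> norm (X m - X n) < e" and F: "finite F" for e N n F
  proof (rule tendsto_upperbound)
    show "(\<lambda>m. \<Sum>i\<in>F. (cmod (Rep_ell2 (X m) i - Rep_ell2 (X n) i))\<^sup>2)
        \<longlonglongrightarrow> (\<Sum>i\<in>F. (cmod (g i - Rep_ell2 (X n) i))\<^sup>2)"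
      by (intro tendsto_intros g)
    have "(\<Sum>i\<in>F. (cmod (Rep_ell2 (X m) i - Rep_ell2 (X n) i))\<^sup>2) \<le> e\<^sup>2" if "m \<ge> N" for m
    proof -
      have "(\<Sum>i\<in>F. (cmod (Rep_ell2 (X m - X n) i))\<^sup>2) \<le> (norm (X m - X n))\<^sup>2"
        by (rule ell2_finite_sum_le[OF F])
      also have "\<dots> \<le> e\<^sup>2" using e(2)[OF that] by (intro power_mono) auto
      finally show ?thesis by simp
    qed
    then show "\<forall>\<^sub>F m in sequentially. (\<Sum>i\<in>F. (cmod (Rep_ell2 (X m) i - Rep_ell2 (X n) i))\<^sup>2) \<le> e\<^sup>2"
      by (auto simp: eventually_sequentially)
  qed simp
  obtain N1 where "\<And>m n. m \<ge> N1 \<Longrightarrow> n \<ge> N1 \<Longrightarrow> norm (X m - X n) < 1"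
    using X unfolding Cauchy_iff by (meson zero_less_one)
  then have "(\<lambda>i. (cmod (g i - Rep_ell2 (X N1) i))\<^sup>2) summable_on UNIV"
    using ell2_normI(1)[OF tail[of 1 N1 N1]] by simp
  from square_summable_add[OF this ell2_summable[of "X N1"]]
  have gs: "(\<lambda>i. (cmod (g i))\<^sup>2) summable_on UNIV" by simp
  have "X \<longlonglongrightarrow> Abs_ell2 g"
    unfolding LIMSEQ_iff
  proof (intro allI impI)
    fix r :: real assume "r > 0"
    then have "r / 2 > 0" by simp
    then obtain N where N: "\<And>m n. m \<ge> N \<Longrightarrow> n \<ge> N \<Longrightarrow> norm (X m - X n) < r / 2"
      using X unfolding Cauchy_iff by meson
    have "norm (X n - Abs_ell2 g) < r" if "n \<ge> N" for n
    proof -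
      have "Abs_ell2 g - X n = Abs_ell2 (\<lambda>i. g i - Rep_ell2 (X n) i)"
      proof (rule ell2_eqI)
        fix i
        have "(\<lambda>i. (cmod (g i - Rep_ell2 (X n) i))\<^sup>2) summable_on UNIV"
          using ell2_normI(1)[OF tail[OF \<open>r / 2 > 0\<close> N[OF _ that]]] \<open>r > 0\<close> by simp
        then show "Rep_ell2 (Abs_ell2 g - X n) i = Rep_ell2 (Abs_ell2 (\<lambda>i. g i - Rep_ell2 (X n) i)) i"
          by (simp add: Rep_Abs_ell2 gs)
      qed
      then have "norm (Abs_ell2 g - X n) \<le> r / 2"
        using ell2_normI(2)[OF tail[OF \<open>r / 2 > 0\<close> N[OF _ that]]] \<open>r > 0\<close> by simp
      then show ?thesis using \<open>r > 0\<close> by (simp add: norm_minus_commute)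
    qed
    then show "\<exists>no. \<forall>n\<ge>no. norm (X n - Abs_ell2 g) < r" by blast
  qed
  then show "convergent X" by (rule convergentI)
qed

lemma norm_cscale: "norm (cscale c x) = cmod c * norm x"
proof -
  have "(norm (cscale c x))\<^sup>2 = (\<Sum>\<^sub>\<infinity>i. (cmod c)\<^sup>2 * (cmod (Rep_ell2 x i))\<^sup>2)"
    unfolding ell2_norm_square by (rule infsum_cong) (simp add: norm_mult power_mult_distrib)
  also have "\<dots> = (cmod c * norm x)\<^sup>2"
    by (simp only: infsum_cmult_right' ell2_norm_square power_mult_distrib)
  finally show ?thesis by (rule power2_eq_imp_eq) simp_all
qed

lemma cscale_simps:
  "cscale c (x + y) = cscale c x + cscale c y" "cscale c (r *\<^sub>R x) = r *\<^sub>R cscale c x"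
  "cscale (c + d) x = cscale c x + cscale d x" "cscale c (cscale d x) = cscale (c * d) x" "cscale 1 x = x"
  by (rule ell2_eqI, simp add: algebra_simps)+

lemma inner_cscale: "inner (cscale c x) y = inner x (cscale (cnj c) y)"
  unfolding inner_ell2_def by (rule infsum_cong) (simp add: algebra_simps)

lemma bounded_linear_cscale: "bounded_linear (cscale c)"
  by (rule bounded_linear_intro[of _ "cmod c"]) (simp_all add: cscale_simps norm_cscale)

section \<open>The C*-algebra of operators with an adjoint\<close>

definition cscale_op :: "complex \<Rightarrow> 'i ell2 \<Rightarrow>\<^sub>L 'i ell2" where
  "cscale_op c = Blinfun (cscale c)"

lemma cscale_op_apply [simp]: "blinfun_apply (cscale_op c) x = cscale c x"
  unfolding cscale_op_def by (simp add: bounded_linear_Blinfun_apply bounded_linear_cscale)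

text \<open>Adjoints for the real inner product. For a complex linear T this is the complex adjoint
  as well, because \<open>cscale\<close> crosses \<open>inner\<close> with a conjugate.\<close>

definition is_adj :: "('i ell2 \<Rightarrow>\<^sub>L 'i ell2) \<Rightarrow> ('i ell2 \<Rightarrow>\<^sub>L 'i ell2) \<Rightarrow> bool" where
  "is_adj T U \<longleftrightarrow> (\<forall>x y. inner (T x) y = inner x (U y))"

definition op_carrier :: "('i ell2 \<Rightarrow>\<^sub>L 'i ell2) set" where
  "op_carrier = {T. (\<forall>c x. blinfun_apply T (cscale c x) = cscale c (blinfun_apply T x)) \<and> (\<exists>U. is_adj T U)}"

text \<open>The bounded operators on \<open>\<ell>\<^sup>2\<close>. By the Riesz representation theorem adjoints always exist, but
  restricting to operators that have one makes that theorem unnecessary.\<close>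

definition op_algebra :: "('i ell2 \<Rightarrow>\<^sub>L 'i ell2) cstar" where
  "op_algebra = \<lparr>carrier = op_carrier, monoid.mult = (o\<^sub>L), one = id_blinfun, zero = 0, add = (+),
    module.smult = \<lambda>c T. cscale_op c o\<^sub>L T, star = \<lambda>T. SOME U. is_adj T U, nrm = norm\<rparr>"

lemma is_adj_unique: "is_adj T U \<Longrightarrow> is_adj T V \<Longrightarrow> U = V"
  unfolding is_adj_def by (intro blinfun_eqI) (metis vector_eq_rdot inner_commute)

lemma is_adj_sym: "is_adj T U \<Longrightarrow> is_adj U T"
  unfolding is_adj_def by (metis inner_commute)

lemma is_adj_add: "is_adj T U \<Longrightarrow> is_adj T' U' \<Longrightarrow> is_adj (T + T') (U + U')"
  by (simp add: is_adj_def blinfun.add_left inner_add_left inner_add_right)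

lemma is_adj_compose: "is_adj T U \<Longrightarrow> is_adj T' U' \<Longrightarrow> is_adj (T o\<^sub>L T') (U' o\<^sub>L U)"
  by (simp add: is_adj_def)

lemma is_adj_cscale: "is_adj (cscale_op c) (cscale_op (cnj c))"
  by (simp add: is_adj_def inner_cscale)

lemma is_adj_carrier:
  assumes "T \<in> op_carrier" "is_adj T U"
  shows "U \<in> op_carrier"
proof -
  have adj: "inner (T x) y = inner x (U y)" for x y using assms(2) by (simp add: is_adj_def)
  have T: "T (cscale c x) = cscale c (T x)" for c x using assms(1) by (simp add: op_carrier_def)
  have "inner x (U (cscale c y)) = inner x (cscale c (U y))" for x y c
  proof -
    have "inner x (U (cscale c y)) = inner (cscale (cnj c) (T x)) y"
      by (simp add: adj[symmetric] inner_cscale)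
    also have "\<dots> = inner x (cscale c (U y))"
      by (simp add: T[symmetric] adj inner_cscale)
    finally show ?thesis .
  qed
  then have "U (cscale c y) = cscale c (U y)" for c y
    by (metis vector_eq_rdot inner_commute)
  then show ?thesis using is_adj_sym[OF assms(2)] by (auto simp: op_carrier_def)
qed

text \<open>By Cauchy-Schwarz, the square of the norm of T x is at most the norm of U T times the
  square of the norm of x. This is one half of the C*-identity; by symmetry it also makes the norms
  of T and U equal.\<close>

lemma is_adj_norm:
  assumes "is_adj T U"
  shows "norm T \<le> norm U" "(norm T)\<^sup>2 \<le> norm (U o\<^sub>L T)"
proof -
  have n: "(norm (T x))\<^sup>2 \<le> norm (U o\<^sub>L T) * (norm x)\<^sup>2" for x
  proof -
    have "(norm (T x))\<^sup>2 = inner x ((U o\<^sub>L T) x)"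
      using assms unfolding is_adj_def power2_norm_eq_inner by simp
    also have "\<dots> \<le> norm x * norm ((U o\<^sub>L T) x)" by (rule norm_cauchy_schwarz)
    also have "\<dots> \<le> norm x * (norm (U o\<^sub>L T) * norm x)"
      by (intro mult_left_mono norm_blinfun) simp
    finally show ?thesis by (simp add: power2_eq_square mult_ac)
  qed
  have "norm T \<le> sqrt (norm (U o\<^sub>L T))"
  proof (rule norm_blinfun_bound)
    fix x
    show "norm (T x) \<le> sqrt (norm (U o\<^sub>L T)) * norm x"
      by (rule power2_le_imp_le) (use n[of x] in \<open>simp_all add: power_mult_distrib\<close>)
  qed simp
  then show 2: "(norm T)\<^sup>2 \<le> norm (U o\<^sub>L T)"
    by (metis norm_ge_zero real_sqrt_pow2 power_mono)
  have "norm T * norm T \<le> norm U * norm T"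
    using 2 norm_blinfun_compose[of U T] by (simp add: power2_eq_square)
  then show "norm T \<le> norm U" by (cases "norm T = 0") auto
qed

lemma op_algebra_simps:
  "carrier op_algebra = op_carrier" "x \<otimes>\<^bsub>op_algebra\<^esub> y = x o\<^sub>L y" "\<zero>\<^bsub>op_algebra\<^esub> = 0"
  "x \<oplus>\<^bsub>op_algebra\<^esub> y = x + y" "c \<odot>\<^bsub>op_algebra\<^esub> y = cscale_op c o\<^sub>L y" "nrm op_algebra x = norm x"
  by (simp_all add: op_algebra_def)

lemma op_star: "is_adj T U \<Longrightarrow> star op_algebra T = U"
  unfolding op_algebra_def by (simp, rule some_equality) (auto intro: is_adj_unique)

lemma op_carrier_adj:
  assumes "T \<in> op_carrier"
  obtains U where "is_adj T U" "star op_algebra T = U" "U \<in> op_carrier"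
  using assms is_adj_carrier op_star unfolding op_carrier_def by blast

lemma op_carrier_closed:
  assumes "T \<in> op_carrier" "U \<in> op_carrier"
  shows "T + U \<in> op_carrier" "T o\<^sub>L U \<in> op_carrier"
proof -
  show "T + U \<in> op_carrier"
    using assms unfolding op_carrier_def by (auto simp: blinfun.add_left cscale_simps intro: is_adj_add)
  show "T o\<^sub>L U \<in> op_carrier"
    using assms unfolding op_carrier_def by (auto intro: is_adj_compose)
qed

lemma op_carrier_consts: "cscale_op c \<in> op_carrier" "(0 :: 'i ell2 \<Rightarrow>\<^sub>L 'i ell2) \<in> op_carrier"
proof -
  show "cscale_op c \<in> op_carrier"
    unfolding op_carrier_def by (auto simp: cscale_simps mult.commute intro: is_adj_cscale)
  have "cscale a 0 = (0 :: 'i ell2)" for a by (rule ell2_eqI) simp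
  moreover have "is_adj (0 :: 'i ell2 \<Rightarrow>\<^sub>L 'i ell2) 0" by (simp add: is_adj_def)
  ultimately show "(0 :: 'i ell2 \<Rightarrow>\<^sub>L 'i ell2) \<in> op_carrier"
    unfolding op_carrier_def by auto
qed

lemma norm_cscale_op_compose: "norm (cscale_op c o\<^sub>L T) = cmod c * norm T"
proof (rule antisym)
  have le: "norm (cscale_op d o\<^sub>L U) \<le> cmod d * norm U" for d U
  proof (rule norm_blinfun_bound)
    show "norm ((cscale_op d o\<^sub>L U) x) \<le> cmod d * norm U * norm x" for x
      using norm_blinfun[of U x] by (simp add: norm_cscale mult.assoc mult_left_mono)
  qed simp
  then show "norm (cscale_op c o\<^sub>L T) \<le> cmod c * norm T" .
  show "cmod c * norm T \<le> norm (cscale_op c o\<^sub>L T)"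
  proof (cases "c = 0")
    case False
    have "cscale_op (1 / c) o\<^sub>L (cscale_op c o\<^sub>L T) = T"
      using False by (intro blinfun_eqI) (simp add: cscale_simps)
    then have "norm T \<le> cmod (1 / c) * norm (cscale_op c o\<^sub>L T)" using le[of "1 / c"] by metis
    then show ?thesis using False by (simp add: norm_divide field_simps)
  qed simp
qed

lemma op_algebra_cstar: "cstar_algebra (op_algebra :: ('i ell2 \<Rightarrow>\<^sub>L 'i ell2) cstar)"
proof -
  let ?A = "op_algebra :: ('i ell2 \<Rightarrow>\<^sub>L 'i ell2) cstar"
  note simps = op_algebra_simps op_carrier_closed op_carrier_consts
  have uminus: "- x = cscale_op (-1) o\<^sub>L x" for x :: "'i ell2 \<Rightarrow>\<^sub>L 'i ell2"
    by (rule blinfun_eqI, rule ell2_eqI) (simp add: blinfun.minus_left)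
  have mc: "- x \<in> op_carrier" if "x \<in> op_carrier" for x :: "'i ell2 \<Rightarrow>\<^sub>L 'i ell2"
    unfolding uminus using that by (intro op_carrier_closed op_carrier_consts)
  interpret abelian_group ?A
    by (rule abelian_groupI) (auto simp: simps intro!: bexI[of _ "- x" for x] mc)
  have "Module.module complex_ring ?A"
    by (rule moduleI[OF cring_complex_ring abelian_group_axioms])
      (auto simp: simps complex_ring_def blinfun.add_left blinfun.add_right cscale_simps intro!: blinfun_eqI)
  have neg: "\<ominus>\<^bsub>?A\<^esub> x = - x" if "x \<in> op_carrier" for x
    by (rule minus_equality) (use that mc in \<open>auto simp: simps\<close>)
  have minus: "x \<ominus>\<^bsub>?A\<^esub> y = x - y" if "x \<in> op_carrier" "y \<in> op_carrier" for x y
    using that by (simp add: a_minus_def neg simps)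
  have dc: "x - y \<in> op_carrier" if "x \<in> op_carrier" "y \<in> op_carrier" for x y :: "'i ell2 \<Rightarrow>\<^sub>L 'i ell2"
    using op_carrier_closed(1)[OF that(1) mc[OF that(2)]] by simp
  have dist: "cdist ?A x y = dist x y" if "x \<in> op_carrier" "y \<in> op_carrier" for x y
    using that by (simp add: cdist_def minus simps dist_norm)
  interpret M: Metric_space "carrier ?A" "cdist ?A"
  proof
    show "0 \<le> cdist ?A x y" for x y by (simp add: cdist_def simps)
    show "cdist ?A x y = cdist ?A y x" for x y
      by (auto simp: cdist_def simps minus norm_minus_commute)
    show "cdist ?A x y = 0 \<longleftrightarrow> x = y" if "x \<in> carrier ?A" "y \<in> carrier ?A" for x y
      using that by (simp add: simps dist)
    show "cdist ?A x z \<le> cdist ?A x y + cdist ?A y z"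
      if "x \<in> carrier ?A" "y \<in> carrier ?A" "z \<in> carrier ?A" for x y z
      using that by (simp add: simps dist dist_triangle)
  qed
  have complete: "M.mcomplete"
    unfolding M.mcomplete_def
  proof (intro allI impI)
    fix \<sigma> assume \<sigma>: "M.MCauchy \<sigma>"
    then have \<sigma>c: "\<sigma> n \<in> op_carrier" for n unfolding M.MCauchy_def by (auto simp: op_algebra_simps)
    then have "Cauchy \<sigma>"
      using \<sigma> unfolding M.MCauchy_def Cauchy_def by (simp add: dist)
    then obtain T where T: "\<sigma> \<longlonglongrightarrow> T" by (metis Cauchy_convergent_iff convergent_def)
    have "\<exists>U. is_adj (\<sigma> n) U" for n using \<sigma>c by (auto simp: op_carrier_def)
    then obtain \<tau> where \<tau>: "\<And>n. is_adj (\<sigma> n) (\<tau> n)" by metis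
    \<comment> \<open>Taking adjoints preserves norms, so the adjoints converge as well; their limit
      is an adjoint of T, and T stays in the carrier.\<close>
    have "Cauchy \<tau>"
      unfolding Cauchy_def
    proof (intro allI impI)
      fix e :: real assume "e > 0"
      then obtain N where N: "\<And>m n. m \<ge> N \<Longrightarrow> n \<ge> N \<Longrightarrow> dist (\<sigma> m) (\<sigma> n) < e"
        using \<open>Cauchy \<sigma>\<close> unfolding Cauchy_def by metis
      have "is_adj (\<tau> m - \<tau> n) (\<sigma> m - \<sigma> n)" for m n
        using is_adj_sym[OF \<tau>[of m]] is_adj_sym[OF \<tau>[of n]]
        by (simp add: is_adj_def blinfun.diff_left inner_diff_left inner_diff_right)
      then have "dist (\<tau> m) (\<tau> n) \<le> dist (\<sigma> m) (\<sigma> n)" for m n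
        unfolding dist_norm by (rule is_adj_norm(1))
      then show "\<exists>M. \<forall>m\<ge>M. \<forall>n\<ge>M. dist (\<tau> m) (\<tau> n) < e"
        using N by (meson le_less_trans)
    qed
    then obtain U where U: "\<tau> \<longlonglongrightarrow> U" by (metis Cauchy_convergent_iff convergent_def)
    have T': "(\<lambda>n. \<sigma> n x) \<longlonglongrightarrow> T x" for x using T by (intro tendsto_intros)
    have U': "(\<lambda>n. \<tau> n x) \<longlonglongrightarrow> U x" for x using U by (intro tendsto_intros)
    have "is_adj T U"
      unfolding is_adj_def
    proof (intro allI)
      fix x y
      have "(\<lambda>n. inner (\<sigma> n x) y) \<longlonglongrightarrow> inner (T x) y" by (intro tendsto_intros T')
      moreover have "(\<lambda>n. inner (\<sigma> n x) y) \<longlonglongrightarrow> inner x (U y)"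
        using \<tau> unfolding is_adj_def by simp (intro tendsto_intros U')
      ultimately show "inner (T x) y = inner x (U y)" by (rule LIMSEQ_unique)
    qed
    moreover have "T (cscale c x) = cscale c (T x)" for c x
    proof -
      have "(\<lambda>n. \<sigma> n (cscale c x)) \<longlonglongrightarrow> cscale c (T x)"
        using bounded_linear.tendsto[OF bounded_linear_cscale T'] \<sigma>c by (simp add: op_carrier_def)
      then show ?thesis using T'[of "cscale c x"] LIMSEQ_unique by blast
    qed
    ultimately have Tc: "T \<in> op_carrier" by (auto simp: op_carrier_def)
    have "limitin M.mtopology \<sigma> T sequentially"
      unfolding M.limit_metric_sequentially
      using T \<sigma>c Tc by (simp add: simps dist LIMSEQ_def)
    then show "\<exists>x. limitin M.mtopology \<sigma> x sequentially" ..
  qed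
  have st: "\<exists>U. is_adj x U \<and> star ?A x = U \<and> U \<in> op_carrier" if "x \<in> op_carrier" for x :: "'i ell2 \<Rightarrow>\<^sub>L 'i ell2"
    using op_carrier_adj[OF that] by metis
  show ?thesis
  proof (intro cstar_algebra.intro cstar_algebra_axioms.intro)
    show "Module.module complex_ring ?A" by fact
    show "M.mcomplete" by (rule complete)
    fix x assume "x \<in> carrier ?A"
    then have x: "x \<in> op_carrier" by (simp add: simps)
    obtain U where U: "is_adj x U" "star ?A x = U" "U \<in> op_carrier" using st[OF x] by blast
    show "star ?A x \<in> carrier ?A" using U by (simp add: simps)
    show "star ?A (star ?A x) = x" using U op_star[OF is_adj_sym[OF U(1)]] by simp
    show "star ?A (c \<odot>\<^bsub>?A\<^esub> x) = cnj c \<odot>\<^bsub>?A\<^esub> star ?A x" for c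
    proof -
      have "U o\<^sub>L cscale_op (cnj c) = cscale_op (cnj c) o\<^sub>L U"
        using U(3) by (intro blinfun_eqI) (simp add: op_carrier_def)
      then show ?thesis
        using op_star[OF is_adj_compose[OF is_adj_cscale U(1)], of c] U(2) by (simp add: simps)
    qed
    show "nrm ?A (star ?A x \<otimes>\<^bsub>?A\<^esub> x) = (nrm ?A x)\<^sup>2"
    proof -
      have "norm (U o\<^sub>L x) \<le> norm x * norm x"
        using norm_blinfun_compose[of U x] mult_right_mono[OF is_adj_norm(1)[OF is_adj_sym[OF U(1)]], of "norm x"]
        by simp
      then show ?thesis
        using is_adj_norm(2)[OF U(1)] U(2) by (simp add: simps power2_eq_square)
    qed
    show "nrm ?A (c \<odot>\<^bsub>?A\<^esub> x) = cmod c * nrm ?A x" for c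
      by (simp add: simps norm_cscale_op_compose)
    fix y assume "y \<in> carrier ?A"
    then have y: "y \<in> op_carrier" by (simp add: simps)
    obtain V where V: "is_adj y V" "star ?A y = V" "V \<in> op_carrier" using st[OF y] by blast
    show "star ?A (x \<oplus>\<^bsub>?A\<^esub> y) = star ?A x \<oplus>\<^bsub>?A\<^esub> star ?A y"
      using op_star[OF is_adj_add[OF U(1) V(1)]] U(2) V(2) by (simp add: simps)
    show "star ?A (x \<otimes>\<^bsub>?A\<^esub> y) = star ?A y \<otimes>\<^bsub>?A\<^esub> star ?A x"
      using op_star[OF is_adj_compose[OF U(1) V(1)]] U(2) V(2) by (simp add: simps)
    show "x \<otimes>\<^bsub>?A\<^esub> (c \<odot>\<^bsub>?A\<^esub> y) = c \<odot>\<^bsub>?A\<^esub> (x \<otimes>\<^bsub>?A\<^esub> y)" for c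
      using x by (intro blinfun_eqI) (simp add: simps op_carrier_def)
  qed (auto simp: simps norm_triangle_ineq norm_blinfun_compose blinfun.add_left blinfun.add_right intro!: blinfun_eqI)
qed

section \<open>Boundary paths\<close>

text \<open>These are the characters, that is the homomorphisms to the two-element algebra; the zero
  character is the empty filter.\<close>

definition prime_filter :: "'b::generalized_boolean_algebra set \<Rightarrow> bool" where
  "prime_filter \<xi> \<longleftrightarrow> bot \<notin> \<xi> \<and> (\<forall>A B. inf A B \<in> \<xi> \<longleftrightarrow> A \<in> \<xi> \<and> B \<in> \<xi>) \<and>
    (\<forall>A B. sup A B \<in> \<xi> \<longleftrightarrow> A \<in> \<xi> \<or> B \<in> \<xi>)"

lemma prime_filterD:
  assumes "prime_filter \<xi>"
  shows "bot \<notin> \<xi>" "inf A B \<in> \<xi> \<longleftrightarrow> A \<in> \<xi> \<and> B \<in> \<xi>" "sup A B \<in> \<xi> \<longleftrightarrow> A \<in> \<xi> \<or> B \<in> \<xi>"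
  using assms unfolding prime_filter_def by blast+

lemma prime_filter_diff:
  assumes "prime_filter \<xi>" "A \<in> \<xi>" "B \<notin> \<xi>"
  shows "A - B \<in> \<xi>"
  using prime_filterD(2,3)[OF assms(1)] sup_inf_diff[of A B] assms(2,3) by metis

text \<open>A maximal proper filter above G, from Zorn's lemma, is prime: an element outside it is
  disjoint from some member, and if this happens for A and for B, the meet of the two members is
  disjoint from the join of A and B.\<close>

lemma prime_filter_extension:
  fixes G :: "'b::generalized_boolean_algebra set"
  assumes G: "bot \<notin> G" "\<And>A B. \<lbrakk>A \<in> G; B \<in> G\<rbrakk> \<Longrightarrow> inf A B \<in> G" "G \<noteq> {}"
  shows "\<exists>\<xi>. prime_filter \<xi> \<and> G \<subseteq> \<xi>"
proof -
  define \<F> where "\<F> = {F. G \<subseteq> F \<and> bot \<notin> F \<and> (\<forall>A\<in>F. \<forall>B\<in>F. inf A B \<in> F) \<and> (\<forall>A\<in>F. \<forall>B. A \<le> B \<longrightarrow> B \<in> F)}"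
  have FD: "G \<subseteq> F" "bot \<notin> F" "\<lbrakk>A \<in> F; B \<in> F\<rbrakk> \<Longrightarrow> inf A B \<in> F" "\<lbrakk>A \<in> F; A \<le> B\<rbrakk> \<Longrightarrow> B \<in> F"
    if "F \<in> \<F>" for F A B
    using that unfolding \<F>_def mem_Collect_eq by (simp, simp, simp, metis)
  define up where "up H = {B :: 'b. \<exists>A\<in>H. A \<le> B}" for H
  have up: "up H \<in> \<F>" if H: "G \<subseteq> up H" "bot \<notin> H" "\<And>A B. \<lbrakk>A \<in> H; B \<in> H\<rbrakk> \<Longrightarrow> inf A B \<in> H" for H
  proof -
    have "bot \<notin> up H" using H(2) by (auto simp: up_def bot_unique)
    moreover have "inf A B \<in> up H" if AB: "A \<in> up H" "B \<in> up H" for A B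
    proof -
      obtain A' B' where "A' \<in> H" "B' \<in> H" "A' \<le> A" "B' \<le> B" using AB by (auto simp: up_def)
      then show ?thesis using H(3)[of A' B'] inf_mono[of A' A B' B] by (auto simp: up_def)
    qed
    moreover have "B \<in> up H" if "A \<in> up H" "A \<le> B" for A B
      using that order_trans by (auto simp: up_def)
    ultimately show ?thesis using H(1) by (auto simp: \<F>_def)
  qed
  have subset_up: "H \<subseteq> up H" for H by (auto simp: up_def)
  have "\<F> \<noteq> {}" using up[OF subset_up G(1,2)] by auto
  moreover have "\<Union>K \<in> \<F>" if K: "K \<noteq> {}" "subset.chain \<F> K" for K
  proof -
    have KF: "F \<in> \<F>" if "F \<in> K" for F using K(2) that by (auto simp: subset.chain_def)
    have inf: "inf A B \<in> \<Union>K" if "A \<in> F" "F \<in> K" "B \<in> H" "H \<in> K" for A B F H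
    proof -
      have "F \<subseteq> H \<or> H \<subseteq> F" using K(2) that by (auto simp: subset.chain_def)
      then show ?thesis
      proof
        assume "F \<subseteq> H"
        then have "inf A B \<in> H" using that by (intro FD(3)[OF KF]) auto
        then show ?thesis using that by auto
      next
        assume "H \<subseteq> F"
        then have "inf A B \<in> F" using that by (intro FD(3)[OF KF]) auto
        then show ?thesis using that by auto
      qed
    qed
    show ?thesis
      unfolding \<F>_def
    proof (intro CollectI conjI ballI allI impI)
      obtain F where "F \<in> K" using K(1) by auto
      then show "G \<subseteq> \<Union>K" using FD(1)[OF KF] by auto
      show "bot \<notin> \<Union>K" using FD(2)[OF KF] by auto
      show "inf A B \<in> \<Union>K" if "A \<in> \<Union>K" "B \<in> \<Union>K" for A B using inf that by auto
      show "B \<in> \<Union>K" if AB: "A \<in> \<Union>K" "A \<le> B" for A B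
      proof -
        obtain F where "F \<in> K" "A \<in> F" using AB(1) by auto
        then have "B \<in> F" using FD(4)[OF KF] AB(2) by metis
        then show ?thesis using \<open>F \<in> K\<close> by auto
      qed
    qed
  qed
  ultimately obtain F where F: "F \<in> \<F>" "\<And>H. \<lbrakk>H \<in> \<F>; F \<subseteq> H\<rbrakk> \<Longrightarrow> H = F"
    using subset_Zorn_nonempty[of \<F>] by blast
  have F': "G \<subseteq> F" "bot \<notin> F" "\<And>A B. \<lbrakk>A \<in> F; B \<in> F\<rbrakk> \<Longrightarrow> inf A B \<in> F" "\<And>A B. \<lbrakk>A \<in> F; A \<le> B\<rbrakk> \<Longrightarrow> B \<in> F"
    using FD[OF F(1)] by simp_all
  \<comment> \<open>Otherwise the filter generated by F and A would be proper and strictly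
    larger.\<close>
  have out: "\<exists>f\<in>F. inf f A = bot" if "A \<notin> F" for A
  proof (rule ccontr)
    assume nb: "\<not> (\<exists>f\<in>F. inf f A = bot)"
    define H where "H = (\<lambda>f. inf f A) ` F"
    have FH: "F \<subseteq> up H"
    proof
      fix f assume "f \<in> F"
      then have "inf f A \<in> H" by (simp add: H_def)
      then show "f \<in> up H" unfolding up_def using inf_le1[of f A] by blast
    qed
    have "up H \<in> \<F>"
    proof (rule up)
      show "G \<subseteq> up H" using FH F'(1) by simp
      show "bot \<notin> H" using nb by (auto simp: H_def)
      show "inf B D \<in> H" if BD: "B \<in> H" "D \<in> H" for B D
      proof -
        obtain f g where "f \<in> F" "g \<in> F" "B = inf f A" "D = inf g A" using BD by (auto simp: H_def)
        then have "inf B D = inf (inf f g) A" "inf f g \<in> F" using F'(3) by (simp_all add: inf_aci)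
        then show ?thesis by (simp add: H_def)
      qed
    qed
    then have "up H = F" using FH by (rule F(2))
    moreover have "A \<in> up H"
    proof -
      obtain g where "g \<in> F" using F'(1) G(3) by auto
      then have "inf g A \<in> H" by (simp add: H_def)
      then show ?thesis unfolding up_def using inf_le2[of g A] by blast
    qed
    ultimately show False using that by simp
  qed
  have "prime_filter F"
    unfolding prime_filter_def
  proof (intro conjI allI)
    show "bot \<notin> F" by (rule F'(2))
    fix A B
    show "inf A B \<in> F \<longleftrightarrow> A \<in> F \<and> B \<in> F"
      using F'(3,4) inf_le1[of A B] inf_le2[of A B] by blast
    show "sup A B \<in> F \<longleftrightarrow> A \<in> F \<or> B \<in> F"
    proof
      assume AB: "sup A B \<in> F"
      show "A \<in> F \<or> B \<in> F"
      proof (rule ccontr)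
        assume "\<not> (A \<in> F \<or> B \<in> F)"
        then obtain f g where fg: "f \<in> F" "inf f A = bot" "g \<in> F" "inf g B = bot" using out by meson
        have "inf (inf f g) (sup A B) = sup (inf g (inf f A)) (inf f (inf g B))"
          by (simp add: inf_sup_distrib1 inf_aci)
        also have "\<dots> = bot" by (simp add: fg inf_absorb2 sup_absorb1)
        finally show False using F'(2,3) fg(1,3) AB by metis
      qed
    next
      assume "A \<in> F \<or> B \<in> F"
      then show "sup A B \<in> F" using F'(4) sup_ge1[of A B] sup_ge2[of B A] by blast
    qed
  qed
  then show ?thesis using F'(1) by blast
qed

section \<open>Construction of boundary paths\<close>

context boolean_dynamical_system
begin

text \<open>\<open>None\<close> is barred at a filter with a regular member: the projection of that
  member is a sum over labels, so a label has to follow.\<close>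

definition follows :: "'b set \<Rightarrow> 'l option \<Rightarrow> 'b set \<Rightarrow> bool" where
  "follows \<xi> a \<xi>' \<longleftrightarrow> (case a of
      None \<Rightarrow> \<forall>A\<in>\<xi>. \<not> regular A
    | Some \<alpha> \<Rightarrow> \<alpha> \<in> L \<and> \<xi> = {A. \<theta> \<alpha> A \<in> \<xi>'})"

text \<open>Otherwise every label kills some member of the filter. Only the finitely many labels of
  R matter, so a single member below R is killed by all labels, against the regularity of R.\<close>

lemma regular_prime_filter_step:
  assumes \<xi>: "prime_filter \<xi>" and R: "R \<in> \<xi>" "regular R"
  shows "\<exists>\<alpha>\<in>L. \<forall>B\<in>\<xi>. \<theta> \<alpha> B \<noteq> bot"
proof (rule ccontr)
  note pf = prime_filterD[OF \<xi>]
  assume "\<not> (\<exists>\<alpha>\<in>L. \<forall>B\<in>\<xi>. \<theta> \<alpha> B \<noteq> bot)"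
  then have "\<forall>\<alpha>\<in>L. \<exists>B\<in>\<xi>. \<theta> \<alpha> B = bot" by blast
  then obtain b where b: "\<And>\<alpha>. \<alpha> \<in> L \<Longrightarrow> b \<alpha> \<in> \<xi> \<and> \<theta> \<alpha> (b \<alpha>) = bot" by metis
  have nb: "R \<noteq> bot" using R pf(1) by auto
  then have fin: "finite (\<Delta> R)" using R(2) by (auto simp: regular_def)
  have mono: "\<theta> \<alpha> B = bot" if "\<alpha> \<in> L" "B \<le> B'" "\<theta> \<alpha> B' = bot" for \<alpha> B B'
    using theta_inf[OF that(1), of B B'] that(2,3) by (metis inf_absorb1 inf_le2 bot_unique)
  have "\<exists>B\<in>\<xi>. B \<le> R \<and> (\<forall>\<alpha>\<in>K. \<theta> \<alpha> B = bot)" if "finite K" "K \<subseteq> L" for K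
    using that
  proof induction
    case empty
    then show ?case using R(1) by auto
  next
    case (insert \<alpha> K)
    then obtain B where B: "B \<in> \<xi>" "B \<le> R" "\<And>\<alpha>. \<alpha> \<in> K \<Longrightarrow> \<theta> \<alpha> B = bot" by auto
    have \<alpha>: "\<alpha> \<in> L" and K: "K \<subseteq> L" using insert.prems by auto
    have "\<theta> \<beta> (inf B (b \<alpha>)) = bot" if "\<beta> \<in> insert \<alpha> K" for \<beta>
      using that mono[OF _ inf_le1 B(3)] mono[OF \<alpha> inf_le2] b[OF \<alpha>] K by auto
    moreover have "inf B (b \<alpha>) \<in> \<xi>" using B(1) b[OF \<alpha>] pf(2) by simp
    moreover have "inf B (b \<alpha>) \<le> R" using B(2) by (rule le_infI1)
    ultimately show ?case by metis
  qed
  from this[OF fin] obtain B where B: "B \<in> \<xi>" "B \<le> R" "\<And>\<alpha>. \<alpha> \<in> \<Delta> R \<Longrightarrow> \<theta> \<alpha> B = bot"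
    by (auto simp: \<Delta>_def)
  have "\<Delta> B = {}"
    using B(3) mono[OF _ B(2)] by (auto simp: \<Delta>_def)
  moreover have "B \<noteq> bot" using B(1) pf(1) by auto
  ultimately show False using R(2) B(2) by (auto simp: regular_def)
qed

lemma prime_filter_follows:
  assumes \<xi>: "prime_filter \<xi>"
  shows "\<exists>a \<xi>'. prime_filter \<xi>' \<and> follows \<xi> a \<xi>'"
proof (cases "\<exists>R\<in>\<xi>. regular R")
  case False
  then have "follows \<xi> None \<xi>" by (simp add: follows_def)
  then show ?thesis using \<xi> by blast
next
  case True
  note pf = prime_filterD[OF \<xi>]
  from True obtain R where R: "R \<in> \<xi>" "regular R" by blast
  obtain \<alpha> where \<alpha>: "\<alpha> \<in> L" "\<And>B. B \<in> \<xi> \<Longrightarrow> \<theta> \<alpha> B \<noteq> bot"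
    using regular_prime_filter_step[OF \<xi> R] by blast
  have "\<exists>\<xi>'. prime_filter \<xi>' \<and> \<theta> \<alpha> ` \<xi> \<subseteq> \<xi>'"
  proof (rule prime_filter_extension)
    show "bot \<notin> \<theta> \<alpha> ` \<xi>" using \<alpha>(2) by (metis imageE)
    show "\<theta> \<alpha> ` \<xi> \<noteq> {}" using R(1) by auto
    show "inf A B \<in> \<theta> \<alpha> ` \<xi>" if AB: "A \<in> \<theta> \<alpha> ` \<xi>" "B \<in> \<theta> \<alpha> ` \<xi>" for A B
    proof -
      obtain A' B' where "A' \<in> \<xi>" "B' \<in> \<xi>" "A = \<theta> \<alpha> A'" "B = \<theta> \<alpha> B'" using AB by blast
      then have "inf A B = \<theta> \<alpha> (inf A' B')" "inf A' B' \<in> \<xi>" using \<alpha>(1) pf(2) by (simp_all add: theta_inf)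
      then show ?thesis by simp
    qed
  qed
  then obtain \<xi>' where \<xi>': "prime_filter \<xi>'" "\<theta> \<alpha> ` \<xi> \<subseteq> \<xi>'" by blast
  note pf' = prime_filterD[OF \<xi>'(1)]
  \<comment> \<open>For A outside the filter, the image of R - A is in the new filter and disjoint
    from the image of A. Hence the preimage of the new filter is no larger than the old
    filter.\<close>
  have "A \<in> \<xi>" if A: "\<theta> \<alpha> A \<in> \<xi>'" for A
  proof (rule ccontr)
    assume "A \<notin> \<xi>"
    then have "R - A \<in> \<xi>" using prime_filter_diff[OF \<xi> R(1)] by blast
    then have "\<theta> \<alpha> R - \<theta> \<alpha> A \<in> \<xi>'" using \<xi>'(2) theta_diff[OF \<alpha>(1), of R A] by auto
    then have "inf (\<theta> \<alpha> A) (\<theta> \<alpha> R - \<theta> \<alpha> A) \<in> \<xi>'" using A pf'(2) by simp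
    then show False using pf'(1) by (simp add: inf_diff_bot)
  qed
  then have "\<xi> = {A. \<theta> \<alpha> A \<in> \<xi>'}" using \<xi>'(2) by blast
  then have "follows \<xi> (Some \<alpha>) \<xi>'" using \<alpha>(1) by (simp add: follows_def)
  then show ?thesis using \<xi>'(1) by blast
qed

text \<open>A boundary path is a sequence of prime filters (possibly empty, so that a path can be extended
  backwards by every label) and labels. Nothing ends a path: a label \<open>None\<close> separates its initial
  segment from an arbitrary continuation.\<close>

definition boundary_path :: "(nat \<Rightarrow> 'b set \<times> 'l option) \<Rightarrow> bool" where
  "boundary_path \<omega> \<longleftrightarrow> (\<forall>n. prime_filter (fst (\<omega> n)) \<and> follows (fst (\<omega> n)) (snd (\<omega> n)) (fst (\<omega> (Suc n))))"

definition shift :: "(nat \<Rightarrow> 'b set \<times> 'l option) \<Rightarrow> nat \<Rightarrow> 'b set \<times> 'l option" where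
  "shift \<omega> n = \<omega> (Suc n)"

definition extend :: "'l \<Rightarrow> (nat \<Rightarrow> 'b set \<times> 'l option) \<Rightarrow> nat \<Rightarrow> 'b set \<times> 'l option" where
  "extend \<alpha> \<omega> n = (case n of 0 \<Rightarrow> ({A. \<theta> \<alpha> A \<in> fst (\<omega> 0)}, Some \<alpha>) | Suc n \<Rightarrow> \<omega> n)"

lemma shift_extend [simp]: "shift (extend \<alpha> \<omega>) = \<omega>"
  by (rule ext) (simp add: shift_def extend_def)

lemma extend_0 [simp]: "extend \<alpha> \<omega> 0 = ({A. \<theta> \<alpha> A \<in> fst (\<omega> 0)}, Some \<alpha>)"
  by (simp add: extend_def)

lemma path_shift: "boundary_path \<omega> \<Longrightarrow> boundary_path (shift \<omega>)"
  by (simp add: boundary_path_def shift_def)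

lemma path_extend:
  assumes "boundary_path \<omega>" "\<alpha> \<in> L"
  shows "boundary_path (extend \<alpha> \<omega>)"
  unfolding boundary_path_def
proof
  fix n
  show "prime_filter (fst (extend \<alpha> \<omega> n)) \<and>
    follows (fst (extend \<alpha> \<omega> n)) (snd (extend \<alpha> \<omega> n)) (fst (extend \<alpha> \<omega> (Suc n)))"
  proof (cases n)
    case 0
    have "prime_filter (fst (\<omega> 0))" using assms(1) by (simp add: boundary_path_def)
    then have "prime_filter {A. \<theta> \<alpha> A \<in> fst (\<omega> 0)}"
      unfolding prime_filter_def using assms(2) by (simp add: theta_inf theta_sup theta_bot)
    then show ?thesis using assms(2) by (simp add: 0 extend_def follows_def)
  next
    case (Suc m)
    then show ?thesis using assms(1) by (simp add: boundary_path_def extend_def)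
  qed
qed

lemma path_label:
  assumes "boundary_path \<omega>" "snd (\<omega> 0) = Some \<alpha>"
  shows "\<alpha> \<in> L" "extend \<alpha> (shift \<omega>) = \<omega>" "A \<in> fst (\<omega> 0) \<longleftrightarrow> \<theta> \<alpha> A \<in> fst (shift \<omega> 0)"
proof -
  have "follows (fst (\<omega> 0)) (Some \<alpha>) (fst (\<omega> (Suc 0)))"
    using assms unfolding boundary_path_def by metis
  then have *: "\<alpha> \<in> L" "fst (\<omega> 0) = {A. \<theta> \<alpha> A \<in> fst (\<omega> (Suc 0))}" by (simp_all add: follows_def)
  then show "\<alpha> \<in> L" "A \<in> fst (\<omega> 0) \<longleftrightarrow> \<theta> \<alpha> A \<in> fst (shift \<omega> 0)" by (simp_all add: shift_def)
  show "extend \<alpha> (shift \<omega>) = \<omega>"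
  proof
    fix n
    show "extend \<alpha> (shift \<omega>) n = \<omega> n"
      using *(2) assms(2) by (cases n) (simp_all add: extend_def shift_def prod_eq_iff)
  qed
qed

text \<open>This determines which summand of the relation for a regular set acts on a given
  path.\<close>

lemma path_regular:
  assumes "boundary_path \<omega>" "A \<in> fst (\<omega> 0)" "regular A"
  shows "\<exists>\<alpha>\<in>\<Delta> A. snd (\<omega> 0) = Some \<alpha>"
proof (cases "snd (\<omega> 0)")
  case None
  have "follows (fst (\<omega> 0)) None (fst (\<omega> (Suc 0)))" using assms(1) None unfolding boundary_path_def by metis
  then show ?thesis using assms(2,3) by (simp add: follows_def)
next
  case (Some \<alpha>)
  have "\<theta> \<alpha> A \<in> fst (shift \<omega> 0)" using path_label[OF assms(1) Some] assms(2) by blast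
  moreover have "bot \<notin> fst (shift \<omega> 0)"
    using path_shift[OF assms(1)] by (auto simp: boundary_path_def prime_filter_def)
  ultimately show ?thesis using Some path_label(1)[OF assms(1) Some] by (auto simp: \<Delta>_def)
qed

lemma path_exists:
  assumes "A \<noteq> bot"
  shows "\<exists>\<omega>. boundary_path \<omega> \<and> A \<in> fst (\<omega> 0)"
proof -
  obtain \<xi> where \<xi>: "prime_filter \<xi>" "A \<in> \<xi>"
    using prime_filter_extension[of "{A}"] assms by auto
  \<comment> \<open>A fixed choice of successor, which exists at every prime filter by
    \<open>prime_filter_follows\<close>; the path iterates it.\<close>
  define step where "step \<xi> = (SOME (a, \<xi>'). prime_filter \<xi>' \<and> follows \<xi> a \<xi>')" for \<xi>
  have step: "prime_filter (snd (step \<xi>)) \<and> follows \<xi> (fst (step \<xi>)) (snd (step \<xi>))"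
    if "prime_filter \<xi>" for \<xi>
  proof -
    have "\<exists>u. case u of (a, \<xi>') \<Rightarrow> prime_filter \<xi>' \<and> follows \<xi> a \<xi>'"
      using prime_filter_follows[OF that] by auto
    from someI_ex[OF this] show ?thesis unfolding step_def[symmetric] by (simp add: case_prod_beta)
  qed
  define x where "x n = ((snd \<circ> step) ^^ n) \<xi>" for n
  have x: "x 0 = \<xi>" "x (Suc n) = snd (step (x n))" for n by (simp_all add: x_def)
  have pf: "prime_filter (x n)" for n by (induction n) (use \<xi> step in \<open>auto simp: x\<close>)
  have "boundary_path (\<lambda>n. (x n, fst (step (x n))))"
    using pf step[OF pf] by (simp add: boundary_path_def x)
  then show ?thesis using \<xi>(2) by (intro exI[of _ "\<lambda>n. (x n, fst (step (x n)))"]) (simp add: x)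
qed

end

section \<open>Operators induced by partial injections\<close>

definition pinj :: "('i \<Rightarrow> 'i option) \<Rightarrow> bool" where
  "pinj h \<longleftrightarrow> (\<forall>i i' j. h i = Some j \<longrightarrow> h i' = Some j \<longrightarrow> i = i')"

definition pull :: "('i \<Rightarrow> 'i option) \<Rightarrow> 'i ell2 \<Rightarrow> 'i \<Rightarrow> complex" where
  "pull h x i = (case h i of None \<Rightarrow> 0 | Some j \<Rightarrow> Rep_ell2 x j)"

text \<open>Composition with h, extended by 0 off its domain. Injectivity of h makes this a
  contraction, and the inverse partial injection gives the adjoint.\<close>

definition pull_op :: "('i \<Rightarrow> 'i option) \<Rightarrow> 'i ell2 \<Rightarrow>\<^sub>L 'i ell2" where
  "pull_op h = Blinfun (\<lambda>x. Abs_ell2 (pull h x))"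

lemma pull_sum_le:
  assumes "pinj h" "finite F"
  shows "(\<Sum>i\<in>F. (cmod (pull h x i))\<^sup>2) \<le> (norm x)\<^sup>2"
proof -
  define D where "D = {i \<in> F. h i \<noteq> None}"
  have "(\<Sum>i\<in>F. (cmod (pull h x i))\<^sup>2) = (\<Sum>i\<in>D. (cmod (pull h x i))\<^sup>2)"
    using assms(2) by (intro sum.mono_neutral_right) (auto simp: D_def pull_def)
  also have "\<dots> = (\<Sum>i\<in>D. (cmod (Rep_ell2 x (the (h i))))\<^sup>2)"
    by (intro sum.cong) (auto simp: D_def pull_def)
  also have "\<dots> = (\<Sum>j\<in>(\<lambda>i. the (h i)) ` D. (cmod (Rep_ell2 x j))\<^sup>2)"
    using assms(1) by (subst sum.reindex) (auto simp: inj_on_def D_def pinj_def)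
  also have "\<dots> \<le> (norm x)\<^sup>2"
    using assms(2) by (intro ell2_finite_sum_le) (simp add: D_def)
  finally show ?thesis .
qed

lemma pull_op_apply:
  assumes "pinj h"
  shows "Rep_ell2 (blinfun_apply (pull_op h) x) i = pull h x i"
proof -
  have r: "Rep_ell2 (Abs_ell2 (pull h x)) = pull h x" for x
    by (rule Rep_Abs_ell2[OF ell2_normI(1)[OF pull_sum_le[OF assms, of _ x]]]) auto
  have "bounded_linear (\<lambda>x. Abs_ell2 (pull h x))"
  proof (rule bounded_linear_intro[of _ 1])
    show "norm (Abs_ell2 (pull h x)) \<le> norm x * 1" for x
      using ell2_normI(2)[OF pull_sum_le[OF assms, of _ x]] by simp
  qed (rule ell2_eqI, simp add: r, simp add: pull_def split: option.split)+
  then show ?thesis by (simp add: pull_op_def bounded_linear_Blinfun_apply r)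
qed

text \<open>Both pairings are sums over the graph of h; the bijection from \<open>dom h\<close> to
  \<open>dom k\<close> carries one into the other.\<close>

lemma pull_op_adj:
  assumes h: "\<And>i j. h i = Some j \<longleftrightarrow> k j = Some i"
  shows "is_adj (pull_op h) (pull_op k)" "pinj h" "pinj k"
proof -
  show ph: "pinj h" using h unfolding pinj_def by (metis option.inject)
  show pk: "pinj k" using h unfolding pinj_def by (metis option.inject)
  define f where "f = (\<lambda>x y i. Re (pull h x i * cnj (Rep_ell2 y i)))"
  have "inner (pull_op h x) y = inner x (pull_op k y)" for x y
  proof -
    have "inner (pull_op h x) y = (\<Sum>\<^sub>\<infinity>i\<in>dom h. Re (pull h x i * cnj (Rep_ell2 y i)))"
      unfolding inner_ell2_def pull_op_apply[OF ph]
      by (rule infsum_cong_neutral) (auto simp: pull_def split: option.splits)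
    also have "\<dots> = (\<Sum>\<^sub>\<infinity>i\<in>dom h. (\<lambda>j. Re (Rep_ell2 x j * cnj (pull k y j))) (the (h i)))"
    proof (rule infsum_cong)
      fix i assume "i \<in> dom h"
      then obtain j where "h i = Some j" by auto
      moreover from this have "k j = Some i" using h by simp
      ultimately show "Re (pull h x i * cnj (Rep_ell2 y i)) = Re (Rep_ell2 x (the (h i)) * cnj (pull k y (the (h i))))"
        by (simp add: pull_def)
    qed
    also have "\<dots> = (\<Sum>\<^sub>\<infinity>j\<in>dom k. Re (Rep_ell2 x j * cnj (pull k y j)))"
    proof (rule infsum_reindex_bij_betw)
      show "bij_betw (\<lambda>i. the (h i)) (dom h) (dom k)"
      proof (rule bij_betwI[where g = "\<lambda>j. the (k j)"])
        have hk: "the (h i) \<in> dom k \<and> the (k (the (h i))) = i" if "i \<in> dom h" for i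
        proof -
          from that obtain j where "h i = Some j" by auto
          moreover from this have "k j = Some i" using h by simp
          ultimately show ?thesis by auto
        qed
        have kh: "the (k j) \<in> dom h \<and> the (h (the (k j))) = j" if "j \<in> dom k" for j
        proof -
          from that obtain i where "k j = Some i" by auto
          moreover from this have "h i = Some j" using h by simp
          ultimately show ?thesis by auto
        qed
        show "(\<lambda>i. the (h i)) \<in> dom h \<rightarrow> dom k" "(\<lambda>j. the (k j)) \<in> dom k \<rightarrow> dom h"
          using hk kh by blast+
        show "the (k (the (h i))) = i" if "i \<in> dom h" for i using hk that by blast
        show "the (h (the (k j))) = j" if "j \<in> dom k" for j using kh that by blast
      qed
    qed
    also have "\<dots> = inner x (pull_op k y)"
      unfolding inner_ell2_def pull_op_apply[OF pk]
      by (rule infsum_cong_neutral) (auto simp: pull_def split: option.splits)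
    finally show ?thesis .
  qed
  then show "is_adj (pull_op h) (pull_op k)" by (simp add: is_adj_def)
qed

lemma pull_op_algebra:
  assumes h: "\<And>i j. h i = Some j \<longleftrightarrow> k j = Some i"
  shows "pull_op h \<in> op_carrier" "star op_algebra (pull_op h) = pull_op k"
proof -
  note adj = pull_op_adj[of h k, OF h]
  have "pull_op h (cscale c x) = cscale c (pull_op h x)" for c x
    by (rule ell2_eqI) (simp add: pull_op_apply adj(2), simp add: pull_def split: option.split)
  then show "pull_op h \<in> op_carrier" using adj(1) by (auto simp: op_carrier_def)
  show "star op_algebra (pull_op h) = pull_op k" using adj(1) by (rule op_star)
qed

lemma pull_op_eqI:
  assumes "\<And>x i. Rep_ell2 (blinfun_apply T x) i = Rep_ell2 (blinfun_apply U x) i"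
  shows "T = U"
  by (rule blinfun_eqI, rule ell2_eqI) (rule assms)

section \<open>The boundary path representation\<close>

context generalized_boolean_dynamical_system
begin

definition path_P :: "'b \<Rightarrow> (nat \<Rightarrow> 'b set \<times> 'l option) ell2 \<Rightarrow>\<^sub>L (nat \<Rightarrow> 'b set \<times> 'l option) ell2" where
  "path_P A = pull_op (\<lambda>\<omega>. if boundary_path \<omega> \<and> A \<in> fst (\<omega> 0) then Some \<omega> else None)"

text \<open>On basis vectors this prepends the label \<alpha> to the paths whose first filter
  contains B; the formula is the same action read on functions.\<close>

definition path_S :: "'l \<Rightarrow> 'b \<Rightarrow> (nat \<Rightarrow> 'b set \<times> 'l option) ell2 \<Rightarrow>\<^sub>L (nat \<Rightarrow> 'b set \<times> 'l option) ell2" where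
  "path_S \<alpha> B = pull_op (\<lambda>\<omega>. if boundary_path \<omega> \<and> snd (\<omega> 0) = Some \<alpha> \<and> B \<in> fst (shift \<omega> 0)
    then Some (shift \<omega>) else None)"

definition path_S_star :: "'l \<Rightarrow> 'b \<Rightarrow> (nat \<Rightarrow> 'b set \<times> 'l option) ell2 \<Rightarrow>\<^sub>L (nat \<Rightarrow> 'b set \<times> 'l option) ell2" where
  "path_S_star \<alpha> B = pull_op (\<lambda>\<omega>. if boundary_path \<omega> \<and> B \<in> fst (\<omega> 0) then Some (extend \<alpha> \<omega>) else None)"

lemma path_P_op:
  shows path_P_carrier: "path_P A \<in> op_carrier"
    and path_P_star: "star op_algebra (path_P A) = path_P A"
    and path_P_apply: "Rep_ell2 (blinfun_apply (path_P A) x) \<omega> = (if boundary_path \<omega> \<and> A \<in> fst (\<omega> 0) then Rep_ell2 x \<omega> else 0)"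
proof -
  let ?h = "\<lambda>\<omega>. if boundary_path \<omega> \<and> A \<in> fst (\<omega> 0) then Some \<omega> else None"
  have h: "?h i = Some j \<longleftrightarrow> ?h j = Some i" for i j by auto
  show "path_P A \<in> op_carrier" "star op_algebra (path_P A) = path_P A"
    unfolding path_P_def using pull_op_algebra[of ?h ?h, OF h] by blast+
  show "Rep_ell2 (blinfun_apply (path_P A) x) \<omega> = (if boundary_path \<omega> \<and> A \<in> fst (\<omega> 0) then Rep_ell2 x \<omega> else 0)"
    unfolding path_P_def pull_op_apply[OF pull_op_adj(2)[of ?h ?h, OF h]] by (simp add: pull_def)
qed

lemma path_S_op:
  assumes \<alpha>: "\<alpha> \<in> L"
  shows path_S_carrier: "path_S \<alpha> B \<in> op_carrier"
    and path_S_star_carrier: "path_S_star \<alpha> B \<in> op_carrier"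
    and star_path_S: "star op_algebra (path_S \<alpha> B) = path_S_star \<alpha> B"
    and path_S_apply: "Rep_ell2 (blinfun_apply (path_S \<alpha> B) x) \<omega> =
      (if boundary_path \<omega> \<and> snd (\<omega> 0) = Some \<alpha> \<and> B \<in> fst (shift \<omega> 0) then Rep_ell2 x (shift \<omega>) else 0)"
    and path_S_star_apply: "Rep_ell2 (blinfun_apply (path_S_star \<alpha> B) x) \<omega> =
      (if boundary_path \<omega> \<and> B \<in> fst (\<omega> 0) then Rep_ell2 x (extend \<alpha> \<omega>) else 0)"
proof -
  let ?h = "\<lambda>\<omega>. if boundary_path \<omega> \<and> snd (\<omega> 0) = Some \<alpha> \<and> B \<in> fst (shift \<omega> 0) then Some (shift \<omega>) else None"
  let ?k = "\<lambda>\<omega>. if boundary_path \<omega> \<and> B \<in> fst (\<omega> 0) then Some (extend \<alpha> \<omega>) else None"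
  have h: "?h i = Some j \<longleftrightarrow> ?k j = Some i" for i j
  proof
    assume "?h i = Some j"
    then have i: "boundary_path i" "snd (i 0) = Some \<alpha>" "B \<in> fst (shift i 0)" "j = shift i"
      by (auto split: if_splits)
    then show "?k j = Some i" using path_shift[OF i(1)] path_label(2)[OF i(1,2)] by simp
  next
    assume "?k j = Some i"
    then have "boundary_path j" "B \<in> fst (j 0)" "i = extend \<alpha> j" by (auto split: if_splits)
    then show "?h i = Some j" using path_extend[OF _ \<alpha>] by simp
  qed
  have k: "?k i = Some j \<longleftrightarrow> ?h j = Some i" for i j using h[of j i] by (rule sym)
  show "path_S \<alpha> B \<in> op_carrier" "star op_algebra (path_S \<alpha> B) = path_S_star \<alpha> B"
    unfolding path_S_def path_S_star_def using pull_op_algebra[of ?h ?k, OF h] by blast+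
  show "path_S_star \<alpha> B \<in> op_carrier"
    unfolding path_S_star_def using pull_op_algebra(1)[of ?k ?h, OF k] by blast
  show "Rep_ell2 (blinfun_apply (path_S \<alpha> B) x) \<omega> =
      (if boundary_path \<omega> \<and> snd (\<omega> 0) = Some \<alpha> \<and> B \<in> fst (shift \<omega> 0) then Rep_ell2 x (shift \<omega>) else 0)"
    unfolding path_S_def pull_op_apply[OF pull_op_adj(2)[of ?h ?k, OF h]] by (simp add: pull_def)
  show "Rep_ell2 (blinfun_apply (path_S_star \<alpha> B) x) \<omega> =
      (if boundary_path \<omega> \<and> B \<in> fst (\<omega> 0) then Rep_ell2 x (extend \<alpha> \<omega>) else 0)"
    unfolding path_S_star_def pull_op_apply[OF pull_op_adj(3)[of ?h ?k, OF h]] by (simp add: pull_def)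
qed

lemma path_filter:
  assumes "boundary_path \<omega>"
  shows "bot \<notin> fst (\<omega> 0)" "inf A B \<in> fst (\<omega> 0) \<longleftrightarrow> A \<in> fst (\<omega> 0) \<and> B \<in> fst (\<omega> 0)"
    "sup A B \<in> fst (\<omega> 0) \<longleftrightarrow> A \<in> fst (\<omega> 0) \<or> B \<in> fst (\<omega> 0)"
proof -
  have "prime_filter (fst (\<omega> 0))" using assms by (simp add: boundary_path_def)
  from prime_filterD[OF this] show "bot \<notin> fst (\<omega> 0)"
    "inf A B \<in> fst (\<omega> 0) \<longleftrightarrow> A \<in> fst (\<omega> 0) \<and> B \<in> fst (\<omega> 0)"
    "sup A B \<in> fst (\<omega> 0) \<longleftrightarrow> A \<in> fst (\<omega> 0) \<or> B \<in> fst (\<omega> 0)" by blast+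
qed

lemma finsum_op_apply:
  assumes "finite K" "\<And>k. k \<in> K \<Longrightarrow> f k \<in> op_carrier"
  shows "Rep_ell2 (blinfun_apply (finsum op_algebra f K) x) i = (\<Sum>k\<in>K. Rep_ell2 (blinfun_apply (f k) x) i)"
proof -
  interpret O: cstar_algebra "op_algebra :: ('c ell2 \<Rightarrow>\<^sub>L 'c ell2) cstar" by (rule op_algebra_cstar)
  show ?thesis
    using assms
  proof (induction rule: finite_induct)
    case empty
    then show ?case by (simp add: op_algebra_simps)
  next
    case (insert k K)
    have "f \<in> K \<rightarrow> carrier op_algebra" "f k \<in> carrier op_algebra"
      using insert.prems by (auto simp: op_algebra_simps)
    then have "finsum op_algebra f (insert k K) = f k + finsum op_algebra f K"
      using insert.hyps by (simp add: O.M.finsum_insert op_algebra_simps)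
    then show ?case using insert by (simp add: blinfun.add_left)
  qed
qed

text \<open>The relations are checked at one path at a time. They come down to two facts: shifting
  and extending by a label undo each other, and a path with first label \<alpha> has E in its first
  filter exactly when its tail has \<open>\<theta> \<alpha> E\<close> there.\<close>

lemma path_representation: "cuntz_krieger_representation L \<theta> I op_algebra path_P path_S"
proof -
  interpret O: cstar_algebra "op_algebra :: ((nat \<Rightarrow> 'b set \<times> 'l option) ell2 \<Rightarrow>\<^sub>L (nat \<Rightarrow> 'b set \<times> 'l option) ell2) cstar"
    by (rule op_algebra_cstar)
  note simps = op_algebra_simps path_P_carrier path_S_carrier path_S_star_carrier
    path_P_star star_path_S
  show ?thesis
  proof
    fix E F
    show "projection op_algebra (path_P E)"
      unfolding projection_def simps by (auto intro!: pull_op_eqI simp: simps path_P_apply)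
    show "path_P bot = \<zero>\<^bsub>op_algebra\<^esub>"
      unfolding simps by (rule pull_op_eqI) (use path_filter(1) in \<open>auto simp: path_P_apply\<close>)
    show "path_P (inf E F) = path_P E \<otimes>\<^bsub>op_algebra\<^esub> path_P F"
      unfolding simps by (rule pull_op_eqI) (use path_filter(2) in \<open>auto simp: path_P_apply\<close>)
    have c: "path_P E \<oplus>\<^bsub>op_algebra\<^esub> path_P F \<in> carrier op_algebra" "path_P (inf E F) \<in> carrier op_algebra"
      using O.M.a_closed[of "path_P E" "path_P F"] by (simp_all add: simps)
    show "path_P (sup E F) = path_P E \<oplus>\<^bsub>op_algebra\<^esub> path_P F \<ominus>\<^bsub>op_algebra\<^esub> path_P (inf E F)"
      unfolding O.diff_eq[OF c] unfolding simps
      by (rule pull_op_eqI) (use path_filter(2,3) in \<open>auto simp: path_P_apply blinfun.add_left\<close>)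
    show "path_P E = (\<Oplus>\<^bsub>op_algebra\<^esub>\<alpha>\<in>\<Delta> E. path_S \<alpha> (\<theta> \<alpha> E) \<otimes>\<^bsub>op_algebra\<^esub> star op_algebra (path_S \<alpha> (\<theta> \<alpha> E)))"
      if E: "regular E"
    proof (rule pull_op_eqI)
      fix x \<omega>
      have fin: "finite (\<Delta> E)"
      proof (cases "E = bot")
        case True
        then have "\<Delta> E = {}" using theta_bot by (auto simp: \<Delta>_def)
        then show ?thesis by simp
      qed (use E in \<open>simp add: regular_def\<close>)
      have \<Delta>L: "\<alpha> \<in> L" if "\<alpha> \<in> \<Delta> E" for \<alpha> using that by (simp add: \<Delta>_def)
      let ?f = "\<lambda>\<alpha>. path_S \<alpha> (\<theta> \<alpha> E) \<otimes>\<^bsub>op_algebra\<^esub> star op_algebra (path_S \<alpha> (\<theta> \<alpha> E))"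
      have f: "?f \<alpha> \<in> op_carrier" if "\<alpha> \<in> \<Delta> E" for \<alpha>
        using \<Delta>L[OF that] by (simp add: simps op_carrier_closed)
      \<comment> \<open>Each summand is the projection to the paths over E with first label
        \<alpha>.\<close>
      have fa: "Rep_ell2 (blinfun_apply (?f \<alpha>) x) \<omega>
          = (if boundary_path \<omega> \<and> snd (\<omega> 0) = Some \<alpha> \<and> E \<in> fst (\<omega> 0) then Rep_ell2 x \<omega> else 0)"
        if "\<alpha> \<in> \<Delta> E" for \<alpha>
        using \<Delta>L[OF that] path_label(2,3)[of \<omega> \<alpha>] path_shift[of \<omega>]
        by (auto simp: simps path_S_apply path_S_star_apply)
      have "Rep_ell2 (blinfun_apply (finsum op_algebra ?f (\<Delta> E)) x) \<omega>
          = (\<Sum>\<alpha>\<in>\<Delta> E. if boundary_path \<omega> \<and> snd (\<omega> 0) = Some \<alpha> \<and> E \<in> fst (\<omega> 0) then Rep_ell2 x \<omega> else 0)"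
        by (subst finsum_op_apply[OF fin f]) (auto intro!: sum.cong simp: fa)
      \<comment> \<open>A path over the regular E has exactly one first label, and this label lies
        in \<Delta> E, so one summand survives.\<close>
      also have "\<dots> = (if boundary_path \<omega> \<and> E \<in> fst (\<omega> 0) then Rep_ell2 x \<omega> else 0)"
      proof (cases "boundary_path \<omega> \<and> E \<in> fst (\<omega> 0)")
        case True
        then obtain \<alpha> where \<alpha>: "\<alpha> \<in> \<Delta> E" "snd (\<omega> 0) = Some \<alpha>" using path_regular[OF _ _ E] by blast
        have "(\<Sum>\<beta>\<in>\<Delta> E. if boundary_path \<omega> \<and> snd (\<omega> 0) = Some \<beta> \<and> E \<in> fst (\<omega> 0) then Rep_ell2 x \<omega> else 0)
            = (\<Sum>\<beta>\<in>\<Delta> E. if \<beta> = \<alpha> then Rep_ell2 x \<omega> else 0)"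
          using True \<alpha> by (intro sum.cong) auto
        then show ?thesis using True \<alpha> fin by simp
      qed auto
      finally show "Rep_ell2 (blinfun_apply (path_P E) x) \<omega> = Rep_ell2 (blinfun_apply (finsum op_algebra ?f (\<Delta> E)) x) \<omega>"
        by (simp add: path_P_apply)
    qed
  next
    fix \<alpha> B assume \<alpha>: "\<alpha> \<in> L"
    have ext: "boundary_path (extend \<alpha> \<omega>)" if "boundary_path \<omega>" for \<omega> using that \<alpha> by (rule path_extend)
    show "partial_isometry op_algebra (path_S \<alpha> B)"
      unfolding partial_isometry_def
    proof
      show "path_S \<alpha> B \<in> carrier op_algebra" using \<alpha> by (simp add: simps)
      show "path_S \<alpha> B \<otimes>\<^bsub>op_algebra\<^esub> star op_algebra (path_S \<alpha> B) \<otimes>\<^bsub>op_algebra\<^esub> path_S \<alpha> B = path_S \<alpha> B"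
        by (rule pull_op_eqI)
          (simp add: simps \<alpha> path_S_apply path_S_star_apply path_shift ext)
    qed
    show "path_P E \<otimes>\<^bsub>op_algebra\<^esub> path_S \<alpha> B = path_S \<alpha> B \<otimes>\<^bsub>op_algebra\<^esub> path_P (\<theta> \<alpha> E)" for E
    proof (rule pull_op_eqI)
      fix x \<omega>
      show "Rep_ell2 (blinfun_apply (path_P E \<otimes>\<^bsub>op_algebra\<^esub> path_S \<alpha> B) x) \<omega>
          = Rep_ell2 (blinfun_apply (path_S \<alpha> B \<otimes>\<^bsub>op_algebra\<^esub> path_P (\<theta> \<alpha> E)) x) \<omega>"
        using path_label(3)[of \<omega> \<alpha> E] path_shift[of \<omega>]
        by (auto simp: simps \<alpha> path_P_apply path_S_apply)
    qed
    show "star op_algebra (path_S \<alpha> B) \<otimes>\<^bsub>op_algebra\<^esub> path_S \<alpha>' B'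
        = (if \<alpha> = \<alpha>' then path_P (inf B B') else \<zero>\<^bsub>op_algebra\<^esub>)" if "\<alpha>' \<in> L" for \<alpha>' B'
    proof (rule pull_op_eqI)
      fix x \<omega>
      show "Rep_ell2 (blinfun_apply (star op_algebra (path_S \<alpha> B) \<otimes>\<^bsub>op_algebra\<^esub> path_S \<alpha>' B') x) \<omega>
          = Rep_ell2 (blinfun_apply (if \<alpha> = \<alpha>' then path_P (inf B B') else \<zero>\<^bsub>op_algebra\<^esub>) x) \<omega>"
        using that ext[of \<omega>] path_filter(2)[of \<omega>]
        by (auto simp: simps \<alpha> path_P_apply path_S_apply path_S_star_apply)
    qed
  qed
qed

lemma path_P_nonzero:
  assumes "A \<noteq> bot"
  shows "path_P A \<noteq> 0"
proof
  assume 0: "path_P A = 0"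
  obtain \<omega> where \<omega>: "boundary_path \<omega>" "A \<in> fst (\<omega> 0)" using path_exists[OF assms] by blast
  \<comment> \<open>The point mass at a path over A is fixed by \<open>path_P A\<close>.\<close>
  define e :: "(nat \<Rightarrow> 'b set \<times> 'l option) \<Rightarrow> complex" where "e i = (if i = \<omega> then 1 else 0)" for i
  have "(\<Sum>i\<in>F. (cmod (e i))\<^sup>2) \<le> 1\<^sup>2" if "finite F" for F
  proof -
    have "(\<Sum>i\<in>F. (cmod (e i))\<^sup>2) = (\<Sum>i\<in>F. if i = \<omega> then 1 else (0::real))"
      by (rule sum.cong) (auto simp: e_def)
    also have "\<dots> \<le> 1" using that by simp
    finally show ?thesis by simp
  qed
  then have "Rep_ell2 (Abs_ell2 e) = e" by (rule Rep_Abs_ell2[OF ell2_normI(1)]) simp_all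
  then have "Rep_ell2 (blinfun_apply (path_P A) (Abs_ell2 e)) \<omega> = 1"
    using \<omega> by (simp add: path_P_apply e_def)
  then show False by (simp add: 0)
qed

end

section \<open>The gauge action of the universal algebra and its transport\<close>

context cstar_algebra
begin

lemma closedin_convI:
  assumes "D \<subseteq> carrier A" "\<And>f l. \<lbrakk>conv f l; \<And>n. f n \<in> D\<rbrakk> \<Longrightarrow> l \<in> D"
  shows "closedin metric.mtopology D"
  unfolding metric.metric_closedin_iff_sequentially_closed
proof (intro conjI allI impI assms(1))
  fix \<sigma> l assume \<sigma>: "range \<sigma> \<subseteq> D \<and> limitin metric.mtopology \<sigma> l sequentially"
  then have c: "\<sigma> n \<in> carrier A" for n using assms(1) by auto
  from \<sigma> have l: "l \<in> carrier A" "\<And>e. e > 0 \<Longrightarrow> \<exists>N. \<forall>n\<ge>N. cdist A (\<sigma> n) l < e"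
    unfolding metric.limit_metric_sequentially by blast+
  have "(\<lambda>n. nrm A (\<sigma> n \<ominus> l)) \<longlonglongrightarrow> 0"
    unfolding LIMSEQ_iff using l c by (simp add: cdist_def nrm_nonneg)
  then have "conv \<sigma> l" using l c by (auto simp: conv_def)
  then show "l \<in> D" by (rule assms(2)) (use \<sigma> in auto)
qed

end

text \<open>z cancels against its conjugate wherever S meets its adjoint, and stands on both sides
  of \<open>P_S\<close>. Universality turns the rotated family into a gauge map on C.\<close>

lemma (in cuntz_krieger_representation) gauge_representation:
  assumes z: "cmod z = 1"
  shows "cuntz_krieger_representation L \<theta> I A P (\<lambda>\<alpha> B. z \<odot> S \<alpha> B)"
proof
  have zz: "z * cnj z = 1" "cnj z * z = 1" using z by (simp_all add: complex_mult_cnj cmod_def mult.commute)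
  show "projection A (P E)" "P bot = \<zero>" "P (inf E F) = P E \<otimes> P F"
    "P (sup E F) = P E \<oplus> P F \<ominus> P (inf E F)" for E F
    by (rule projection_P P_bot P_inf P_sup)+
  show "P E = (\<Oplus>\<alpha>\<in>\<Delta> E. z \<odot> S \<alpha> (\<theta> \<alpha> E) \<otimes> star A (z \<odot> S \<alpha> (\<theta> \<alpha> E)))" if "regular E" for E
  proof -
    have "(\<Oplus>\<alpha>\<in>\<Delta> E. z \<odot> S \<alpha> (\<theta> \<alpha> E) \<otimes> star A (z \<odot> S \<alpha> (\<theta> \<alpha> E)))
        = (\<Oplus>\<alpha>\<in>\<Delta> E. S \<alpha> (\<theta> \<alpha> E) \<otimes> star A (S \<alpha> (\<theta> \<alpha> E)))"
      by (rule M.finsum_cong')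
        (auto simp: \<Delta>_def theta_in_I star_smult smult_mult_left smult_mult_right zz)
    then show ?thesis using P_regular[OF that] by simp
  qed
  show "partial_isometry A (z \<odot> S \<alpha> B)" if "\<alpha> \<in> L" "B \<in> I \<alpha>" for \<alpha> B
    using that partial_isometry_S[OF that]
    by (simp add: partial_isometry_def star_smult smult_mult_left smult_mult_right zz mult.assoc)
  show "P E \<otimes> (z \<odot> S \<alpha> B) = z \<odot> S \<alpha> B \<otimes> P (\<theta> \<alpha> E)" if "\<alpha> \<in> L" "B \<in> I \<alpha>" for \<alpha> B E
    using that by (simp add: smult_mult_left smult_mult_right P_S)
  show "star A (z \<odot> S \<alpha> B) \<otimes> (z \<odot> S \<alpha>' B') = (if \<alpha> = \<alpha>' then P (inf B B') else \<zero>)"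
    if "\<alpha> \<in> L" "B \<in> I \<alpha>" "\<alpha>' \<in> L" "B' \<in> I \<alpha>'" for \<alpha> B \<alpha>' B'
    using that by (simp add: star_smult smult_mult_left smult_mult_right zz S_S)
qed

context ck_morphism
begin

text \<open>The preimage of the generated algebra is a closed subalgebra that contains the
  generators of C, hence everything. Conversely the image of \<pi> is closed, because an injective
  \<pi> is isometric.\<close>

lemma image_eq_gen:
  assumes inj: "inj_on \<pi> (carrier C)" and generates: "cstar_generated C (generators L I p s) = carrier C"
  shows "\<pi> ` carrier C = gen"
proof
  define D where "D = {x \<in> carrier C. \<pi> x \<in> gen}"
  have "closedin C.metric.mtopology D"
  proof (rule C.closedin_convI)
    fix f l assume f: "C.conv f l" "\<And>n. f n \<in> D"
    have cl: "closedin X.metric.mtopology gen"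
      using X.generated_subalgebra(1)[OF X.generators_closed] by (simp add: cstar_subalgebra_def)
    have "\<pi> l \<in> gen"
      by (rule X.closedin_conv[OF cl hom_conv[OF f(1)]]) (use f(2) in \<open>simp add: D_def\<close>)
    then show "l \<in> D" using C.conv_closed[OF f(1)] by (simp add: D_def)
  qed (auto simp: D_def)
  then have "cstar_subalgebra C D"
    unfolding cstar_subalgebra_def
    by (auto simp: D_def hom_add hom_smult hom_mult hom_star gen_zero gen_add gen_smult gen_mult gen_star)
  moreover have "generators L I p s \<subseteq> D"
    using gen_P gen_S by (auto simp: generators_def D_def hom_p hom_s)
  ultimately have "cstar_generated C (generators L I p s) \<subseteq> D"
    unfolding cstar_generated_def by blast
  then show "\<pi> ` carrier C \<subseteq> gen" unfolding generates by (auto simp: D_def)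
next
  have "closedin X.metric.mtopology (\<pi> ` carrier C)"
  proof (rule X.closedin_convI)
    fix f l assume f: "X.conv f l" "\<And>n. f n \<in> \<pi> ` carrier C"
    then have "\<forall>n. \<exists>x. x \<in> carrier C \<and> f n = \<pi> x" by blast
    then obtain g where g: "\<And>n. g n \<in> carrier C" "\<And>n. f n = \<pi> (g n)" by metis
    have iso: "nrm C (g m \<ominus>\<^bsub>C\<^esub> g n) = nrm X (f m \<ominus>\<^bsub>X\<^esub> f n)" for m n
      using inj_isometric[OF inj, of "g m \<ominus>\<^bsub>C\<^esub> g n"] g by (simp add: hom_diff)
    have "\<exists>k. C.conv g k"
    proof (rule C.cauchy_imp_conv[OF g(1)])
      fix e :: real assume "e > 0"
      then have "\<forall>\<^sub>F n in sequentially. nrm X (f n \<ominus>\<^bsub>X\<^esub> l) < e / 2"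
        using f(1) unfolding X.conv_def by (intro order_tendstoD(2)[of _ 0]) auto
      then obtain N where N: "\<And>n. n \<ge> N \<Longrightarrow> nrm X (f n \<ominus>\<^bsub>X\<^esub> l) < e / 2"
        by (auto simp: eventually_sequentially)
      have "nrm C (g m \<ominus>\<^bsub>C\<^esub> g n) < e" if "m \<ge> N" "n \<ge> N" for m n
        using X.nrm_diff_triangle[of "f m" l "f n"] X.nrm_diff_commute[of l "f n"] N[OF that(1)] N[OF that(2)]
          X.conv_closed[OF f(1)] by (simp add: iso)
      then show "\<exists>N. \<forall>m\<ge>N. \<forall>n\<ge>N. nrm C (g m \<ominus>\<^bsub>C\<^esub> g n) < e" by blast
    qed
    then obtain k where k: "C.conv g k" ..
    have "X.conv f (\<pi> k)" using hom_conv[OF k] by (simp add: g(2)[symmetric])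
    then have "l = \<pi> k" using f(1) by (intro X.conv_unique)
    then show "l \<in> \<pi> ` carrier C" using C.conv_closed(2)[OF k] by simp
  qed auto
  moreover have "\<zero>\<^bsub>X\<^esub> = \<pi> \<zero>\<^bsub>C\<^esub>" by simp
  ultimately have "cstar_subalgebra X (\<pi> ` carrier C)"
    unfolding cstar_subalgebra_def
    by (auto simp: hom_add[symmetric] hom_smult[symmetric] hom_mult[symmetric] hom_star[symmetric]
        simp del: hom_zero intro!: imageI)
  moreover have "generators L I P S \<subseteq> \<pi> ` carrier C"
    using C.P_closed C.S_closed by (auto simp: generators_def hom_p[symmetric] hom_s[symmetric])
  ultimately show "gen \<subseteq> \<pi> ` carrier C"
    unfolding cstar_generated_def by blast
qed

text \<open>\<beta> is \<gamma> conjugated by \<pi>, which is possible because \<pi> is a bijection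
  onto the generated algebra.\<close>

lemma inj_imp_gauge:
  assumes inj: "inj_on \<pi> (carrier C)" and generates: "cstar_generated C (generators L I p s) = carrier C"
    and \<gamma>: "star_hom C C \<gamma>" "\<And>A. \<gamma> (p A) = p A" "\<And>\<alpha> B. \<lbrakk>\<alpha> \<in> L; B \<in> I \<alpha>\<rbrakk> \<Longrightarrow> \<gamma> (s \<alpha> B) = z \<odot>\<^bsub>C\<^esub> s \<alpha> B"
  shows "\<exists>\<beta>. gauge z \<beta>"
proof -
  interpret \<gamma>: cstar_hom C C \<gamma> by unfold_locales (rule \<gamma>(1))
  define \<beta> where "\<beta> y = \<pi> (\<gamma> (inv_into (carrier C) \<pi> y))" for y
  have \<beta>: "\<beta> (\<pi> x) = \<pi> (\<gamma> x)" if "x \<in> carrier C" for x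
    using inj that by (simp add: \<beta>_def)
  have img: "gen = \<pi> ` carrier C" using image_eq_gen[OF inj generates] by simp
  have "star_hom (generated_algebra X L I P S) (generated_algebra X L I P S) \<beta>"
    unfolding star_hom_def generated_algebra_simps unfolding img
    by (auto simp: \<beta> hom_add[symmetric] hom_smult[symmetric] hom_mult[symmetric] hom_star[symmetric]
        \<gamma>.hom_add \<gamma>.hom_smult \<gamma>.hom_mult \<gamma>.hom_star)
  moreover have "\<beta> (P A) = P A" for A
    using \<beta>[of "p A"] by (simp add: hom_p \<gamma>(2))
  moreover have "\<beta> (S \<alpha> B) = z \<odot>\<^bsub>X\<^esub> S \<alpha> B" if "\<alpha> \<in> L" "B \<in> I \<alpha>" for \<alpha> B
    using \<beta>[of "s \<alpha> B"] that by (simp add: hom_s \<gamma>(3) hom_smult)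
  ultimately show ?thesis by (auto simp: gauge_def)
qed

end

theorem corollary6p2:
  fixes L :: "'l set"
    and \<theta> :: "'l \<Rightarrow> 'b::generalized_boolean_algebra \<Rightarrow> 'b"
    and I :: "'l \<Rightarrow> 'b set"
    and C :: "'c cstar" and p :: "'b \<Rightarrow> 'c" and s :: "'l \<Rightarrow> 'b \<Rightarrow> 'c"
    and X :: "'x cstar" and P :: "'b \<Rightarrow> 'x" and S :: "'l \<Rightarrow> 'b \<Rightarrow> 'x"
    and \<pi> :: "'c \<Rightarrow> 'x"
  assumes "generalized_boolean_dynamical_system L \<theta> I"
    and "universal_cuntz_krieger_representation L \<theta> I C p s"
    and "cuntz_krieger_representation L \<theta> I X P S"
    and "star_hom C X \<pi>"
    and "\<And>A. \<pi> (p A) = P A"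
    and "\<And>\<alpha> B. \<alpha> \<in> L \<Longrightarrow> B \<in> I \<alpha> \<Longrightarrow> \<pi> (s \<alpha> B) = S \<alpha> B"
  shows "inj_on \<pi> (carrier C) \<longleftrightarrow>
    (\<forall>A. A \<noteq> bot \<longrightarrow> P A \<noteq> \<zero>\<^bsub>X\<^esub>) \<and>
    (\<forall>z::complex. cmod z = 1 \<longrightarrow>
      (\<exists>\<beta>. star_hom (generated_algebra X L I P S) (generated_algebra X L I P S) \<beta> \<and>
           (\<forall>A. \<beta> (P A) = P A) \<and>
           (\<forall>\<alpha>\<in>L. \<forall>B\<in>I \<alpha>. \<beta> (S \<alpha> B) = z \<odot>\<^bsub>X\<^esub> S \<alpha> B)))"
proof -
  interpret U: universal_cuntz_krieger_representation L \<theta> I C p s by fact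
  interpret X: cuntz_krieger_representation L \<theta> I X P S by fact
  interpret ck_morphism L \<theta> I C p s X P S \<pi>
    by unfold_locales (fact assms)+
  have nz: "P A \<noteq> \<zero>\<^bsub>X\<^esub>" if inj: "inj_on \<pi> (carrier C)" and A: "A \<noteq> bot" for A
  proof
    assume "P A = \<zero>\<^bsub>X\<^esub>"
    then have "\<pi> (p A) = \<pi> \<zero>\<^bsub>C\<^esub>" by (simp add: assms(5))
    then have pA: "p A = \<zero>\<^bsub>C\<^esub>" by (rule inj_onD[OF inj]) auto
    \<comment> \<open>The boundary path representation factors through C, so \<open>p A\<close> = 0
      would force \<open>path_P A\<close> = 0.\<close>
    obtain \<phi> where \<phi>: "star_hom C op_algebra \<phi>" "\<And>A. \<phi> (p A) = U.path_P A"
      using U.universal_property[OF U.path_representation] by blast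
    interpret O: cstar_hom C op_algebra \<phi>
      by (intro cstar_hom.intro cstar_hom_axioms.intro U.cstar_algebra_axioms op_algebra_cstar \<phi>(1))
    have "U.path_P A = 0" using \<phi>(2)[of A] O.hom_zero by (simp add: pA op_algebra_simps)
    then show False using U.path_P_nonzero[OF A] by simp
  qed
  have gauge: "\<exists>\<beta>. gauge z \<beta>" if inj: "inj_on \<pi> (carrier C)" and z: "cmod z = 1" for z
  proof -
    \<comment> \<open>The family with s multiplied by z lives in C itself, so universality yields an
      endomorphism of C.\<close>
    obtain \<gamma> where "star_hom C C \<gamma>" "\<And>A. \<gamma> (p A) = p A"
      "\<And>\<alpha> B. \<lbrakk>\<alpha> \<in> L; B \<in> I \<alpha>\<rbrakk> \<Longrightarrow> \<gamma> (s \<alpha> B) = z \<odot>\<^bsub>C\<^esub> s \<alpha> B"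
      using U.universal_property[OF U.gauge_representation[OF z]] by blast
    then show ?thesis by (rule inj_imp_gauge[OF inj U.generates])
  qed
  show ?thesis
    unfolding gauge_def[symmetric]
    using nz gauge gauge_invariant_uniqueness[OF _ _ U.generates] by blast
qed

end
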